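(* Let $T$ be a Galton-Watson tree with offspring law $p(\cdot)$ on $\{0,1,2,\dots\}$ such that $0<p(0)<1-p(1)$, $\sum_\ell \ell\, p(\ell)=1$ and $\ell^{-1}\log p(\ell)\to-\infty$ as $\ell\to\infty$. Let $\mathcal X$ be a finite alphabet, and let $X$ be a Markov chain indexed by $T$ with arbitrary initial distribution on $\mathcal X$ and an irreducible Markovian transition kernel $Q$ on $\mathcal X$. Then, as $n\to\infty$ along those $n$ with $\mathbb P\{|T|=n\}>0$, the empirical pair measure $L_X$, conditioned on $\{|T|=n\}$, satisfies a large deviation principle in the space of probability vectors on $\mathcal X\times\mathcal X$ with speed $n$ and the convex, good rate function $$I(\mu)=\begin{cases} H(\mu\,\|\,\mu_1\otimes Q)+\displaystyle\sum_{a\in\mathcal X}\mu_2(a)\,I_p\Big(\frac{\mu_1(a)}{\mu_2(a)}\Big) & \text{if }\mu_1\ll\mu_2,\\ \infty & \text{otherwise,}\end{cases}$$ where $\mu_1$ and $\mu_2$ are the first and second marginals of $\mu$ and $\mu_1\otimes Q(a,b)=Q\{b\,|\,a\}\,\mu_1(a)$.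
   Context: Galton-Watson tree: random rooted planar tree in which the numbers of children of the vertices are independent with law $p(\cdot)$; $|T|$ is the number of vertices. Tree-indexed Markov chain: given $T$ with root $\rho$ and vertex set $V$, $X:V\to\mathcal X$ is obtained by choosing $X(\rho)$ from the initial distribution and, for each $v\neq\rho$, choosing $X(v)$ according to $Q\{\cdot\,|\,X(\text{parent of }v)\}$, independently of everything else. Probabilities refer to the joint law of $T$ and $X$. Empirical pair measure: for a finite tree with edge set $E$ (edges oriented away from the root, $e$ going from $e_1$ to $e_2$), $$L_X(a,b)=\frac1{|E|}\sum_{e\in E}\delta_{(X(e_1),X(e_2))}(a,b),\qquad a,b\in\mathcal X.$$ $H(\cdot\,\|\,\cdot)$ is relative entropy: $H(\nu\|\nu')=\int\log\frac{d\nu}{d\nu'}\,d\nu$ if $\nu\ll\nu'$, and $\infty$ otherwise. Cramér's rate function is $$I_p(x)=\sup_{\lambda\in\mathbb R}\Big\{\lambda x-\log\Big[\sum_{n=0}^\infty p(n)e^{\lambda n}\Big]\Big\}.$$ Terms of the sum with $\mu_2(a)=0$ (hence $\mu_1(a)=0$) are taken to be $0$. A large deviation principle with speed $n$ and rate function $I$ for conditional laws $P_n$ means $\limsup\frac1n\log P_n(F)\le-\inf_F I$ for closed $F$ and $\liminf\frac1n\log P_n(O)\ge-\inf_O I$ for open $O$; a rate function is good if its level sets $\{I\le\alpha\}$, $\alpha<\infty$, are compact. *)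

theory Defs
  imports "HOL-Probability.Probability"
begin

section \<open>Random trees and Markov chains indexed by them\<close>

text \<open>
  Rooted planar trees are sets of Ulam-Harris addresses: the root is \<open>[]\<close>, the children of \<open>v\<close>
  are \<open>v @ [0]\<close>, \<open>v @ [1]\<close>, \dots, and the parent of \<open>v \<noteq> []\<close> is \<open>butlast v\<close>.
\<close>

inductive_set planar_tree :: "(nat list \<Rightarrow> nat) \<Rightarrow> nat list set"
  for k :: "nat list \<Rightarrow> nat" where
  root: "[] \<in> planar_tree k"
| child: "v \<in> planar_tree k \<Longrightarrow> i < k v \<Longrightarrow> v @ [i] \<in> planar_tree k"

definition galton_watson_tree :: "'w measure \<Rightarrow> nat pmf \<Rightarrow> ('w \<Rightarrow> nat list set) \<Rightarrow> bool" where
  "galton_watson_tree M p T \<longleftrightarrow> prob_space M \<and>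
     (\<exists>N :: nat list \<Rightarrow> 'w \<Rightarrow> nat.
        prob_space.indep_vars M (\<lambda>_. count_space UNIV) N UNIV \<and>
        (\<forall>v. distr M (count_space UNIV) (N v) = measure_pmf p) \<and>
        (\<forall>\<omega>\<in>space M. T \<omega> = planar_tree (\<lambda>v. N v \<omega>)))"

text \<open>
  The conditional law of the labels \<open>X\<close> given \<open>T\<close>: given that \<open>T\<close>, seen through a finite window
  \<open>W\<close> of addresses, equals \<open>S\<close>, the labels on \<open>S\<close> form a Markov chain along the edges of \<open>S\<close>.
  The windows make the definition meaningful also for infinite \<open>T\<close>; for a finite tree \<open>t\<close>, the
  event \<open>T \<omega> = t\<close> is of the form \<open>T \<omega> \<inter> W = t\<close>. Labels of addresses outside \<open>T \<omega>\<close> are irrelevant.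
\<close>

definition tree_indexed_markov_chain ::
  "'w measure \<Rightarrow> 'a pmf \<Rightarrow> ('a \<Rightarrow> 'a pmf) \<Rightarrow> ('w \<Rightarrow> nat list set) \<Rightarrow> ('w \<Rightarrow> nat list \<Rightarrow> 'a) \<Rightarrow> bool" where
  "tree_indexed_markov_chain M init Q T X \<longleftrightarrow>
     (\<forall>v a. {\<omega> \<in> space M. v \<in> T \<omega> \<and> X \<omega> v = a} \<in> sets M) \<and>
     (\<forall>W S x. finite W \<longrightarrow> [] \<in> W \<longrightarrow> (\<forall>v\<in>W. butlast v \<in> W) \<longrightarrow>
        \<P>(\<omega> in M. T \<omega> \<inter> W = S \<and> (\<forall>v\<in>S. X \<omega> v = x v)) =
        \<P>(\<omega> in M. T \<omega> \<inter> W = S) *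
          (pmf init (x []) * (\<Prod>v\<in>S - {[]}. pmf (Q (x (butlast v))) (x v))))"

primrec step_law :: "('a \<Rightarrow> 'a pmf) \<Rightarrow> nat \<Rightarrow> 'a \<Rightarrow> 'a pmf" where
  "step_law Q 0 a = return_pmf a"
| "step_law Q (Suc n) a = bind_pmf (step_law Q n a) Q"

definition irreducible_kernel :: "('a \<Rightarrow> 'a pmf) \<Rightarrow> bool" where
  "irreducible_kernel Q \<longleftrightarrow> (\<forall>a b. \<exists>n. pmf (step_law Q n a) b > 0)"

definition tree_edges :: "nat list set \<Rightarrow> (nat list \<times> nat list) set" where
  "tree_edges t = {(butlast v, v) | v. v \<in> t \<and> v \<noteq> []}"

definition empirical_pair_measure ::
  "nat list set \<Rightarrow> (nat list \<Rightarrow> 'a) \<Rightarrow> real ^ ('a::finite \<times> 'a)" where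
  "empirical_pair_measure t x =
     (\<chi> ab. (\<Sum>e\<in>tree_edges t. of_bool ((x (fst e), x (snd e)) = ab)) / real (card (tree_edges t)))"


section \<open>Large deviation principles\<close>

text \<open>The real \<open>ln\<close> has \<open>ln 0 = 0\<close>; here the logarithm of \<open>0\<close> is \<open>-\<infinity>\<close> and that of \<open>\<infinity>\<close> is \<open>\<infinity>\<close>.\<close>

definition ext_ln :: "ennreal \<Rightarrow> ereal" where
  "ext_ln x = (if x = 0 then -\<infinity> else if x = top then \<infinity> else ereal (ln (enn2real x)))"

text \<open>
  \<open>P n A\<close> is the probability given to \<open>A \<subseteq> Y\<close> by the \<open>n\<close>-th law, \<open>r\<close> is the speed, and \<open>F\<close> says how
  \<open>n\<close> tends to infinity (e.g. along a set of indices).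
\<close>

definition large_deviation_principle ::
  "'b::topological_space set \<Rightarrow> nat filter \<Rightarrow> (nat \<Rightarrow> real) \<Rightarrow> (nat \<Rightarrow> 'b set \<Rightarrow> real) \<Rightarrow> ('b \<Rightarrow> ereal) \<Rightarrow> bool"
where
  "large_deviation_principle Y F r P I \<longleftrightarrow>
     (\<forall>C. closedin (top_of_set Y) C \<longrightarrow>
        Limsup F (\<lambda>n. ext_ln (ennreal (P n C)) / ereal (r n)) \<le> - (INF x\<in>C. I x)) \<and>
     (\<forall>U. openin (top_of_set Y) U \<longrightarrow>
        Liminf F (\<lambda>n. ext_ln (ennreal (P n U)) / ereal (r n)) \<ge> - (INF x\<in>U. I x))"

text \<open>In a Hausdorff space, compactness of the level sets entails lower semicontinuity of \<open>I\<close>.\<close>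

definition good_rate_function :: "'b::t2_space set \<Rightarrow> ('b \<Rightarrow> ereal) \<Rightarrow> bool" where
  "good_rate_function Y I \<longleftrightarrow>
     (\<forall>x\<in>Y. 0 \<le> I x) \<and> (\<forall>\<alpha>::real. compact {x \<in> Y. I x \<le> ereal \<alpha>})"

definition ereal_convex_on :: "'b::real_vector set \<Rightarrow> ('b \<Rightarrow> ereal) \<Rightarrow> bool" where
  "ereal_convex_on Y I \<longleftrightarrow> convex Y \<and>
     (\<forall>x\<in>Y. \<forall>y\<in>Y. \<forall>t\<in>{0..1}.
        I ((1 - t) *\<^sub>R x + t *\<^sub>R y) \<le> ereal (1 - t) * I x + ereal t * I y)"


section \<open>The rate function\<close>

text \<open>Measures on a finite type are represented by their vectors of point masses.\<close>

definition prob_vectors :: "(real ^ 'i::finite) set" where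
  "prob_vectors = {\<mu>. (\<forall>i. 0 \<le> \<mu> $ i) \<and> (\<Sum>i\<in>UNIV. \<mu> $ i) = 1}"

definition vec_measure :: "real ^ 'i::finite \<Rightarrow> 'i measure" where
  "vec_measure \<mu> = point_measure UNIV (\<lambda>i. ennreal (\<mu> $ i))"

definition marginal1 :: "real ^ ('a::finite \<times> 'b::finite) \<Rightarrow> real ^ 'a" where
  "marginal1 \<mu> = (\<chi> a. \<Sum>b\<in>UNIV. \<mu> $ (a, b))"

definition marginal2 :: "real ^ ('a::finite \<times> 'b::finite) \<Rightarrow> real ^ 'b" where
  "marginal2 \<mu> = (\<chi> b. \<Sum>a\<in>UNIV. \<mu> $ (a, b))"

definition kernel_product :: "real ^ 'a::finite \<Rightarrow> ('a \<Rightarrow> 'b pmf) \<Rightarrow> real ^ ('a \<times> 'b::finite)" where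
  "kernel_product \<nu> Q = (\<chi> ab. pmf (Q (fst ab)) (snd ab) * \<nu> $ fst ab)"

text \<open>
  Mind the argument order of the library notions: \<open>absolutely_continuous \<nu>' \<nu>\<close> means \<open>\<nu> \<lless> \<nu>'\<close>, and
  \<open>KL_divergence b \<nu>' \<nu>\<close> integrates the base-\<open>b\<close> logarithm of \<open>d\<nu>/d\<nu>'\<close> with respect to \<open>\<nu>\<close>. This
  integral always exists for the measures on finite spaces considered here.
\<close>

definition relative_entropy :: "'b measure \<Rightarrow> 'b measure \<Rightarrow> ereal" where
  "relative_entropy \<nu> \<nu>' =
     (if absolutely_continuous \<nu>' \<nu> then ereal (KL_divergence (exp 1) \<nu>' \<nu>) else \<infinity>)"

definition cramer_rate :: "nat pmf \<Rightarrow> real \<Rightarrow> ereal" where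
  "cramer_rate p x =
     (SUP l::real. ereal (l * x) - ext_ln (\<Sum>n. ennreal (pmf p n * exp (l * real n))))"

definition pair_rate_function ::
  "nat pmf \<Rightarrow> ('a::finite \<Rightarrow> 'a pmf) \<Rightarrow> real ^ ('a \<times> 'a) \<Rightarrow> ereal" where
  "pair_rate_function p Q \<mu> =
     (if absolutely_continuous (vec_measure (marginal2 \<mu>)) (vec_measure (marginal1 \<mu>))
      then relative_entropy (vec_measure \<mu>) (vec_measure (kernel_product (marginal1 \<mu>) Q)) +
           (\<Sum>a\<in>UNIV. if marginal2 \<mu> $ a = 0 then 0
                      else ereal (marginal2 \<mu> $ a) * cramer_rate p (marginal1 \<mu> $ a / marginal2 \<mu> $ a))
      else \<infinity>)"

lemma absolutely_continuous_vec_measure: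
  fixes \<mu> \<nu> :: "real ^ 'i::finite"
  assumes "\<And>i. 0 \<le> \<mu> $ i" "\<And>i. 0 \<le> \<nu> $ i"
  shows "absolutely_continuous (vec_measure \<nu>) (vec_measure \<mu>) \<longleftrightarrow> (\<forall>i. \<nu> $ i = 0 \<longrightarrow> \<mu> $ i = 0)"
proof -
  have null: "A \<in> null_sets (vec_measure \<xi>) \<longleftrightarrow> (\<forall>i\<in>A. \<xi> $ i = 0)"
    if "\<And>i. 0 \<le> \<xi> $ i" for \<xi> :: "real ^ 'i" and A
  proof -
    have "A \<in> null_sets (vec_measure \<xi>) \<longleftrightarrow> (\<Sum>i\<in>A. ennreal (\<xi> $ i)) = 0"
      by (simp add: null_sets_def vec_measure_def sets_point_measure emeasure_point_measure_finite
          del: sum_ennreal)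
    also have "\<dots> \<longleftrightarrow> (\<forall>i\<in>A. ennreal (\<xi> $ i) = 0)"
      by (rule sum_eq_0_iff) simp
    also have "\<dots> \<longleftrightarrow> (\<forall>i\<in>A. \<xi> $ i = 0)"
      by (intro ball_cong refl) (use that in \<open>metis ennreal_eq_0_iff order_antisym order_refl\<close>)
    finally show ?thesis .
  qed
  show ?thesis
  proof
    assume ac: "absolutely_continuous (vec_measure \<nu>) (vec_measure \<mu>)"
    show "\<forall>i. \<nu> $ i = 0 \<longrightarrow> \<mu> $ i = 0"
    proof (intro allI impI)
      fix i assume "\<nu> $ i = 0"
      then have "{i} \<in> null_sets (vec_measure \<nu>)"
        using null[OF assms(2), of "{i}"] by simp
      then have "{i} \<in> null_sets (vec_measure \<mu>)"
        using ac unfolding absolutely_continuous_def by (rule rev_subsetD)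
      then show "\<mu> $ i = 0"
        using null[OF assms(1), of "{i}"] by simp
    qed
  next
    assume "\<forall>i. \<nu> $ i = 0 \<longrightarrow> \<mu> $ i = 0"
    then show "absolutely_continuous (vec_measure \<nu>) (vec_measure \<mu>)"
      unfolding absolutely_continuous_def subset_iff null[OF assms(1)] null[OF assms(2)] by blast
  qed
qed

lemma relative_entropy_vec_measure:
  fixes \<mu> \<nu> :: "real ^ 'i::finite"
  assumes "\<And>i. 0 \<le> \<mu> $ i" "\<And>i. 0 \<le> \<nu> $ i"
  shows "relative_entropy (vec_measure \<mu>) (vec_measure \<nu>) =
    (if \<forall>i. \<nu> $ i = 0 \<longrightarrow> \<mu> $ i = 0
     then ereal (\<Sum>i\<in>UNIV. \<mu> $ i * ln (\<mu> $ i / \<nu> $ i)) else \<infinity>)"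
proof (cases "\<forall>i. \<nu> $ i = 0 \<longrightarrow> \<mu> $ i = 0")
  case True
  interpret sigma_finite_measure "count_space (UNIV :: 'i set)"
    by (rule sigma_finite_measure_count_space_finite) simp
  have "KL_divergence (exp 1) (vec_measure \<nu>) (vec_measure \<mu>) =
      (\<integral>i. \<mu> $ i * log (exp 1) (\<mu> $ i / \<nu> $ i) \<partial>count_space UNIV)"
    unfolding vec_measure_def point_measure_def
    by (rule KL_density_density) (use assms True in \<open>auto simp: AE_count_space\<close>)
  also have "\<dots> = (\<Sum>i\<in>UNIV. \<mu> $ i * ln (\<mu> $ i / \<nu> $ i))"
    by (simp add: lebesgue_integral_count_space_finite log_def)
  finally show ?thesis
    using True
    by (simp only: relative_entropy_def absolutely_continuous_vec_measure[OF assms] if_True simp_thms)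
next
  case False
  then show ?thesis
    by (simp only: relative_entropy_def absolutely_continuous_vec_measure[OF assms] if_False)
qed

end

theory Submission
  imports Defs
begin

text \<open>
  Weight a labelled tree by its probability times \<open>exp (\<Sum>e. g e - ln (gf (normal g b)))\<close>, the sum
  running over the edges \<open>e = (a, b)\<close>, where \<open>gf\<close> is the offspring generating function and
  \<open>normal g a = \<Sum>b. Q a b * exp (g (a, b))\<close>. For every \<open>g\<close> the total mass is finite, so Chernoff's
  bound gives the rate \<open>lin_rate g \<mu>\<close>, linear in \<open>\<mu>\<close>, and the rate function is the supremum of
  these linear functions; convexity, goodness and the upper bound follow.

  For the lower bound, a vector \<open>\<mu>\<close> of finite rate is mixed with the stationary pair measure; the mixture
  is the critical pair measure of a suitable tilt. The upper bound applied to the tilted weights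
  concentrates the empirical pair measure at \<open>\<mu>\<close>, provided that the tilted mass of the trees of
  size \<open>n\<close> decays subexponentially. It does: these masses are supermultiplicative, since two trees
  can be grafted onto a fixed one, and their generating function diverges to the right of \<open>1\<close> by
  criticality and convexity of \<open>gf\<close>.
\<close>

section \<open>Labelled plane trees and their weights\<close>

text \<open>Some features shape the details. The compensation \<open>ln (gf (normal g b))\<close>
  sits at the lower end of an edge, so only the root stays uncompensated; this costs a factor
  bounded in n. The initial distribution may vanish at some letters and is likewise carried as a
  bounded factor at the root. The supremum over g need not be attained: if \<mu> vanishes where Q
  does not, or if the ratio of its marginals at some letter is the largest possible offspring
  number, the optimal tilt runs off to infinity. Mixing with the stationary pair measure, where the
  rate is zero, cures both defects without raising the rate, because \<open>lin_rate g\<close> is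
  linear. Concentration needs uniqueness in one direction only: for a given tilt, a single pair
  measure solves the first-order equation. The probability of size n is never computed
  asymptotically; a bound below it by every decaying exponential, along the sizes that occur, is
  enough and allows for periodicity.\<close>

datatype 'a ltree = LNode (lab: 'a) (subtrees: "'a ltree list")

primrec tsize :: "'a ltree \<Rightarrow> nat" where
  "tsize (LNode a ts) = Suc (sum_list (map tsize ts))"

text \<open>Nested primitive recursion sees the recursive calls only through
  \<open>map (weight u q) ts\<close>, so \<open>map2\<close> pairs them with the subtree labels;
  \<open>weight_LNode\<close> is the form in use. The root label gives no factor: an edge is charged
  to its upper vertex, and the initial distribution is multiplied in separately.\<close>

primrec weight :: "(nat \<Rightarrow> real) \<Rightarrow> ('a \<Rightarrow> 'a \<Rightarrow> real) \<Rightarrow> 'a ltree \<Rightarrow> real" where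
  "weight u q (LNode a ts) =
     u (length ts) * prod_list (map2 (\<lambda>t w. q a (lab t) * w) ts (map (weight u q) ts))"

primrec edge_count :: "'a ltree \<Rightarrow> 'a \<times> 'a \<Rightarrow> real" where
  "edge_count (LNode a ts) = (\<lambda>e.
     sum_list (map2 (\<lambda>t c. of_bool ((a, lab t) = e) + c e) ts (map edge_count ts)))"

lemma map2_map_right: "map2 f xs (map g xs) = map (\<lambda>x. f x (g x)) xs"
  by (induction xs) auto

lemma weight_LNode:
  "weight u q (LNode a ts) = u (length ts) * (\<Prod>t\<leftarrow>ts. q a (lab t) * weight u q t)"
  by (simp add: map2_map_right)

lemma edge_count_LNode:
  "edge_count (LNode a ts) e = (\<Sum>t\<leftarrow>ts. of_bool ((a, lab t) = e) + edge_count t e)"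
  by (simp add: map2_map_right)

declare weight.simps [simp del] edge_count.simps [simp del]
declare weight_LNode [simp] edge_count_LNode [simp]

lemma tsize_pos: "0 < tsize t"
  by (cases t) simp

lemma tsize_neq_0 [simp]: "tsize t \<noteq> 0"
  using tsize_pos[of t] by simp

lemma tsize_le_subtrees: "t \<in> set ts \<Longrightarrow> tsize t \<le> sum_list (map tsize ts)"
  by (simp add: member_le_sum_list)

lemma length_le_sum_tsize: "length ts \<le> sum_list (map tsize ts)"
proof (induction ts)
  case (Cons t ts)
  with tsize_pos[of t] show ?case by simp
qed simp

lemma finite_trees_le: "finite {t :: 'a::finite ltree. tsize t \<le> n}"
proof (induction n)
  case 0
  show ?case by simp
next
  case (Suc n)
  have "{t :: 'a ltree. tsize t \<le> Suc n} \<subseteq>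
      (\<lambda>(a, ts). LNode a ts) ` (UNIV \<times> {ts. set ts \<subseteq> {t. tsize t \<le> n} \<and> length ts \<le> n})"
  proof
    fix t :: "'a ltree"
    assume "t \<in> {t. tsize t \<le> Suc n}"
    then obtain a ts where t: "t = LNode a ts" and s: "sum_list (map tsize ts) \<le> n"
      by (cases t) auto
    then show "t \<in> (\<lambda>(a, ts). LNode a ts) `
        (UNIV \<times> {ts. set ts \<subseteq> {t. tsize t \<le> n} \<and> length ts \<le> n})"
      using tsize_le_subtrees[of _ ts] length_le_sum_tsize[of ts] by (force simp: image_iff)
  qed
  moreover have "finite (\<dots> :: 'a ltree set)"
    using Suc by (intro finite_imageI finite_cartesian_product finite_lists_length_le) auto
  ultimately show ?case
    by (rule finite_subset)
qed

lemma finite_trees_eq: "finite {t :: 'a::finite ltree. tsize t = n \<and> P t}"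
  by (rule finite_subset[OF _ finite_trees_le[of n]]) auto

section \<open>Sums over lists of subtrees\<close>

lemma sum_listset_prod_list:
  fixes f :: "'b \<Rightarrow> real"
  shows "(\<Sum>xs\<in>listset As. prod_list (map f xs)) = prod_list (map (sum f) As)"
proof (induction As)
  case (Cons A As)
  have "bij_betw (\<lambda>(x, xs). x # xs) (A \<times> listset As) (listset (A # As))"
    by (auto simp: bij_betw_def inj_on_def set_Cons_def)
  then have "(\<Sum>xs\<in>listset (A # As). prod_list (map f xs)) =
      (\<Sum>(x, xs)\<in>A \<times> listset As. f x * prod_list (map f xs))"
    by (subst sum.reindex_bij_betw[symmetric, where h="\<lambda>(x, xs). x # xs"]) (auto simp: case_prod_beta)
  also have "\<dots> = sum f A * (\<Sum>xs\<in>listset As. prod_list (map f xs))"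
    by (simp add: sum_product sum.cartesian_product)
  finally show ?case
    by (simp add: Cons)
qed simp

text \<open>Distributivity turns the choice of subtrees into a product: the branching recursion for
  masses in finite form. It is used with all entries of \<open>As\<close> equal (subtrees of bounded
  size) and with entries of prescribed sizes.\<close>

lemma sum_weight_listset:
  "(\<Sum>t\<in>LNode a ` listset As. weight u q t) =
     u (length As) * (\<Prod>A\<leftarrow>As. \<Sum>t\<in>A. q a (lab t) * weight u q t)"
proof -
  have len: "length ts = length As" if "ts \<in> listset As" for ts
    using that by (induction As arbitrary: ts) (auto simp: set_Cons_def)
  have "(\<Sum>t\<in>LNode a ` listset As. weight u q t) = (\<Sum>ts\<in>listset As. weight u q (LNode a ts))"
    by (subst sum.reindex) (auto simp: inj_on_def)
  also have "\<dots> = (\<Sum>ts\<in>listset As. u (length As) * (\<Prod>t\<leftarrow>ts. q a (lab t) * weight u q t))"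
    by (intro sum.cong refl) (simp add: len)
  finally show ?thesis
    by (simp add: sum_listset_prod_list flip: sum_distrib_left)
qed

lemma listset_replicate: "listset (replicate k A) = {ts. set ts \<subseteq> A \<and> length ts = k}"
proof (induction k)
  case (Suc k)
  then show ?case
    by (auto simp: set_Cons_def length_Suc_conv)
qed auto

lemma weight_nonneg:
  assumes "\<And>k. 0 \<le> u k" "\<And>a b. 0 \<le> q a b"
  shows "0 \<le> weight u q t"
  by (induction t) (auto intro!: mult_nonneg_nonneg prod_list_nonneg assms)

text \<open>One factor s per vertex: sums of these weights over trees of size at most n are partial
  sums, at s, of the generating function of the masses by size.\<close>

lemma weight_scale: "weight (\<lambda>k. s * u k) q t = s ^ tsize t * weight u q t"
proof (induction t)
  case (LNode a ts)
  have "(\<Prod>t\<leftarrow>ts. q a (lab t) * weight (\<lambda>k. s * u k) q t) =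
      s ^ sum_list (map tsize ts) * (\<Prod>t\<leftarrow>ts. q a (lab t) * weight u q t)"
    using LNode by (induction ts) (auto simp: power_add)
  then show ?case by simp
qed

lemma sum_lab:
  fixes f :: "'a::finite ltree \<Rightarrow> real"
  assumes "finite A"
  shows "(\<Sum>t\<in>A. f t) = (\<Sum>b\<in>UNIV. \<Sum>t | t \<in> A \<and> lab t = b. f t)"
  using sum.group[OF assms, of UNIV lab f] by simp

section \<open>Masses by root label and size\<close>

definition tmass :: "(nat \<Rightarrow> real) \<Rightarrow> ('a::finite \<Rightarrow> 'a \<Rightarrow> real) \<Rightarrow> 'a \<Rightarrow> nat \<Rightarrow> real" where
  "tmass u q a n = (\<Sum>t | tsize t = n \<and> lab t = a. weight u q t)"

text \<open>Truncation by size keeps every mass a finite sum; the total mass occurs only through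
  uniform bounds on \<open>cmass\<close> or as its limit.\<close>

definition cmass :: "(nat \<Rightarrow> real) \<Rightarrow> ('a::finite \<Rightarrow> 'a \<Rightarrow> real) \<Rightarrow> 'a \<Rightarrow> nat \<Rightarrow> real" where
  "cmass u q a n = (\<Sum>t | tsize t \<le> n \<and> lab t = a. weight u q t)"

lemma finite_trees_le': "finite {t :: 'a::finite ltree. tsize t \<le> n \<and> P t}"
  by (rule finite_subset[OF _ finite_trees_le[of n]]) auto

lemma cmass_eq_sum: "cmass u q a n = (\<Sum>k\<le>n. tmass u q a k)"
  unfolding cmass_def tmass_def
  by (subst sum.group[where g=tsize and T="{..n}", symmetric])
     (auto simp: finite_trees_le' intro!: sum.cong Collect_cong)

context
  fixes u :: "nat \<Rightarrow> real" and q :: "'a::finite \<Rightarrow> 'a \<Rightarrow> real"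
  assumes u: "\<And>k. 0 \<le> u k" and q: "\<And>a b. 0 \<le> q a b"
begin

lemma tmass_nonneg: "0 \<le> tmass u q a n"
  unfolding tmass_def by (intro sum_nonneg weight_nonneg u q)

lemma cmass_nonneg: "0 \<le> cmass u q a n"
  unfolding cmass_def by (intro sum_nonneg weight_nonneg u q)

lemma cmass_mono: "m \<le> n \<Longrightarrow> cmass u q a m \<le> cmass u q a n"
  unfolding cmass_def by (intro sum_mono2) (auto simp: finite_trees_le' intro: weight_nonneg u q)

lemma sum_weight_children_cmass:
  "(\<Sum>t | tsize t \<le> n. q a (lab t) * weight u q t) = (\<Sum>b\<in>UNIV. q a b * cmass u q b n)"
  unfolding cmass_def sum_distrib_left
  by (subst sum_lab[OF finite_trees_le]) (auto intro!: sum.cong)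

lemma sum_weight_children_tmass:
  "(\<Sum>t | tsize t = n. q a (lab t) * weight u q t) = (\<Sum>b\<in>UNIV. q a b * tmass u q b n)"
  unfolding tmass_def sum_distrib_left
  by (subst sum_lab) (auto intro!: sum.cong simp: finite_trees_eq[where P="\<lambda>_. True", simplified])

text \<open>With at most m children and subtrees of size at most n, the recursion is an identity of
  finite sums. \<open>cmass_le_fixpoint\<close> and \<open>sum_lists_le_cmass\<close> place this set
  of trees between two truncations by size.\<close>

lemma sum_weight_lists_cmass:
  "(\<Sum>t\<in>(\<Union>k\<le>m. LNode a ` listset (replicate k {t. tsize t \<le> n})). weight u q t) =
     (\<Sum>k\<le>m. u k * (\<Sum>b\<in>UNIV. q a b * cmass u q b n) ^ k)"
proof -
  have fin: "finite (LNode a ` listset (replicate k {t :: 'a ltree. tsize t \<le> n}))" for k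
    unfolding listset_replicate by (intro finite_imageI finite_lists_length_eq finite_trees_le)
  have "(\<Sum>t\<in>(\<Union>k\<le>m. LNode a ` listset (replicate k {t. tsize t \<le> n})). weight u q t) =
      (\<Sum>k\<le>m. \<Sum>t\<in>LNode a ` listset (replicate k {t. tsize t \<le> n}). weight u q t)"
    by (intro sum.UNION_disjoint) (use fin in \<open>auto simp: listset_replicate\<close>)
  also have "\<dots> = (\<Sum>k\<le>m. u k * (\<Sum>b\<in>UNIV. q a b * cmass u q b n) ^ k)"
    by (simp add: sum_weight_listset sum_weight_children_cmass prod_list_replicate)
  finally show ?thesis .
qed

text \<open>As with the extinction probability, iterating the recursion from below never overtakes a
  supersolution r. Bounding the partial sums over k expresses this property of r without a
  convergence hypothesis.\<close>

lemma cmass_le_fixpoint: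
  assumes r: "\<And>a. 0 \<le> r a"
    and sub: "\<And>a m. (\<Sum>k\<le>m. u k * (\<Sum>b\<in>UNIV. q a b * r b) ^ k) \<le> r a"
  shows "cmass u q a n \<le> r a"
proof (induction n arbitrary: a)
  case 0
  show ?case
    unfolding cmass_def using r by simp
next
  case (Suc n)
  let ?S = "\<Union>k\<le>n. LNode a ` listset (replicate k {t :: 'a ltree. tsize t \<le> n})"
  have "{t. tsize t \<le> Suc n \<and> lab t = a} \<subseteq> ?S"
  proof
    fix t :: "'a ltree"
    assume "t \<in> {t. tsize t \<le> Suc n \<and> lab t = a}"
    then obtain ts where t: "t = LNode a ts" and s: "sum_list (map tsize ts) \<le> n"
      by (cases t) auto
    then show "t \<in> ?S"
      using tsize_le_subtrees[of _ ts] length_le_sum_tsize[of ts]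
      by (force simp: listset_replicate)
  qed
  moreover have "finite ?S"
    unfolding listset_replicate by (intro finite_UN_I finite_imageI finite_lists_length_eq finite_trees_le) auto
  ultimately have "cmass u q a (Suc n) \<le> (\<Sum>t\<in>?S. weight u q t)"
    unfolding cmass_def by (intro sum_mono2) (auto intro: weight_nonneg u q)
  also have "\<dots> = (\<Sum>k\<le>n. u k * (\<Sum>b\<in>UNIV. q a b * cmass u q b n) ^ k)"
    by (rule sum_weight_lists_cmass)
  also have "\<dots> \<le> (\<Sum>k\<le>n. u k * (\<Sum>b\<in>UNIV. q a b * r b) ^ k)"
    by (intro sum_mono mult_left_mono power_mono sum_nonneg mult_nonneg_nonneg) (auto simp: u q Suc cmass_nonneg)
  also have "\<dots> \<le> r a"
    by (rule sub)
  finally show ?case .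
qed

lemma sum_lists_le_cmass:
  "(\<Sum>k\<le>m. u k * (\<Sum>b\<in>UNIV. q a b * cmass u q b n) ^ k) \<le> cmass u q a (Suc (m * n))"
proof -
  have "sum_list (map tsize ts) \<le> m * n" if "\<forall>t\<in>set ts. tsize t \<le> n" "length ts \<le> m" for ts :: "'a ltree list"
  proof -
    have "sum_list (map tsize ts) \<le> length ts * n"
      using that(1) by (induction ts) auto
    then show ?thesis
      using mult_le_mono1[OF that(2), of n] by linarith
  qed
  then show ?thesis
    unfolding sum_weight_lists_cmass[symmetric] unfolding cmass_def
    by (intro sum_mono2) (auto simp: finite_trees_le' listset_replicate subset_iff intro: weight_nonneg u q)
qed

text \<open>Grafting trees of prescribed sizes, in this order, onto a new root yields only some of
  the trees of the resulting size, hence an inequality. All lower bounds on masses by grafting come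
  from here.\<close>

lemma tmass_join:
  "u (length ns) * (\<Prod>n\<leftarrow>ns. \<Sum>b\<in>UNIV. q a b * tmass u q b n) \<le> tmass u q a (Suc (sum_list ns))"
proof -
  let ?As = "map (\<lambda>n. {t :: 'a ltree. tsize t = n}) ns"
  have sz: "sum_list (map tsize ts) = sum_list ns" if "ts \<in> listset ?As" for ts
    using that by (induction ns arbitrary: ts) (auto simp: set_Cons_def)
  have "u (length ns) * (\<Prod>n\<leftarrow>ns. \<Sum>b\<in>UNIV. q a b * tmass u q b n) =
      (\<Sum>t\<in>LNode a ` listset ?As. weight u q t)"
    by (simp add: sum_weight_listset sum_weight_children_tmass o_def)
  also have "\<dots> \<le> tmass u q a (Suc (sum_list ns))"
    unfolding tmass_def by (intro sum_mono2) (use sz in \<open>auto simp: finite_trees_eq intro: weight_nonneg u q\<close>)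
  finally show ?thesis .
qed

end

section \<open>Critical weights\<close>

text \<open>As in Fekete's lemma: along each residue class modulo \<open>m + k\<close> every step of length \<open>m + k\<close>
  multiplies \<open>A\<close> by at least \<open>\<kappa> * A m\<close>.\<close>

lemma supermultiplicative_lower_bound:
  fixes A :: "nat \<Rightarrow> real"
  assumes nonneg: "\<And>n. 0 \<le> A n" and \<kappa>: "0 \<le> \<kappa>"
    and super: "\<And>m n. \<kappa> * A m * A n \<le> A (m + n + k)"
    and m: "0 < m + k" "exp (- \<delta> * real (m + k)) \<le> \<kappa> * A m" and \<delta>: "0 < \<delta>"
  shows "\<exists>C>0. \<forall>n. 0 < A n \<longrightarrow> C * exp (- \<delta> * real n) \<le> A n"
proof -
  define d where "d = m + k"
  define R where "R r = (LEAST n. n mod d = r \<and> 0 < A n)" for r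
  \<comment> \<open>The 1 keeps \<open>Min\<close> meaningful when no residue class contains a
    positive value.\<close>
  define C where "C = Min (insert 1 ((A \<circ> R) ` {r. r < d \<and> (\<exists>n. n mod d = r \<and> 0 < A n)}))"
  have d: "0 < d" using m(1) by (simp add: d_def)
  have R: "R r mod d = r \<and> 0 < A (R r)" if "\<exists>n. n mod d = r \<and> 0 < A n" for r
    unfolding R_def using LeastI_ex[OF that] .
  have fin: "finite ((A \<circ> R) ` {r. r < d \<and> (\<exists>n. n mod d = r \<and> 0 < A n)})"
    by (rule finite_imageI, rule finite_subset[of _ "{..<d}"]) auto
  have "0 < C"
    unfolding C_def using fin R by (subst Min_gr_iff) auto
  moreover have "C * exp (- \<delta> * real n) \<le> A n" if n: "0 < A n" for n
  proof -
    define r where "r = R (n mod d)"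
    have ex: "\<exists>n'. n' mod d = n mod d \<and> 0 < A n'" using n by auto
    have r: "r mod d = n mod d" "0 < A r" using R[OF ex] by (auto simp: r_def)
    have "r \<le> n" unfolding r_def R_def using n by (intro Least_le) auto
    then obtain j where j: "n = r + j * d"
      using r(1) by (metis mod_eq_nat2E mult.commute)
    have step: "A r * exp (- \<delta> * real (i * d)) \<le> A (r + i * d)" for i
    proof (induction i)
      case (Suc i)
      have "A r * exp (- \<delta> * real (Suc i * d)) = (A r * exp (- \<delta> * real (i * d))) * exp (- \<delta> * real d)"
        by (simp add: algebra_simps flip: exp_add)
      also have "\<dots> \<le> A (r + i * d) * (\<kappa> * A m)"
        using Suc m(2) by (intro mult_mono) (auto simp: d_def nonneg)
      also have "\<dots> = \<kappa> * A (r + i * d) * A m" by simp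
      also have "\<dots> \<le> A (r + i * d + m + k)" by (rule super)
      finally show ?case by (simp add: d_def algebra_simps)
    qed simp
    have "C \<le> A r"
      unfolding C_def r_def using fin ex d by (intro Min_le) auto
    then have "C * exp (- \<delta> * real n) \<le> A r * exp (- \<delta> * real (j * d))"
      using \<delta> \<open>0 < A r\<close> by (intro mult_mono) (auto simp: j)
    also have "\<dots> \<le> A n" using step[of j] by (simp add: j)
    finally show ?thesis .
  qed
  ultimately show ?thesis by auto
qed

section \<open>The offspring generating function\<close>

lemma power_tangent:
  fixes x y :: real
  assumes "0 \<le> x" "0 \<le> y"
  shows "y ^ k + real k * y ^ (k - Suc 0) * (x - y) \<le> x ^ k"
proof (induction k)
  case (Suc k)
  \<comment> \<open>Convexity of powers without calculus: x times the tangent for k exceeds the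
    tangent for k + 1 by exactly this remainder. At k = 0 the truncated exponent is harmless because
    of the factor \<open>real k\<close>.\<close>
  have "0 \<le> real k * y ^ (k - Suc 0) * (x - y)\<^sup>2" using assms by simp
  also have "\<dots> = x * (y ^ k + real k * y ^ (k - Suc 0) * (x - y)) - (y ^ Suc k + real (Suc k) * y ^ k * (x - y))"
    by (cases k) (simp_all add: algebra_simps power2_eq_square)
  also have "\<dots> \<le> x * x ^ k - (y ^ Suc k + real (Suc k) * y ^ k * (x - y))"
    using Suc assms by (intro diff_right_mono mult_left_mono)
  finally show ?case by simp
qed simp

text \<open>The superexponential decay of the offspring law enters only through
  \<open>p_summable\<close>: the generating function is entire, so no exponential tilt leaves its
  domain.\<close>

locale offspring_law =
  fixes p :: "nat \<Rightarrow> real"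
  assumes p_nonneg: "\<And>k. 0 \<le> p k"
    and p_sums: "p sums 1"
    and mean_sums: "(\<lambda>k. real k * p k) sums 1"
    and p_summable: "\<And>z. summable (\<lambda>k. p k * z ^ k)"
    and p_0: "0 < p 0"
    and branching: "\<exists>K\<ge>2. 0 < p K"
begin

definition gf :: "real \<Rightarrow> real" where
  "gf z = (\<Sum>k. p k * z ^ k)"

definition gf' :: "real \<Rightarrow> real" where
  "gf' z = (\<Sum>k. diffs p k * z ^ k)"

lemma gf_sums: "(\<lambda>k. p k * z ^ k) sums gf z"
  unfolding gf_def by (intro summable_sums p_summable)

lemma gf_has_derivative: "(gf has_field_derivative gf' z) (at z)"
  unfolding gf_def[abs_def] gf'_def by (rule termdiffs_strong_converges_everywhere[OF p_summable])

lemma gf'_sums: "(\<lambda>k. real k * p k * z ^ (k - Suc 0)) sums gf' z"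
  unfolding gf'_def by (rule diffs_equiv) (rule termdiff_converges_all[OF p_summable])

lemma gf_1: "gf 1 = 1"
  using gf_sums[of 1] p_sums by (simp add: sums_unique2)

lemma gf'_1: "gf' 1 = 1"
  using gf'_sums[of 1] mean_sums by (simp add: sums_unique2)

lemma gf_ge_partial: "0 \<le> z \<Longrightarrow> (\<Sum>k\<le>m. p k * z ^ k) \<le> gf z"
  unfolding gf_def by (intro sum_le_suminf p_summable) (auto simp: p_nonneg)

lemma gf_ge_term: "0 \<le> z \<Longrightarrow> p k * z ^ k \<le> gf z"
  using order_trans[OF member_le_sum[of k "{..k}" "\<lambda>k. p k * z ^ k"] gf_ge_partial[of z k]]
  by (simp add: p_nonneg)

lemma gf_pos: "0 \<le> z \<Longrightarrow> 0 < gf z"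
  using gf_ge_term[of z 0] p_0 by simp

text \<open>Termwise \<open>power_tangent\<close>. At y = 1 criticality, that is
  \<open>gf 1 = 1\<close> and \<open>gf' 1 = 1\<close>, turns it into x \<le>
  \<open>gf x\<close>.\<close>

lemma gf_tangent:
  assumes "0 \<le> x" "0 \<le> y"
  shows "gf y + gf' y * (x - y) \<le> gf x"
proof (rule sums_le[OF _ _ gf_sums])
  show "(\<lambda>k. p k * y ^ k + real k * p k * y ^ (k - Suc 0) * (x - y)) sums (gf y + gf' y * (x - y))"
    by (intro sums_add sums_mult2 gf_sums gf'_sums)
  show "p k * y ^ k + real k * p k * y ^ (k - Suc 0) * (x - y) \<le> p k * x ^ k" for k
    using mult_left_mono[OF power_tangent[OF assms, of k] p_nonneg[of k]] by (simp add: algebra_simps)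
qed

lemma gf'_pos: "0 < z \<Longrightarrow> 0 < gf' z"
proof -
  assume z: "0 < z"
  obtain K where K: "K \<ge> 2" "0 < p K" using branching by auto
  have "0 < (\<Sum>k. real k * p k * z ^ (k - Suc 0))"
    using K z by (intro suminf_pos2[where i=K] sums_summable[OF gf'_sums]) (auto simp: p_nonneg)
  then show ?thesis using sums_unique[OF gf'_sums[of z]] by simp
qed

end

text \<open>q stands for a tilted kernel, whose rows need not sum to 1. Irreducibility is
  reachability in the graph of positive entries because tilting preserves this graph. The closure is
  reflexive, so over a one-letter alphabet it is \<open>q_row\<close> that supplies a
  successor.\<close>

locale branching_weight = offspring_law p for p +
  fixes q :: "'a::finite \<Rightarrow> 'a \<Rightarrow> real"
  assumes q_nonneg: "\<And>a b. 0 \<le> q a b"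
    and q_row: "\<And>a. \<exists>b. 0 < q a b"
    and q_irreducible: "\<And>a b. (a, b) \<in> {(a, b). 0 < q a b}\<^sup>*"
begin

section \<open>Grafting trees onto a common root\<close>

lemma tmass_1: "0 < tmass p q a 1"
  using tmass_join[of p q "[]" a, OF p_nonneg q_nonneg] p_0 by simp

text \<open>The mass of the branches of size n that can hang below a vertex labelled a, the
  connecting edge included.\<close>

definition dmass :: "'a \<Rightarrow> nat \<Rightarrow> real" where
  "dmass a n = (\<Sum>b\<in>UNIV. q a b * tmass p q b n)"

lemma dmass_ge: "q a b * tmass p q b n \<le> dmass a n"
  unfolding dmass_def using q_nonneg tmass_nonneg[of p q, OF p_nonneg q_nonneg]
  by (intro member_le_sum) auto

lemma dmass_nonneg: "0 \<le> dmass a n"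
  unfolding dmass_def using q_nonneg tmass_nonneg[of p q, OF p_nonneg q_nonneg]
  by (intro sum_nonneg) auto

lemma dmass_1: "0 < dmass a 1"
proof -
  obtain b where "0 < q a b" using q_row by auto
  then have "0 < q a b * tmass p q b 1" using tmass_1 by simp
  then show ?thesis using dmass_ge[of a b 1] by linarith
qed

text \<open>A tree is extended upwards along a path from a to b. Each new vertex gets K children,
  for a fixed K \<ge> 2 in the offspring support: one carries the tree built so far, the others are
  leaves. So a step adds K vertices and a factor independent of n.\<close>

lemma tmass_path:
  "\<exists>k. \<exists>\<kappa>>0. \<forall>n. \<kappa> * tmass p q b n \<le> tmass p q a (n + k)"
  using q_irreducible[of a b]
proof (induction rule: converse_rtrancl_induct)
  case base
  show ?case by (rule exI[of _ 0], rule exI[of _ 1]) simp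
next
  case (step a c)
  obtain k \<kappa> where k: "0 < \<kappa>" "\<And>n. \<kappa> * tmass p q b n \<le> tmass p q c (n + k)" using step.IH by auto
  obtain K where K: "K \<ge> 2" "0 < p K" using branching by auto
  define \<kappa>' where "\<kappa>' = p K * dmass a 1 ^ (K - 1) * q a c"
  have "0 < \<kappa>'" using K dmass_1 step.hyps by (simp add: \<kappa>'_def)
  moreover have "\<kappa>' * \<kappa> * tmass p q b n \<le> tmass p q a (n + (k + K))" for n
  proof -
    have "\<kappa>' * (\<kappa> * tmass p q b n) \<le> \<kappa>' * tmass p q c (n + k)"
      using k(2)[of n] \<open>0 < \<kappa>'\<close> by (intro mult_left_mono) auto
    also have "\<dots> = p K * dmass a 1 ^ (K - 1) * (q a c * tmass p q c (n + k))"
      by (simp add: \<kappa>'_def)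
    also have "\<dots> \<le> p K * dmass a 1 ^ (K - 1) * dmass a (n + k)"
      using K dmass_1[of a] by (intro mult_left_mono dmass_ge) auto
    also have "\<dots> = p (length ((n + k) # replicate (K - 1) 1)) *
        (\<Prod>n\<leftarrow>(n + k) # replicate (K - 1) 1. dmass a n)"
      using K by (simp add: prod_list_replicate)
    also have "\<dots> \<le> tmass p q a (Suc (sum_list ((n + k) # replicate (K - 1) 1)))"
      unfolding dmass_def by (rule tmass_join[OF p_nonneg q_nonneg])
    also have "Suc (sum_list ((n + k) # replicate (K - 1) 1)) = n + (k + K)"
      using K by (simp add: sum_list_replicate)
    finally show ?thesis by (simp add: mult.assoc)
  qed
  ultimately show ?case using \<open>0 < \<kappa>\<close> by (intro exI[of _ "k + K"] exI[of _ "\<kappa>' * \<kappa>"]) auto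
qed

text \<open>Both trees are extended upwards until their root label is a successor b of c, then hung
  below one vertex labelled c whose other K - 2 children are leaves; here genuine branching is
  essential. The offset is a successor so that m + \<open>Suc k\<close> is positive even for m =
  0.\<close>

lemma tmass_supermultiplicative:
  "\<exists>k. \<exists>\<kappa>>0. \<forall>m n. \<kappa> * tmass p q c m * tmass p q c n \<le> tmass p q c (m + n + Suc k)"
proof -
  obtain K where K: "K \<ge> 2" "0 < p K" using branching by auto
  obtain b where b: "0 < q c b" using q_row by auto
  obtain k \<kappa> where k: "0 < \<kappa>" "\<And>n. \<kappa> * tmass p q c n \<le> tmass p q b (n + k)"
    using tmass_path by meson
  have d: "q c b * \<kappa> * tmass p q c n \<le> dmass c (n + k)" for n
  proof -
    have "q c b * (\<kappa> * tmass p q c n) \<le> q c b * tmass p q b (n + k)"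
      using b k(2) by (intro mult_left_mono) auto
    also have "\<dots> \<le> dmass c (n + k)" by (rule dmass_ge)
    finally show ?thesis by (simp add: mult.assoc)
  qed
  define \<kappa>' where "\<kappa>' = p K * dmass c 1 ^ (K - 2) * (q c b * \<kappa>) ^ 2"
  have "0 < \<kappa>'" using K dmass_1 b k by (simp add: \<kappa>'_def)
  moreover have "\<kappa>' * tmass p q c m * tmass p q c n \<le> tmass p q c (m + n + Suc (k + k + (K - 2)))" for m n
  proof -
    let ?ns = "(m + k) # (n + k) # replicate (K - 2) 1"
    have "\<kappa>' * tmass p q c m * tmass p q c n =
        p K * dmass c 1 ^ (K - 2) * ((q c b * \<kappa> * tmass p q c m) * (q c b * \<kappa> * tmass p q c n))"
      by (simp add: \<kappa>'_def power2_eq_square algebra_simps)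
    also have "\<dots> \<le> p K * dmass c 1 ^ (K - 2) * (dmass c (m + k) * dmass c (n + k))"
      using K dmass_1[of c] b k
      by (intro mult_left_mono mult_mono d) (auto intro!: mult_nonneg_nonneg dmass_nonneg tmass_nonneg p_nonneg q_nonneg)
    also have "\<dots> = p (length ?ns) * (\<Prod>n\<leftarrow>?ns. dmass c n)"
    proof -
      have "length ?ns = K" using K by simp
      then show ?thesis by (simp add: prod_list_replicate)
    qed
    also have "\<dots> \<le> tmass p q c (Suc (sum_list ?ns))"
      unfolding dmass_def by (rule tmass_join[OF p_nonneg q_nonneg])
    also have "Suc (sum_list ?ns) = m + n + Suc (k + k + (K - 2))"
      by (simp add: sum_list_replicate)
    finally show ?thesis .
  qed
  ultimately show ?thesis by (intro exI[of _ "k + k + (K - 2)"] exI[of _ \<kappa>']) auto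
qed

end

text \<open>\<open>r\<close> solves the recursion for the masses, and the linearised recursion at
  \<open>r\<close> has the matrix multiplying \<open>w\<close> in \<open>w_eigen\<close>. A positive
  left eigenvector with eigenvalue 1 is the multitype form of criticality.\<close>

locale critical_weight = branching_weight p q for p and q :: "'a::finite \<Rightarrow> 'a \<Rightarrow> real" +
  fixes r w :: "'a \<Rightarrow> real"
  assumes r_nonneg: "\<And>a. 0 \<le> r a"
    and r_fix: "\<And>a. r a = gf (\<Sum>b\<in>UNIV. q a b * r b)"
    and w_pos: "\<And>a. 0 < w a"
    and w_eigen: "\<And>b. w b = (\<Sum>a\<in>UNIV. w a * gf' (\<Sum>c\<in>UNIV. q a c * r c) * q a b)"
begin

text \<open>At the limiting masses \<open>F\<close> the recursion and the convexity of \<open>gf\<close> give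
  \<open>s * w \<bullet> F \<le> w \<bullet> F\<close>, although \<open>s > 1\<close> and \<open>w \<bullet> F > 0\<close>.\<close>

lemma cmass_unbounded:
  assumes s: "1 < s"
  shows "\<exists>a n. B < cmass (\<lambda>k. s * p k) q a n"
proof (rule ccontr)
  assume "\<not> ?thesis"
  then have B: "cmass (\<lambda>k. s * p k) q a n \<le> B" for a n by (auto simp: not_less)
  have u: "0 \<le> s * p k" for k using s p_nonneg by simp
  define F where "F a = lim (cmass (\<lambda>k. s * p k) q a)" for a
  have inc: "incseq (cmass (\<lambda>k. s * p k) q a)" for a
    unfolding incseq_def using cmass_mono[of "\<lambda>k. s * p k" q, OF u q_nonneg] by blast
  have "convergent (cmass (\<lambda>k. s * p k) q a)" for a
  proof -
    obtain L where "cmass (\<lambda>k. s * p k) q a \<longlonglongrightarrow> L"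
      using incseq_convergent[OF inc, of a B] B by metis
    then show ?thesis by (rule convergentI)
  qed
  then have F: "cmass (\<lambda>k. s * p k) q a \<longlonglongrightarrow> F a" for a
    unfolding F_def by (simp add: convergent_LIMSEQ_iff)
  have F0: "0 \<le> F a" for a
    using LIMSEQ_le_const[OF F] cmass_nonneg[of "\<lambda>k. s * p k" q, OF u q_nonneg] by blast
  have Z0: "0 \<le> (\<Sum>b\<in>UNIV. q a b * F b)" for a
    using F0 q_nonneg by (intro sum_nonneg) auto
  have Fge: "s * gf (\<Sum>b\<in>UNIV. q a b * F b) \<le> F a" for a
  proof -
    have part: "(\<Sum>k\<le>m. s * p k * (\<Sum>b\<in>UNIV. q a b * F b) ^ k) \<le> F a" for m
    proof (rule LIMSEQ_le_const2)
      show "(\<lambda>n. \<Sum>k\<le>m. s * p k * (\<Sum>b\<in>UNIV. q a b * cmass (\<lambda>k. s * p k) q b n) ^ k)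
          \<longlonglongrightarrow> (\<Sum>k\<le>m. s * p k * (\<Sum>b\<in>UNIV. q a b * F b) ^ k)"
        by (intro tendsto_intros F)
      show "\<exists>N. \<forall>n\<ge>N. (\<Sum>k\<le>m. s * p k * (\<Sum>b\<in>UNIV. q a b * cmass (\<lambda>k. s * p k) q b n) ^ k) \<le> F a"
        using sum_lists_le_cmass[of "\<lambda>k. s * p k" q, OF u q_nonneg]
          incseq_le[OF inc F] order_trans by blast
    qed
    have "(\<lambda>k. s * (p k * (\<Sum>b\<in>UNIV. q a b * F b) ^ k)) sums (s * gf (\<Sum>b\<in>UNIV. q a b * F b))"
      by (intro sums_mult gf_sums)
    then show ?thesis
      using LIMSEQ_le_const2[of "\<lambda>m. \<Sum>k\<le>m. s * (p k * (\<Sum>b\<in>UNIV. q a b * F b) ^ k)"] part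
      unfolding sums_def_le by (auto simp: mult.assoc)
  qed
  define Z where "Z a = (\<Sum>b\<in>UNIV. q a b * r b)" for a
  have Fpos: "0 < F a" for a
  proof -
    have "0 < s * gf (\<Sum>b\<in>UNIV. q a b * F b)"
      using gf_pos[OF Z0[of a]] s by simp
    then show ?thesis using Fge[of a] by linarith
  qed
  \<comment> \<open>Split F as r + (F - r). The eigenvector equation moves the pairing of w with F -
    r onto the slopes \<open>gf' (Z a)\<close>, so each letter a contributes exactly the tangent of
    \<open>gf\<close> at \<open>Z a\<close>.\<close>
  have "s * (\<Sum>b\<in>UNIV. w b * F b) = s * ((\<Sum>a\<in>UNIV. w a * r a) + (\<Sum>b\<in>UNIV. w b * (F b - r b)))"
    by (simp add: algebra_simps sum_subtractf)
  also have "(\<Sum>b\<in>UNIV. w b * (F b - r b)) = (\<Sum>b\<in>UNIV. \<Sum>a\<in>UNIV. w a * gf' (Z a) * q a b * (F b - r b))"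
    by (subst w_eigen) (simp add: Z_def sum_distrib_right)
  also have "\<dots> = (\<Sum>a\<in>UNIV. \<Sum>b\<in>UNIV. w a * gf' (Z a) * q a b * (F b - r b))"
    by (rule sum.swap)
  also have "\<dots> = (\<Sum>a\<in>UNIV. w a * (gf' (Z a) * ((\<Sum>b\<in>UNIV. q a b * F b) - Z a)))"
    by (simp add: Z_def sum_distrib_left sum_subtractf[symmetric] algebra_simps)
  also have "s * ((\<Sum>a\<in>UNIV. w a * r a) + \<dots>) =
      (\<Sum>a\<in>UNIV. w a * (s * (gf (Z a) + gf' (Z a) * ((\<Sum>b\<in>UNIV. q a b * F b) - Z a))))"
    by (subst r_fix) (simp add: Z_def sum.distrib[symmetric] sum_distrib_left algebra_simps)
  also have "\<dots> \<le> (\<Sum>a\<in>UNIV. w a * F a)"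
  proof (intro sum_mono mult_left_mono)
    fix a
    have "0 \<le> Z a" unfolding Z_def using q_nonneg r_nonneg by (intro sum_nonneg) auto
    then have "s * (gf (Z a) + gf' (Z a) * ((\<Sum>b\<in>UNIV. q a b * F b) - Z a)) \<le> s * gf (\<Sum>b\<in>UNIV. q a b * F b)"
      using s Z0 by (intro mult_left_mono gf_tangent) auto
    then show "s * (gf (Z a) + gf' (Z a) * ((\<Sum>b\<in>UNIV. q a b * F b) - Z a)) \<le> F a"
      using Fge[of a] by linarith
    show "0 \<le> w a" using w_pos[of a] by simp
  qed
  finally have "(s - 1) * (\<Sum>b\<in>UNIV. w b * F b) \<le> 0" by (simp add: algebra_simps)
  moreover have "0 < (\<Sum>b\<in>UNIV. w b * F b)"
    by (intro sum_pos) (auto simp: Fpos w_pos)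
  ultimately show False using s by (simp add: mult_le_0_iff)
qed

text \<open>By \<open>supermultiplicative_lower_bound\<close> one sufficiently large mass at c is
  enough. If there were none, all masses at c, and along paths to c those at every letter, would
  decay exponentially; the generating function would then be finite at some s > 1, against
  \<open>cmass_unbounded\<close>.\<close>

lemma tmass_subexponential:
  assumes \<delta>: "0 < \<delta>"
  shows "\<exists>C>0. \<forall>n. 0 < tmass p q c n \<longrightarrow> C * exp (- \<delta> * real n) \<le> tmass p q c n"
proof -
  obtain k \<kappa> where k: "0 < \<kappa>"
      "\<And>m n. \<kappa> * tmass p q c m * tmass p q c n \<le> tmass p q c (m + n + Suc k)"
    using tmass_supermultiplicative by meson
  have "\<exists>m. exp (- \<delta> * real (m + Suc k)) \<le> \<kappa> * tmass p q c m"
  proof (rule ccontr)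
    assume "\<not> ?thesis"
    then have small: "\<kappa> * tmass p q c m < exp (- \<delta> * real (m + Suc k))" for m
      by (auto simp: not_le)
    have small': "tmass p q c m \<le> exp (- \<delta> * real m) / \<kappa>" for m
    proof -
      have "exp (- \<delta> * real (m + Suc k)) \<le> exp (- \<delta> * real m)" using \<delta> by simp
      then have "\<kappa> * tmass p q c m \<le> exp (- \<delta> * real m)"
        using small[of m] by linarith
      then show ?thesis using k(1) by (simp add: pos_le_divide_eq mult.commute)
    qed
    have "\<exists>k \<kappa>. 0 < \<kappa> \<and> (\<forall>n. \<kappa> * tmass p q a n \<le> tmass p q c (n + k))" for a
      using tmass_path[of a c] by auto
    then obtain k' \<kappa>' where k': "\<And>a. 0 < \<kappa>' a"
        "\<And>a n. \<kappa>' a * tmass p q a n \<le> tmass p q c (n + k' a)"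
      by metis
    \<comment> \<open>Half of the decay rate pays for the factor s per vertex, the other half leaves
      a geometric series.\<close>
    define s where "s = exp (\<delta> / 2)"
    define C where "C = (\<Sum>a\<in>UNIV. 1 / (\<kappa> * \<kappa>' a))"
    have C: "1 / (\<kappa> * \<kappa>' a) \<le> C" for a
      unfolding C_def using k(1) k'(1) by (intro member_le_sum) (auto simp: less_imp_le)
    have s: "1 < s" using \<delta> by (simp add: s_def)
    have t: "tmass (\<lambda>k. s * p k) q a n \<le> C * exp (- \<delta> / 2) ^ n" for a n
    proof -
      have "tmass p q a n \<le> tmass p q c (n + k' a) / \<kappa>' a"
        using k' by (simp add: pos_le_divide_eq mult.commute)
      also have "\<dots> \<le> exp (- \<delta> * real (n + k' a)) / \<kappa> / \<kappa>' a"
        using k'(1) by (intro divide_right_mono small') (auto intro: less_imp_le)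
      also have "\<dots> \<le> exp (- \<delta> * real n) / \<kappa> / \<kappa>' a"
        using k'(1) k(1) \<delta> by (intro divide_right_mono) (auto intro: less_imp_le)
      also have "\<dots> = exp (- \<delta> * real n) * (1 / (\<kappa> * \<kappa>' a))" by simp
      also have "\<dots> \<le> exp (- \<delta> * real n) * C" by (intro mult_left_mono C) auto
      finally have "s ^ n * tmass p q a n \<le> s ^ n * (exp (- \<delta> * real n) * C)"
        using s by (intro mult_left_mono) auto
      also have "s ^ n * (exp (- \<delta> * real n) * C) = C * exp (- \<delta> / 2) ^ n"
        by (simp add: s_def algebra_simps flip: exp_of_nat_mult exp_add)
      also have "s ^ n * tmass p q a n = tmass (\<lambda>k. s * p k) q a n"
        by (auto simp: tmass_def weight_scale sum_distrib_left intro!: sum.cong)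
      finally show ?thesis .
    qed
    have "cmass (\<lambda>k. s * p k) q a n \<le> C * (1 / (1 - exp (- \<delta> / 2)))" for a n
    proof -
      have C0: "0 \<le> C" unfolding C_def using k(1) k'(1) by (intro sum_nonneg) (auto simp: less_imp_le)
      have "cmass (\<lambda>k. s * p k) q a n \<le> (\<Sum>i\<le>n. C * exp (- \<delta> / 2) ^ i)"
        unfolding cmass_eq_sum by (intro sum_mono t)
      also have "\<dots> = C * (\<Sum>i\<le>n. exp (- \<delta> / 2) ^ i)" by (simp add: sum_distrib_left)
      also have "\<dots> \<le> C * (\<Sum>i. exp (- \<delta> / 2) ^ i)"
        using \<delta> C0 by (intro mult_left_mono sum_le_suminf summable_geometric) auto
      also have "(\<Sum>i. exp (- \<delta> / 2) ^ i) = 1 / (1 - exp (- \<delta> / 2))"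
        using \<delta> by (intro suminf_geometric) auto
      finally show ?thesis .
    qed
    then show False using cmass_unbounded[OF s] by (meson not_le)
  qed
  then obtain m where "exp (- \<delta> * real (m + Suc k)) \<le> \<kappa> * tmass p q c m" by auto
  then show ?thesis
    by (intro supermultiplicative_lower_bound[of "tmass p q c" \<kappa> "Suc k" m \<delta>])
       (use k \<delta> in \<open>auto intro: tmass_nonneg p_nonneg q_nonneg\<close>)
qed

end

section \<open>The law of a tree-indexed Markov chain\<close>

primrec sub_at :: "nat list \<Rightarrow> 'a ltree \<Rightarrow> 'a ltree option" where
  "sub_at [] t = Some t"
| "sub_at (i # v) t = (if i < length (subtrees t) then sub_at v (subtrees t ! i) else None)"

definition addresses :: "'a ltree \<Rightarrow> nat list set" where
  "addresses t = {v. sub_at v t \<noteq> None}"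

definition label_at :: "'a ltree \<Rightarrow> nat list \<Rightarrow> 'a" where
  "label_at t v = lab (the (sub_at v t))"

definition degree_at :: "'a ltree \<Rightarrow> nat list \<Rightarrow> nat" where
  "degree_at t v = length (subtrees (the (sub_at v t)))"

lemma Nil_in_addresses [simp]: "[] \<in> addresses t"
  by (simp add: addresses_def)

lemma addresses_nonempty: "addresses t \<noteq> {}"
  using Nil_in_addresses by blast

lemma Cons_in_addresses [simp]:
  "i # v \<in> addresses t \<longleftrightarrow> i < length (subtrees t) \<and> v \<in> addresses (subtrees t ! i)"
  by (simp add: addresses_def)

lemma label_at_simps [simp]:
  "label_at t [] = lab t"
  "i < length (subtrees t) \<Longrightarrow> label_at t (i # v) = label_at (subtrees t ! i) v"
  by (simp_all add: label_at_def)

lemma degree_at_simps [simp]: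
  "degree_at t [] = length (subtrees t)"
  "i < length (subtrees t) \<Longrightarrow> degree_at t (i # v) = degree_at (subtrees t ! i) v"
  by (simp_all add: degree_at_def)

lemma snoc_in_addresses:
  "v @ [i] \<in> addresses t \<longleftrightarrow> v \<in> addresses t \<and> i < degree_at t v"
proof (induction v arbitrary: t)
  case (Cons j v)
  then show ?case by (cases "j < length (subtrees t)") simp_all
qed simp

lemma butlast_in_addresses: "v \<in> addresses t \<Longrightarrow> butlast v \<in> addresses t"
  by (cases v rule: rev_cases) (simp_all add: snoc_in_addresses)

lemma addresses_eq:
  "addresses t = insert [] (\<Union>i<length (subtrees t). (#) i ` addresses (subtrees t ! i))"
proof (rule set_eqI)
  show "v \<in> addresses t \<longleftrightarrow> v \<in> insert [] (\<Union>i<length (subtrees t). (#) i ` addresses (subtrees t ! i))" for v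
    by (cases v) auto
qed

text \<open>Edges are indexed by their lower endpoints. The roots of the subtrees are listed apart
  because their edges start at the root of the whole tree, and because \<open>butlast\<close>
  commutes with prefixing i only on nonempty addresses.\<close>

lemma addresses_minus_root:
  "addresses t - {[]} =
     (\<Union>i<length (subtrees t). insert [i] ((#) i ` (addresses (subtrees t ! i) - {[]})))"
  by (subst addresses_eq) (auto simp: image_iff)

lemma finite_addresses: "finite (addresses t)"
proof (induction t)
  case (LNode a ts)
  then show ?case by (subst addresses_eq) auto
qed

lemma sum_addresses_minus_root:
  fixes f :: "nat list \<Rightarrow> 'b::comm_monoid_add"
  shows "sum f (addresses t - {[]}) =
    (\<Sum>i<length (subtrees t). f [i] + (\<Sum>v\<in>addresses (subtrees t ! i) - {[]}. f (i # v)))"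
  unfolding addresses_minus_root[of t]
  by (subst sum.UNION_disjoint)
     (auto simp: finite_addresses image_iff sum.reindex intro!: sum.cong)

lemma prod_addresses_minus_root:
  fixes f :: "nat list \<Rightarrow> 'b::comm_monoid_mult"
  shows "prod f (addresses t - {[]}) =
    (\<Prod>i<length (subtrees t). f [i] * (\<Prod>v\<in>addresses (subtrees t ! i) - {[]}. f (i # v)))"
  unfolding addresses_minus_root[of t]
  by (subst prod.UNION_disjoint)
     (auto simp: finite_addresses image_iff prod.reindex intro!: prod.cong)

lemma card_addresses: "card (addresses t) = tsize t"
proof (induction t)
  case (LNode a ts)
  have "card (addresses (LNode a ts)) = Suc (card (\<Union>i<length ts. (#) i ` addresses (ts ! i)))"
    by (subst addresses_eq) (auto simp: finite_addresses intro!: card_insert_disjoint)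
  also have "card (\<Union>i<length ts. (#) i ` addresses (ts ! i)) = (\<Sum>i<length ts. card ((#) i ` addresses (ts ! i)))"
    by (intro card_UN_disjoint) (auto simp: finite_addresses)
  also have "\<dots> = (\<Sum>i<length ts. tsize (ts ! i))"
    using LNode by (intro sum.cong) (auto simp: card_image)
  finally show ?case by (simp add: sum_list_sum_nth atLeast0LessThan)
qed

text \<open>There is one edge fewer than vertices. A single vertex gives the zero vector, which is
  no probability vector; hence the later restrictions to at least two vertices.\<close>

definition empirical :: "'a ltree \<Rightarrow> real ^ ('a::finite \<times> 'a)" where
  "empirical t = (\<chi> ab. edge_count t ab / real (tsize t - 1))"

lemma edge_count_eq_sum:
  "edge_count t e = (\<Sum>v\<in>addresses t - {[]}. of_bool ((label_at t (butlast v), label_at t v) = e))"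
proof (induction t)
  case (LNode a ts)
  have "(\<Sum>v\<in>addresses (LNode a ts) - {[]}.
        of_bool ((label_at (LNode a ts) (butlast v), label_at (LNode a ts) v) = e)) =
      (\<Sum>i<length ts. of_bool ((a, lab (ts ! i)) = e) + edge_count (ts ! i) e)"
    by (subst sum_addresses_minus_root) (auto simp: LNode intro!: sum.cong)
  then show ?case by (simp add: sum_list_sum_nth atLeast0LessThan)
qed

text \<open>The recursion serves the estimates of masses; this product over vertices and edges is
  the form in which independence and the Markov property deliver probabilities.\<close>

lemma weight_eq_prod:
  "weight u q t = (\<Prod>v\<in>addresses t. u (degree_at t v)) *
     (\<Prod>v\<in>addresses t - {[]}. q (label_at t (butlast v)) (label_at t v))"
proof (induction t)
  case (LNode a ts)
  let ?t = "LNode a ts"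
  have 1: "(\<Prod>v\<in>addresses ?t. u (degree_at ?t v)) =
      u (length ts) * (\<Prod>i<length ts. \<Prod>v\<in>addresses (ts ! i). u (degree_at (ts ! i) v))"
  proof -
    have "(\<Prod>v\<in>addresses ?t. u (degree_at ?t v)) =
        u (length ts) * (\<Prod>v\<in>addresses ?t - {[]}. u (degree_at ?t v))"
      by (subst prod.remove[of _ "[]"]) (auto simp: finite_addresses)
    also have "(\<Prod>v\<in>addresses ?t - {[]}. u (degree_at ?t v)) =
        (\<Prod>i<length ts. \<Prod>v\<in>addresses (ts ! i). u (degree_at (ts ! i) v))"
      by (subst prod_addresses_minus_root, rule prod.cong)
         (auto simp: prod.remove[of "addresses _" "[]"] finite_addresses)
    finally show ?thesis .
  qed
  have 2: "(\<Prod>v\<in>addresses ?t - {[]}. q (label_at ?t (butlast v)) (label_at ?t v)) =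
      (\<Prod>i<length ts. q a (lab (ts ! i)) *
        (\<Prod>v\<in>addresses (ts ! i) - {[]}. q (label_at (ts ! i) (butlast v)) (label_at (ts ! i) v)))"
    by (subst prod_addresses_minus_root) (auto intro!: prod.cong)
  have "weight u q ?t = u (length ts) * (\<Prod>i<length ts. q a (lab (ts ! i)) * weight u q (ts ! i))"
    by (simp add: prod.list_conv_set_nth atLeast0LessThan)
  also have "(\<Prod>i<length ts. q a (lab (ts ! i)) * weight u q (ts ! i)) =
      (\<Prod>i<length ts. q a (lab (ts ! i)) * ((\<Prod>v\<in>addresses (ts ! i). u (degree_at (ts ! i) v)) *
        (\<Prod>v\<in>addresses (ts ! i) - {[]}. q (label_at (ts ! i) (butlast v)) (label_at (ts ! i) v))))"
    using LNode by (intro prod.cong) auto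
  finally show ?case
    unfolding 1 2 by (simp add: prod.distrib algebra_simps)
qed

lemma ltree_eqI:
  assumes "addresses t = addresses t'" "\<And>v. v \<in> addresses t \<Longrightarrow> label_at t v = label_at t' v"
  shows "t = t'"
  using assms
proof (induction t arbitrary: t')
  case (LNode a ts)
  obtain a' ts' where t': "t' = LNode a' ts'" by (cases t')
  have mem: "v \<in> addresses (LNode a ts) \<longleftrightarrow> v \<in> addresses (LNode a' ts')" for v
    using LNode.prems(1) t' by simp
  have lt: "i < length ts \<longleftrightarrow> i < length ts'" for i
    using mem[of "[i]"] by simp
  have len: "length ts = length ts'"
    using lt[of "length ts"] lt[of "length ts'"] by linarith
  have "ts ! i = ts' ! i" if i: "i < length ts" for i
  proof (rule LNode.IH)
    show "ts ! i \<in> set ts" using i by simp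
    show "addresses (ts ! i) = addresses (ts' ! i)"
      using mem[of "i # _"] i len by auto
    show "label_at (ts ! i) v = label_at (ts' ! i) v" if "v \<in> addresses (ts ! i)" for v
      using LNode.prems(2)[of "i # v"] that i len t' by auto
  qed
  then have "ts = ts'" using len by (simp add: nth_equalityI)
  then show ?case using LNode.prems(2)[of "[]"] t' by simp
qed

section \<open>Planar trees given by offspring numbers\<close>

lemma snoc_in_planar_tree:
  "v @ [i] \<in> planar_tree k \<longleftrightarrow> v \<in> planar_tree k \<and> i < k v"
proof
  assume "v @ [i] \<in> planar_tree k"
  then show "v \<in> planar_tree k \<and> i < k v" by cases auto
qed (auto intro: planar_tree.child)

lemma Nil_in_planar_tree [simp]: "[] \<in> planar_tree k"
  by (rule planar_tree.root)

text \<open>\<open>planar_tree\<close> grows at the end of an address while \<open>sub_at\<close>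
  reads from the front; induction from the end reconciles the two.\<close>

lemma Cons_in_planar_tree:
  "i # v \<in> planar_tree k \<longleftrightarrow> i < k [] \<and> v \<in> planar_tree (\<lambda>v. k (i # v))"
proof (induction v rule: rev_induct)
  case Nil
  show ?case using snoc_in_planar_tree[of "[]" i k] by simp
next
  case (snoc j v)
  show ?case
    using snoc_in_planar_tree[of "i # v" j k] snoc by (auto simp: snoc_in_planar_tree)
qed

text \<open>Equality with a finite tree is decided by the offspring numbers at its own addresses, so
  the event involves finitely many independent variables.\<close>

lemma planar_tree_eq_addresses_iff:
  "planar_tree k = addresses t \<longleftrightarrow> (\<forall>v\<in>addresses t. k v = degree_at t v)"
proof
  assume eq: "planar_tree k = addresses t"
  show "\<forall>v\<in>addresses t. k v = degree_at t v"
  proof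
    fix v assume v: "v \<in> addresses t"
    have "i < k v \<longleftrightarrow> i < degree_at t v" for i
      using snoc_in_planar_tree[of v i k] snoc_in_addresses[of v i t] v eq by simp
    from this[of "k v"] this[of "degree_at t v"] show "k v = degree_at t v" by linarith
  qed
next
  assume k: "\<forall>v\<in>addresses t. k v = degree_at t v"
  have "v \<in> planar_tree k \<longleftrightarrow> v \<in> addresses t" for v
    by (induction v rule: rev_induct) (use k in \<open>auto simp: snoc_in_planar_tree snoc_in_addresses\<close>)
  then show "planar_tree k = addresses t" by auto
qed

text \<open>Recursion into the subtrees at the children of the root: prefixing i embeds such a
  subtree into the tree and misses the root, so its cardinality is smaller.\<close>

lemma planar_tree_is_ltree:
  assumes "finite (planar_tree k)"
  shows "\<exists>t. addresses t = planar_tree k \<and> (\<forall>v\<in>planar_tree k. label_at t v = x v)"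
  using assms
proof (induction "card (planar_tree k)" arbitrary: k x rule: less_induct)
  case less
  have "\<exists>t. addresses t = planar_tree (\<lambda>v. k (i # v)) \<and>
      (\<forall>v\<in>planar_tree (\<lambda>v. k (i # v)). label_at t v = x (i # v))" if i: "i < k []" for i
  proof (rule less.hyps)
    have sub: "(#) i ` planar_tree (\<lambda>v. k (i # v)) \<subset> planar_tree k"
      using i by (auto simp: Cons_in_planar_tree)
    then have "finite ((#) i ` planar_tree (\<lambda>v. k (i # v)))"
      using less.prems finite_subset by blast
    then show "finite (planar_tree (\<lambda>v. k (i # v)))"
      by (rule finite_imageD) auto
    have "card ((#) i ` planar_tree (\<lambda>v. k (i # v))) < card (planar_tree k)"
      using less.prems sub by (rule psubset_card_mono)
    then show "card (planar_tree (\<lambda>v. k (i # v))) < card (planar_tree k)"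
      by (simp add: card_image)
  qed
  then obtain f where f: "\<And>i. i < k [] \<Longrightarrow> addresses (f i) = planar_tree (\<lambda>v. k (i # v)) \<and>
      (\<forall>v\<in>planar_tree (\<lambda>v. k (i # v)). label_at (f i) v = x (i # v))"
    by metis
  let ?t = "LNode (x []) (map f [0..<k []])"
  have "v \<in> addresses ?t \<longleftrightarrow> v \<in> planar_tree k" for v
    using f by (cases v) (auto simp: Cons_in_planar_tree)
  moreover have "label_at ?t v = x v" if "v \<in> planar_tree k" for v
    using f that by (cases v) (auto simp: Cons_in_planar_tree)
  ultimately show ?case by blast
qed

lemma empirical_pair_measure_addresses:
  fixes x :: "nat list \<Rightarrow> 'a::finite"
  assumes "\<And>v. v \<in> addresses t \<Longrightarrow> x v = label_at t v"
  shows "empirical_pair_measure (addresses t) x = empirical t"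
proof -
  have E: "tree_edges (addresses t) = (\<lambda>v. (butlast v, v)) ` (addresses t - {[]})"
    by (auto simp: tree_edges_def)
  have inj: "inj_on (\<lambda>v. (butlast v, v)) (addresses t - {[]})"
    by (auto simp: inj_on_def)
  have "card (tree_edges (addresses t)) = tsize t - 1"
    unfolding E using inj by (simp add: card_image card_addresses finite_addresses)
  moreover have "(\<Sum>e\<in>tree_edges (addresses t). of_bool ((x (fst e), x (snd e)) = ab)) = edge_count t ab" for ab
    unfolding E edge_count_eq_sum using inj
    by (simp add: sum.reindex) (auto intro!: sum.cong simp: assms butlast_in_addresses)
  ultimately show ?thesis
    by (simp add: empirical_pair_measure_def empirical_def)
qed

section \<open>Probabilities of labelled trees and of pair measures\<close>

context
  fixes M :: "'w measure" and T :: "'w \<Rightarrow> nat list set" and X :: "'w \<Rightarrow> nat list \<Rightarrow> 'a::finite"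
    and p :: "nat pmf" and init :: "'a pmf" and Q :: "'a \<Rightarrow> 'a pmf"
  assumes gw: "galton_watson_tree M p T" and mc: "tree_indexed_markov_chain M init Q T X"
begin

lemma prob_space_M: "prob_space M"
  using gw by (simp add: galton_watson_tree_def)

lemma galton_watson_address_event:
  "{\<omega> \<in> space M. T \<omega> = addresses t} \<in> sets M"
  "measure M {\<omega> \<in> space M. T \<omega> = addresses t} = (\<Prod>v\<in>addresses t. pmf p (degree_at t v))"
proof -
  interpret prob_space M by (rule prob_space_M)
  obtain N :: "nat list \<Rightarrow> 'w \<Rightarrow> nat" where ind: "indep_vars (\<lambda>_. count_space UNIV) N UNIV"
    and N: "\<And>v. distr M (count_space UNIV) (N v) = measure_pmf p"
    and T: "\<And>\<omega>. \<omega> \<in> space M \<Longrightarrow> T \<omega> = planar_tree (\<lambda>v. N v \<omega>)"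
    using gw by (auto simp: galton_watson_tree_def)
  have meas: "N v \<in> measurable M (count_space UNIV)" for v
    using ind by (auto simp: indep_vars_def)
  have eq: "{\<omega> \<in> space M. T \<omega> = addresses t} =
      (\<Inter>v\<in>addresses t. N v -` {degree_at t v} \<inter> space M)"
  proof -
    have "T \<omega> = addresses t \<longleftrightarrow> (\<forall>v\<in>addresses t. N v \<omega> = degree_at t v)" if "\<omega> \<in> space M" for \<omega>
      by (simp only: T[OF that] planar_tree_eq_addresses_iff)
    then show ?thesis using addresses_nonempty[of t] by auto
  qed
  have ev: "N v -` {k} \<inter> space M \<in> sets M" for v k
    using meas by (rule measurable_sets) simp
  show "{\<omega> \<in> space M. T \<omega> = addresses t} \<in> sets M"
    unfolding eq by (intro sets.finite_INT finite_addresses ev) (fact addresses_nonempty)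
  have "measure M {\<omega> \<in> space M. T \<omega> = addresses t} =
      (\<Prod>v\<in>addresses t. prob (N v -` {degree_at t v} \<inter> space M))"
    unfolding eq using addresses_nonempty[of t] finite_addresses[of t]
    by (intro indep_varsD_finite[OF indep_vars_subset[OF ind]]) auto
  also have "\<dots> = (\<Prod>v\<in>addresses t. pmf p (degree_at t v))"
  proof (rule prod.cong)
    fix v
    have "prob (N v -` {degree_at t v} \<inter> space M) = measure (distr M (count_space UNIV) (N v)) {degree_at t v}"
      using meas[of v] by (subst measure_distr) auto
    then show "prob (N v -` {degree_at t v} \<inter> space M) = pmf p (degree_at t v)"
      by (simp add: N measure_pmf_single)
  qed simp
  finally show "measure M {\<omega> \<in> space M. T \<omega> = addresses t} = (\<Prod>v\<in>addresses t. pmf p (degree_at t v))" .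
qed

definition tree_event :: "'a ltree \<Rightarrow> 'w set" where
  "tree_event t = {\<omega> \<in> space M. T \<omega> = addresses t \<and> (\<forall>v\<in>addresses t. X \<omega> v = label_at t v)}"

lemma tree_event_sets: "tree_event t \<in> sets M"
proof -
  interpret prob_space M by (rule prob_space_M)
  have "{\<omega> \<in> space M. v \<in> T \<omega> \<and> X \<omega> v = a} \<in> sets M" for v a
    using mc by (auto simp: tree_indexed_markov_chain_def)
  then have "(\<Inter>v\<in>addresses t. {\<omega> \<in> space M. v \<in> T \<omega> \<and> X \<omega> v = label_at t v}) \<in> sets M"
    using addresses_nonempty by (intro sets.finite_INT finite_addresses) auto
  with galton_watson_address_event(1)[of t]
  have "{\<omega> \<in> space M. T \<omega> = addresses t} \<inter>
      (\<Inter>v\<in>addresses t. {\<omega> \<in> space M. v \<in> T \<omega> \<and> X \<omega> v = label_at t v}) \<in> sets M"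
    by (rule sets.Int)
  moreover have "{\<omega> \<in> space M. T \<omega> = addresses t} \<inter>
      (\<Inter>v\<in>addresses t. {\<omega> \<in> space M. v \<in> T \<omega> \<and> X \<omega> v = label_at t v}) = tree_event t"
    using addresses_nonempty[of t] by (auto simp: tree_event_def)
  ultimately show ?thesis by simp
qed

lemma T_planar: "\<omega> \<in> space M \<Longrightarrow> \<exists>k. T \<omega> = planar_tree k"
  using gw by (auto simp: galton_watson_tree_def)

lemma prob_tree_event:
  "measure M (tree_event t) = pmf init (lab t) * weight (pmf p) (\<lambda>a b. pmf (Q a) b) t"
proof -
  \<comment> \<open>Besides t the window holds, for each vertex of t, the first address after its
    last child (i may equal the degree). Seeing that address unoccupied rules out further children,
    so observing T in W identifies t.\<close>
  define W where "W = insert [] {v @ [i] | v i. v \<in> addresses t \<and> i \<le> degree_at t v}"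
  have "{v @ [i] | v i. v \<in> addresses t \<and> i \<le> degree_at t v} =
      (\<Union>v\<in>addresses t. (\<lambda>i. v @ [i]) ` {..degree_at t v})"
    by auto
  then have fin: "finite W"
    unfolding W_def by (simp add: finite_addresses)
  have sub: "addresses t \<subseteq> W"
  proof
    fix v assume "v \<in> addresses t"
    then show "v \<in> W"
      by (cases v rule: rev_cases) (auto simp: W_def snoc_in_addresses)
  qed
  have bl: "butlast v \<in> W" if "v \<in> W" for v
  proof -
    have "v = [] \<or> (\<exists>w i. v = w @ [i] \<and> w \<in> addresses t)" "[] \<in> W"
      using that by (auto simp: W_def)
    then show ?thesis using sub by auto
  qed
  have window: "planar_tree k \<inter> W = addresses t \<longleftrightarrow> planar_tree k = addresses t" for k
  proof
    assume eq: "planar_tree k \<inter> W = addresses t"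
    have "k v = degree_at t v" if v: "v \<in> addresses t" for v
    proof -
      have vk: "v \<in> planar_tree k" using eq v by auto
      have "i < k v \<longleftrightarrow> i < degree_at t v" if i: "i \<le> degree_at t v" for i
      proof -
        have "v @ [i] \<in> W" using v i by (auto simp: W_def)
        then have "v @ [i] \<in> planar_tree k \<longleftrightarrow> v @ [i] \<in> addresses t" using eq by blast
        then show ?thesis using v vk by (simp add: snoc_in_planar_tree snoc_in_addresses)
      qed
      from this[of "degree_at t v"] this[of "k v"] show ?thesis by auto
    qed
    then show "planar_tree k = addresses t" by (simp add: planar_tree_eq_addresses_iff)
  qed (use sub in auto)
  have ev: "T \<omega> \<inter> W = addresses t \<longleftrightarrow> T \<omega> = addresses t" if "\<omega> \<in> space M" for \<omega>
    using T_planar[OF that] window by auto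
  have "measure M {\<omega> \<in> space M. T \<omega> \<inter> W = addresses t \<and> (\<forall>v\<in>addresses t. X \<omega> v = label_at t v)} =
      measure M {\<omega> \<in> space M. T \<omega> \<inter> W = addresses t} *
        (pmf init (label_at t []) *
          (\<Prod>v\<in>addresses t - {[]}. pmf (Q (label_at t (butlast v))) (label_at t v)))"
    using mc fin bl unfolding tree_indexed_markov_chain_def by (auto simp: W_def)
  also have "{\<omega> \<in> space M. T \<omega> \<inter> W = addresses t \<and> (\<forall>v\<in>addresses t. X \<omega> v = label_at t v)} = tree_event t"
    using ev by (auto simp: tree_event_def)
  also have "{\<omega> \<in> space M. T \<omega> \<inter> W = addresses t} = {\<omega> \<in> space M. T \<omega> = addresses t}"
    using ev by auto
  finally show ?thesis
    by (simp add: galton_watson_address_event(2) weight_eq_prod)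
qed

text \<open>Only finitely many labelled trees have size n, so for every set A the event is a finite
  disjoint union of measurable tree events.\<close>

lemma prob_empirical:
  "measure M {\<omega> \<in> space M. empirical_pair_measure (T \<omega>) (X \<omega>) \<in> A \<and> finite (T \<omega>) \<and> card (T \<omega>) = n} =
     (\<Sum>t | tsize t = n \<and> empirical t \<in> A. pmf init (lab t) * weight (pmf p) (\<lambda>a b. pmf (Q a) b) t)"
proof -
  interpret prob_space M by (rule prob_space_M)
  have "{\<omega> \<in> space M. empirical_pair_measure (T \<omega>) (X \<omega>) \<in> A \<and> finite (T \<omega>) \<and> card (T \<omega>) = n} =
      (\<Union>t\<in>{t. tsize t = n \<and> empirical t \<in> A}. tree_event t)"
  proof (intro set_eqI iffI)
    fix \<omega>
    assume \<omega>: "\<omega> \<in> {\<omega> \<in> space M. empirical_pair_measure (T \<omega>) (X \<omega>) \<in> A \<and> finite (T \<omega>) \<and> card (T \<omega>) = n}"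
    then obtain k where k: "T \<omega> = planar_tree k" using T_planar by auto
    then obtain t where t: "addresses t = T \<omega>" "\<And>v. v \<in> T \<omega> \<Longrightarrow> label_at t v = X \<omega> v"
      using planar_tree_is_ltree[of k "X \<omega>"] \<omega> by auto
    then have "tsize t = n" "empirical t \<in> A"
      using \<omega> card_addresses[of t] empirical_pair_measure_addresses[of t "X \<omega>"] by auto
    then show "\<omega> \<in> (\<Union>t\<in>{t. tsize t = n \<and> empirical t \<in> A}. tree_event t)"
      using \<omega> t by (auto simp: tree_event_def intro!: exI[of _ t])
  next
    fix \<omega>
    assume "\<omega> \<in> (\<Union>t\<in>{t. tsize t = n \<and> empirical t \<in> A}. tree_event t)"
    then obtain t where t: "tsize t = n" "empirical t \<in> A" "\<omega> \<in> tree_event t" by auto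
    then show "\<omega> \<in> {\<omega> \<in> space M. empirical_pair_measure (T \<omega>) (X \<omega>) \<in> A \<and> finite (T \<omega>) \<and> card (T \<omega>) = n}"
      using empirical_pair_measure_addresses[of t "X \<omega>"]
      by (auto simp: tree_event_def card_addresses finite_addresses)
  qed
  also have "prob \<dots> = (\<Sum>t | tsize t = n \<and> empirical t \<in> A. prob (tree_event t))"
  proof (rule finite_measure_finite_Union)
    show "disjoint_family_on tree_event {t. tsize t = n \<and> empirical t \<in> A}"
    proof (unfold disjoint_family_on_def, intro ballI impI, rule ccontr)
      fix t t' :: "'a ltree"
      assume "t \<noteq> t'" "tree_event t \<inter> tree_event t' \<noteq> {}"
      then obtain \<omega> where "\<omega> \<in> tree_event t" "\<omega> \<in> tree_event t'" by auto
      then have "t = t'" by (intro ltree_eqI) (simp_all add: tree_event_def)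
      with \<open>t \<noteq> t'\<close> show False by contradiction
    qed
  qed (auto simp: tree_event_sets finite_trees_eq)
  finally show ?thesis by (simp add: prob_tree_event)
qed

end

section \<open>Exponential tilting\<close>

lemma edge_count_nonneg: "0 \<le> edge_count t e"
  by (simp add: edge_count_eq_sum sum_nonneg)

lemma sum_edge_count:
  fixes t :: "'a::finite ltree"
  shows "(\<Sum>e\<in>UNIV. edge_count t e) = real (tsize t - 1)"
proof -
  have "(\<Sum>e\<in>UNIV. edge_count t e) =
      (\<Sum>v\<in>addresses t - {[]}. \<Sum>e\<in>UNIV. of_bool ((label_at t (butlast v), label_at t v) = e))"
    unfolding edge_count_eq_sum by (rule sum.swap)
  also have "\<dots> = (\<Sum>v\<in>addresses t - {[]}. 1)"
    by (intro sum.cong refl) (simp add: of_bool_def)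
  also have "\<dots> = real (tsize t - 1)"
    by (simp add: card_addresses finite_addresses)
  finally show ?thesis .
qed

lemma empirical_in_prob_vectors: "2 \<le> tsize t \<Longrightarrow> empirical t \<in> prob_vectors"
  by (simp add: prob_vectors_def empirical_def edge_count_nonneg sum_edge_count flip: sum_divide_distrib)

lemma prob_vectors_compact: "compact (prob_vectors :: (real ^ 'i::finite) set)"
proof -
  have "bounded (prob_vectors :: (real ^ 'i::finite) set)"
  proof (rule boundedI)
    fix \<mu> :: "real ^ 'i" assume \<mu>: "\<mu> \<in> prob_vectors"
    have "norm \<mu> \<le> (\<Sum>i\<in>UNIV. \<bar>\<mu> $ i\<bar>)" by (rule norm_le_l1_cart)
    also have "\<dots> = 1" using \<mu> by (simp add: prob_vectors_def)
    finally show "norm \<mu> \<le> 1" .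
  qed
  moreover have "closed (prob_vectors :: (real ^ 'i::finite) set)"
  proof -
    have eq: "(prob_vectors :: (real ^ 'i::finite) set) =
        (\<Inter>i. {\<mu>. 0 \<le> \<mu> $ i}) \<inter> {\<mu>. (\<Sum>i\<in>UNIV. \<mu> $ i) = 1}"
      by (auto simp: prob_vectors_def)
    show ?thesis
      unfolding eq
      by (intro closed_Int closed_INT ballI closed_Collect_le closed_Collect_eq continuous_intros)
  qed
  ultimately show ?thesis by (simp add: compact_eq_bounded_closed)
qed

lemma sum_UNIV_prod:
  fixes f :: "'a::finite \<times> 'b::finite \<Rightarrow> 'c::comm_monoid_add"
  shows "(\<Sum>e\<in>UNIV. f e) = (\<Sum>a\<in>UNIV. \<Sum>b\<in>UNIV. f (a, b))"
  by (simp add: sum.cartesian_product flip: UNIV_Times_UNIV)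

lemma sum_UNION_le:
  fixes f :: "'b \<Rightarrow> real"
  assumes "finite D" "\<And>d. d \<in> D \<Longrightarrow> finite (A d)" "\<And>x. 0 \<le> f x"
  shows "sum f (\<Union>d\<in>D. A d) \<le> (\<Sum>d\<in>D. sum f (A d))"
  using assms
proof (induction D rule: finite_induct)
  case (insert d D)
  have "sum f (A d \<union> (\<Union>d\<in>D. A d)) + sum f (A d \<inter> (\<Union>d\<in>D. A d)) = sum f (A d) + sum f (\<Union>d\<in>D. A d)"
    using insert by (intro sum.union_inter) auto
  moreover have "0 \<le> sum f (A d \<inter> (\<Union>d\<in>D. A d))"
    using insert.prems by (intro sum_nonneg)
  ultimately show ?case using insert by auto
qed simp

section \<open>Tilted kernels and their masses\<close>

locale tree_chain = offspring_law p for p +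
  fixes Q :: "'a::finite \<Rightarrow> 'a \<Rightarrow> real"
  assumes Q_nonneg: "\<And>a b. 0 \<le> Q a b"
    and Q_sum: "\<And>a. (\<Sum>b\<in>UNIV. Q a b) = 1"
    and Q_irreducible: "\<And>a b. (a, b) \<in> {(a, b). 0 < Q a b}\<^sup>*"
begin

text \<open>For every \<open>g\<close>, changing the weight of an edge \<open>(a, b)\<close> by the factor \<open>exp (edge_gain g (a, b))\<close>
  leaves the total mass of all trees finite, since the masses \<open>gf (normal g a)\<close> are a fixed point of
  the recursion. Hence \<open>lin_rate g\<close> is an exponential rate in Chernoff's bound.\<close>

definition normal :: "('a \<times> 'a \<Rightarrow> real) \<Rightarrow> 'a \<Rightarrow> real" where
  "normal g a = (\<Sum>b\<in>UNIV. Q a b * exp (g (a, b)))"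

definition edge_gain :: "('a \<times> 'a \<Rightarrow> real) \<Rightarrow> 'a \<times> 'a \<Rightarrow> real" where
  "edge_gain g e = g e - ln (gf (normal g (snd e)))"

definition tilted :: "('a \<times> 'a \<Rightarrow> real) \<Rightarrow> 'a \<Rightarrow> 'a \<Rightarrow> real" where
  "tilted g a b = Q a b * exp (edge_gain g (a, b))"

definition lin_rate :: "('a \<times> 'a \<Rightarrow> real) \<Rightarrow> real ^ ('a \<times> 'a) \<Rightarrow> real" where
  "lin_rate g \<mu> = (\<Sum>e\<in>UNIV. \<mu> $ e * edge_gain g e)"

lemma Q_row: "\<exists>b. 0 < Q a b"
proof (rule ccontr)
  assume "\<not> ?thesis"
  then have "Q a b = 0" for b using Q_nonneg[of a b] by (metis order_le_less)
  then show False using Q_sum[of a] by simp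
qed

lemma normal_pos: "0 < normal g a"
proof -
  obtain b where "0 < Q a b" using Q_row by auto
  then show ?thesis
    unfolding normal_def by (intro sum_pos2[of UNIV b]) (auto simp: Q_nonneg)
qed

lemma gf_normal_pos: "0 < gf (normal g a)"
  using gf_pos normal_pos less_imp_le by blast

lemma normal_0 [simp]: "normal (\<lambda>_. 0) a = 1"
  by (simp add: normal_def Q_sum)

lemma edge_gain_0 [simp]: "edge_gain (\<lambda>_. 0) e = 0"
  by (simp add: edge_gain_def gf_1)

lemma tilted_0 [simp]: "tilted (\<lambda>_. 0) = Q"
  by (simp add: tilted_def fun_eq_iff)

lemma lin_rate_0 [simp]: "lin_rate (\<lambda>_. 0) \<mu> = 0"
  by (simp add: lin_rate_def)

lemma tilted_nonneg: "0 \<le> tilted g a b"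
  by (simp add: tilted_def Q_nonneg)

lemma tilted_pos_iff: "0 < tilted g a b \<longleftrightarrow> 0 < Q a b"
  by (simp add: tilted_def zero_less_mult_iff)

text \<open>The logarithm subtracted in \<open>edge_gain\<close> cancels against the mass
  \<open>gf (normal g b)\<close> of the subtree below the edge; this is what makes these masses a
  fixed point for every g.\<close>

lemma tilted_sum: "(\<Sum>b\<in>UNIV. tilted g a b * gf (normal g b)) = normal g a"
proof -
  have "tilted g a b * gf (normal g b) = Q a b * exp (g (a, b))" for b
    using gf_normal_pos[of g b] by (simp add: tilted_def edge_gain_def exp_diff)
  then show ?thesis by (simp add: normal_def)
qed

lemma weight_tilted:
  "weight p (tilted g) t = weight p Q t * exp (\<Sum>e\<in>UNIV. edge_count t e * edge_gain g e)"
proof (induction t)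
  case (LNode a ts)
  have "(\<Prod>t\<leftarrow>ts. tilted g a (lab t) * weight p (tilted g) t) =
      (\<Prod>t\<leftarrow>ts. Q a (lab t) * weight p Q t) *
      exp (\<Sum>e\<in>UNIV. (\<Sum>t\<leftarrow>ts. of_bool ((a, lab t) = e) + edge_count t e) * edge_gain g e)"
    using LNode
  proof (induction ts)
    case (Cons t ts)
    have "tilted g a (lab t) * weight p (tilted g) t =
        Q a (lab t) * weight p Q t *
        exp (edge_gain g (a, lab t) + (\<Sum>e\<in>UNIV. edge_count t e * edge_gain g e))"
      using Cons.prems[of t] by (simp add: tilted_def[of g a "lab t"] exp_add)
    also have "edge_gain g (a, lab t) = (\<Sum>e\<in>UNIV. of_bool ((a, lab t) = e) * edge_gain g e)"
      by (simp add: of_bool_def if_distrib[of "\<lambda>x. x * _"] cong: if_cong)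
    finally have first: "tilted g a (lab t) * weight p (tilted g) t = Q a (lab t) * weight p Q t *
        exp ((\<Sum>e\<in>UNIV. of_bool ((a, lab t) = e) * edge_gain g e) +
          (\<Sum>e\<in>UNIV. edge_count t e * edge_gain g e))" .
    note IH = Cons.IH[OF Cons.prems]
    show ?case
      unfolding list.map prod_list.Cons sum_list.Cons first
      by (subst IH) (simp_all add: distrib_right sum.distrib exp_add)
  qed simp
  then show ?case by simp
qed

section \<open>Chernoff bounds\<close>

lemma lin_rate_empirical:
  assumes "2 \<le> tsize t"
  shows "(\<Sum>e\<in>UNIV. edge_count t e * edge_gain g e) = real (tsize t - 1) * lin_rate g (empirical t)"
  using assms by (simp add: lin_rate_def empirical_def sum_distrib_left)

text \<open>The density between two tilts depends on the tree only through its size and its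
  empirical pair measure, so it can be bounded uniformly on sets of pair measures.\<close>

lemma weight_retilt:
  assumes "2 \<le> tsize t"
  shows "weight p (tilted g) t = weight p (tilted h) t *
    exp (- real (tsize t - 1) * (lin_rate h (empirical t) - lin_rate g (empirical t)))"
  unfolding weight_tilted lin_rate_empirical[OF assms]
  by (simp add: algebra_simps flip: exp_add)

lemma tilted_weight_nonneg: "0 \<le> weight p (tilted g) t"
  by (intro weight_nonneg p_nonneg tilted_nonneg)

lemma tilted_mass_le: "tmass p (tilted g) a n \<le> gf (normal g a)"
proof -
  have "tmass p (tilted g) a n \<le> cmass p (tilted g) a n"
    unfolding tmass_def cmass_def
    by (intro sum_mono2) (auto simp: finite_trees_le' tilted_weight_nonneg)
  also have "\<dots> \<le> gf (normal g a)"
  proof (rule cmass_le_fixpoint)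
    show "(\<Sum>k\<le>m. p k * (\<Sum>b\<in>UNIV. tilted g a b * gf (normal g b)) ^ k) \<le> gf (normal g a)" for a m
      unfolding tilted_sum by (intro gf_ge_partial less_imp_le normal_pos)
  qed (auto simp: p_nonneg tilted_nonneg gf_normal_pos less_imp_le)
  finally show ?thesis .
qed

lemma tilted_sum_weight: "(\<Sum>t | tsize t = n. weight p (tilted g) t) = (\<Sum>a\<in>UNIV. tmass p (tilted g) a n)"
  unfolding tmass_def
  by (subst sum_lab) (auto intro!: sum.cong simp: finite_trees_eq[where P="\<lambda>_. True", simplified])

text \<open>The reference tilt g is arbitrary: g = 0 serves the upper bound, a critical g the
  concentration behind the lower bound.\<close>

lemma chernoff:
  assumes n: "2 \<le> n" and S: "\<And>\<mu>. \<mu> \<in> S \<Longrightarrow> \<alpha> \<le> lin_rate h \<mu> - lin_rate g \<mu>"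
  shows "(\<Sum>t | tsize t = n \<and> empirical t \<in> S. weight p (tilted g) t) \<le>
    (\<Sum>a\<in>UNIV. gf (normal h a)) * exp (- \<alpha> * real (n - 1))"
proof -
  have "(\<Sum>t | tsize t = n \<and> empirical t \<in> S. weight p (tilted g) t) \<le>
      (\<Sum>t | tsize t = n \<and> empirical t \<in> S. weight p (tilted h) t * exp (- \<alpha> * real (n - 1)))"
  proof (intro sum_mono)
    fix t :: "'a ltree" assume t: "t \<in> {t. tsize t = n \<and> empirical t \<in> S}"
    have "\<alpha> * real (n - 1) \<le> (lin_rate h (empirical t) - lin_rate g (empirical t)) * real (n - 1)"
      using t S by (intro mult_right_mono) auto
    moreover have "tsize t = n" using t by simp
    ultimately have "exp (- real (tsize t - 1) * (lin_rate h (empirical t) - lin_rate g (empirical t)))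
        \<le> exp (- \<alpha> * real (n - 1))"
      by (simp only: exp_le_cancel_iff mult_minus_left neg_le_iff_le mult.commute)
    then have "weight p (tilted h) t *
        exp (- real (tsize t - 1) * (lin_rate h (empirical t) - lin_rate g (empirical t)))
        \<le> weight p (tilted h) t * exp (- \<alpha> * real (n - 1))"
      by (intro mult_left_mono tilted_weight_nonneg)
    moreover have "weight p (tilted g) t = weight p (tilted h) t *
        exp (- real (tsize t - 1) * (lin_rate h (empirical t) - lin_rate g (empirical t)))"
      using t n by (intro weight_retilt) auto
    ultimately show "weight p (tilted g) t \<le> weight p (tilted h) t * exp (- \<alpha> * real (n - 1))"
      by simp
  qed
  also have "\<dots> \<le> (\<Sum>t | tsize t = n. weight p (tilted h) t * exp (- \<alpha> * real (n - 1)))"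
    by (intro sum_mono2 mult_nonneg_nonneg tilted_weight_nonneg)
       (auto simp: finite_trees_eq[where P="\<lambda>_. True", simplified])
  also have "\<dots> = (\<Sum>a\<in>UNIV. tmass p (tilted h) a n) * exp (- \<alpha> * real (n - 1))"
    by (simp add: tilted_sum_weight flip: sum_distrib_right)
  also have "\<dots> \<le> (\<Sum>a\<in>UNIV. gf (normal h a)) * exp (- \<alpha> * real (n - 1))"
    by (intro mult_right_mono sum_mono tilted_mass_le) auto
  finally show ?thesis .
qed

lemma continuous_lin_rate: "continuous_on S (lin_rate g)"
  unfolding lin_rate_def by (intro continuous_intros)

text \<open>Each strict inequality persists in a neighbourhood, and finitely many neighbourhoods
  cover C. The strict gain \<eta> > \<beta> later absorbs the subexponential losses.\<close>

lemma chernoff_compact: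
  assumes C: "compact C" and ex: "\<And>\<mu>. \<mu> \<in> C \<Longrightarrow> \<exists>h. \<beta> < lin_rate h \<mu> - lin_rate g \<mu>"
  shows "\<exists>\<eta>>\<beta>. \<exists>R\<ge>0. \<forall>n\<ge>2.
    (\<Sum>t | tsize t = n \<and> empirical t \<in> C. weight p (tilted g) t) \<le> R * exp (- \<eta> * real (n - 1))"
proof -
  obtain h where h: "\<And>\<mu>. \<mu> \<in> C \<Longrightarrow> \<beta> < lin_rate (h \<mu>) \<mu> - lin_rate g \<mu>" using ex by metis
  define e where "e \<mu> = (\<beta> + (lin_rate (h \<mu>) \<mu> - lin_rate g \<mu>)) / 2" for \<mu>
  define U where "U \<mu> = {\<nu>. e \<mu> < lin_rate (h \<mu>) \<nu> - lin_rate g \<nu>}" for \<mu>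
  have e: "\<beta> < e \<mu>" "\<mu> \<in> U \<mu>" if "\<mu> \<in> C" for \<mu>
    using h[OF that] by (auto simp: e_def U_def)
  have U: "open (U \<mu>)" for \<mu>
    unfolding U_def by (intro open_Collect_less continuous_intros continuous_lin_rate)
  obtain D where D: "D \<subseteq> C" "finite D" "C \<subseteq> (\<Union>\<mu>\<in>D. U \<mu>)"
  proof (rule compactE_image[OF C])
    show "open (U \<mu>)" for \<mu> by (rule U)
    show "C \<subseteq> (\<Union>\<mu>\<in>C. U \<mu>)" using e by auto
  qed
  \<comment> \<open>The extra element covers the case of an empty cover, that is empty C.\<close>
  define \<eta> where "\<eta> = Min (insert (\<beta> + 1) (e ` D))"
  have \<eta>: "\<beta> < \<eta>" unfolding \<eta>_def using D e by (subst Min_gr_iff) auto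
  have \<eta>_le: "\<eta> \<le> e \<mu>" if "\<mu> \<in> D" for \<mu>
    unfolding \<eta>_def using D that by (intro Min_le) auto
  define R where "R = (\<Sum>\<mu>\<in>D. \<Sum>a\<in>UNIV. gf (normal (h \<mu>) a))"
  have "0 \<le> R" unfolding R_def by (intro sum_nonneg less_imp_le gf_normal_pos)
  moreover have "(\<Sum>t | tsize t = n \<and> empirical t \<in> C. weight p (tilted g) t) \<le> R * exp (- \<eta> * real (n - 1))"
    if n: "2 \<le> n" for n
  proof -
    have "(\<Sum>t | tsize t = n \<and> empirical t \<in> C. weight p (tilted g) t) \<le>
        (\<Sum>t\<in>(\<Union>\<mu>\<in>D. {t. tsize t = n \<and> empirical t \<in> U \<mu>}). weight p (tilted g) t)"
      using D by (intro sum_mono2 tilted_weight_nonneg) (auto simp: finite_trees_eq)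
    also have "\<dots> \<le> (\<Sum>\<mu>\<in>D. \<Sum>t | tsize t = n \<and> empirical t \<in> U \<mu>. weight p (tilted g) t)"
      using D by (intro sum_UNION_le) (auto simp: tilted_weight_nonneg finite_trees_eq)
    also have "\<dots> \<le> (\<Sum>\<mu>\<in>D. (\<Sum>a\<in>UNIV. gf (normal (h \<mu>) a)) * exp (- \<eta> * real (n - 1)))"
      using n \<eta>_le by (intro sum_mono chernoff) (force simp: U_def)+
    also have "\<dots> = R * exp (- \<eta> * real (n - 1))"
      by (simp add: R_def sum_distrib_right)
    finally show ?thesis .
  qed
  ultimately show ?thesis using \<eta> by blast
qed

section \<open>Critical points of the linear rates\<close>

lemma lin_rate_alt:
  "lin_rate g \<mu> = (\<Sum>e\<in>UNIV. \<mu> $ e * g e) - (\<Sum>b\<in>UNIV. marginal2 \<mu> $ b * ln (gf (normal g b)))"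
proof -
  have "lin_rate g \<mu> = (\<Sum>e\<in>UNIV. \<mu> $ e * g e) - (\<Sum>e\<in>UNIV. \<mu> $ e * ln (gf (normal g (snd e))))"
    by (simp add: lin_rate_def edge_gain_def algebra_simps sum_subtractf)
  also have "(\<Sum>e\<in>UNIV. \<mu> $ e * ln (gf (normal g (snd e)))) = (\<Sum>b\<in>UNIV. marginal2 \<mu> $ b * ln (gf (normal g b)))"
    unfolding sum_UNIV_prod by (subst sum.swap) (simp add: marginal2_def sum_distrib_right)
  finally show ?thesis .
qed

lemma sum_marginal1: "(\<Sum>b\<in>UNIV. marginal1 \<mu> $ b) = (\<Sum>e\<in>UNIV. \<mu> $ e)"
  unfolding sum_UNIV_prod by (simp add: marginal1_def)

text \<open>The first-order condition at a maximising tilt: varying g at the single edge (a, b)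
  changes only \<open>normal g a\<close>, so the derivative involves one letter.\<close>

lemma stationary_gradient:
  assumes max: "\<And>h. lin_rate h \<mu> \<le> lin_rate g \<mu>"
  shows "\<mu> $ (a, b) = marginal2 \<mu> $ a * (gf' (normal g a) / gf (normal g a) * Q a b * exp (g (a, b)))"
proof -
  define h where "h t = (\<lambda>e. g e + (if e = (a, b) then t else 0))" for t
  define c where "c = Q a b * exp (g (a, b))"
  have normal_h: "normal (h t) d = normal g d + (if d = a then c * (exp t - 1) else 0)" for t d
  proof -
    have "normal (h t) d = (\<Sum>b'\<in>UNIV. Q d b' * exp (g (d, b')) +
        (if b' = b then if d = a then c * (exp t - 1) else 0 else 0))"
      unfolding normal_def h_def by (intro sum.cong refl) (auto simp: c_def exp_add algebra_simps)
    then show ?thesis by (simp add: sum.distrib normal_def)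
  qed
  have 1: "(\<Sum>e\<in>UNIV. \<mu> $ e * h t e) = (\<Sum>e\<in>UNIV. \<mu> $ e * g e) + \<mu> $ (a, b) * t" for t
    by (simp add: h_def distrib_left sum.distrib if_distrib[of "\<lambda>x. _ * x"] cong: if_cong)
  have 2: "(\<Sum>d\<in>UNIV. marginal2 \<mu> $ d * ln (gf (normal (h t) d))) =
      (\<Sum>d\<in>UNIV. marginal2 \<mu> $ d * ln (gf (normal g d))) +
      marginal2 \<mu> $ a * (ln (gf (normal g a + c * (exp t - 1))) - ln (gf (normal g a)))" for t
  proof -
    have "(\<Sum>d\<in>UNIV. marginal2 \<mu> $ d * ln (gf (normal (h t) d))) =
        (\<Sum>d\<in>UNIV. marginal2 \<mu> $ d * ln (gf (normal g d)) +
          (if d = a then marginal2 \<mu> $ a * (ln (gf (normal g a + c * (exp t - 1))) - ln (gf (normal g a))) else 0))"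
      by (intro sum.cong refl) (auto simp: normal_h algebra_simps)
    then show ?thesis by (simp add: sum.distrib)
  qed
  define f where "f t = lin_rate (h t) \<mu>" for t
  have f: "f t = lin_rate g \<mu> + \<mu> $ (a, b) * t -
      marginal2 \<mu> $ a * (ln (gf (normal g a + c * (exp t - 1))) - ln (gf (normal g a)))" for t
    unfolding f_def lin_rate_alt 1 2 by simp
  have "(f has_field_derivative \<mu> $ (a, b) - marginal2 \<mu> $ a * (gf' (normal g a) * c / gf (normal g a))) (at 0)"
  proof -
    have "((\<lambda>t. gf (normal g a + c * (exp t - 1))) has_field_derivative gf' (normal g a) * c) (at 0)"
    proof -
      have "((\<lambda>t. normal g a + c * (exp t - 1)) has_field_derivative c) (at 0)"
        by (auto intro!: derivative_eq_intros)
      from DERIV_chain2[where f=gf, OF gf_has_derivative this] show ?thesis by simp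
    qed
    then show ?thesis
      unfolding f[abs_def] using gf_normal_pos[of g a]
      by (auto intro!: derivative_eq_intros)
  qed
  moreover have "f t \<le> f 0" for t
    using max[of "h t"] by (simp add: f_def h_def)
  ultimately have "\<mu> $ (a, b) - marginal2 \<mu> $ a * (gf' (normal g a) * c / gf (normal g a)) = 0"
    by (intro DERIV_local_max[of f _ 0 1]) auto
  then show ?thesis by (simp add: c_def mult.assoc)
qed

lemma prob_vectors_nonneg: "\<mu> \<in> prob_vectors \<Longrightarrow> 0 \<le> \<mu> $ e"
  by (simp add: prob_vectors_def)

text \<open>The density of \<open>marginal2 \<nu>\<close> with respect to \<open>marginal2 \<mu>\<close> is harmonic for the time-reversed
  chain, hence constant.\<close>

lemma stationary_unique:
  assumes \<mu>: "\<mu> \<in> prob_vectors" and \<nu>: "\<nu> \<in> prob_vectors"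
    and supp: "\<And>a b. 0 < Q a b \<Longrightarrow> 0 < \<mu> $ (a, b)"
    and pos: "\<And>a. 0 < marginal2 \<mu> $ a"
    and eq: "\<And>a b. \<nu> $ (a, b) = marginal2 \<nu> $ a / marginal2 \<mu> $ a * \<mu> $ (a, b)"
  shows "\<nu> = \<mu>"
proof -
  define \<rho> where "\<rho> a = marginal2 \<nu> $ a / marginal2 \<mu> $ a" for a
  define m where "m = Max (range \<rho>)"
  have m: "\<rho> a \<le> m" for a unfolding m_def by (intro Max_ge) auto
  have "m \<in> range \<rho>" unfolding m_def by (intro Max_in) auto
  then obtain b0 where b0: "\<rho> b0 = m" by auto
  have \<nu>_\<rho>: "\<nu> $ (a, b) = \<rho> a * \<mu> $ (a, b)" for a b
    using eq by (simp add: \<rho>_def)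
  \<comment> \<open>Maximum principle: \<rho>(b) is the average of \<rho>(a) over predecessors a
    with weights \<mu>(a, b), so a maximal value at b is shared by every predecessor.\<close>
  have up: "\<rho> a = m" if b: "\<rho> b = m" and Q: "0 < Q a b" for a b
  proof -
    have "(\<Sum>a\<in>UNIV. (m - \<rho> a) * \<mu> $ (a, b)) = m * marginal2 \<mu> $ b - (\<Sum>a\<in>UNIV. \<nu> $ (a, b))"
      by (simp add: left_diff_distrib sum_subtractf marginal2_def \<nu>_\<rho> sum_distrib_left)
    also have "(\<Sum>a\<in>UNIV. \<nu> $ (a, b)) = \<rho> b * marginal2 \<mu> $ b"
      using pos[of b] by (simp add: \<rho>_def marginal2_def)
    finally have "(\<Sum>a\<in>UNIV. (m - \<rho> a) * \<mu> $ (a, b)) = 0" using b by simp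
    then have "(m - \<rho> a) * \<mu> $ (a, b) = 0"
      using m prob_vectors_nonneg[OF \<mu>] by (subst (asm) sum_nonneg_eq_0_iff) auto
    then show ?thesis using supp[OF Q] by auto
  qed
  have "\<rho> a = m" for a
    using Q_irreducible[of a b0]
  proof (induction rule: converse_rtrancl_induct)
    case (step y z)
    then show ?case using up[of z y] by simp
  qed (rule b0)
  then have \<nu>_eq: "\<nu> $ e = m * \<mu> $ e" for e
    using eq[of "fst e" "snd e"] by (simp add: \<rho>_def)
  have "(\<Sum>e\<in>UNIV. \<nu> $ e) = m * (\<Sum>e\<in>UNIV. \<mu> $ e)"
    by (simp add: \<nu>_eq sum_distrib_left)
  then have "m = 1" using \<mu> \<nu> by (simp add: prob_vectors_def)
  then show ?thesis using \<nu>_eq by (simp add: vec_eq_iff)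
qed

text \<open>The equation of \<open>stationary_gradient\<close>. The factor of
  \<open>marginal2 \<mu> $ a\<close> is the mean number of b-children of an a-vertex under the
  tilted law, so \<mu> is the pair measure of a tilted chain in equilibrium.\<close>

definition critical_tilt :: "('a \<times> 'a \<Rightarrow> real) \<Rightarrow> real ^ ('a \<times> 'a) \<Rightarrow> bool" where
  "critical_tilt g \<mu> \<longleftrightarrow> \<mu> \<in> prob_vectors \<and> (\<forall>a. 0 < marginal2 \<mu> $ a) \<and>
     (\<forall>a b. \<mu> $ (a, b) = marginal2 \<mu> $ a * (gf' (normal g a) / gf (normal g a) * Q a b * exp (g (a, b))))"

text \<open>Summed over a, the equation makes \<open>marginal2 \<mu>\<close> a left eigenvector,
  with eigenvalue 1, of the matrix of tilted mean offspring numbers; dividing by the masses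
  \<open>gf (normal g a)\<close> passes to the unnormalised weights.\<close>

lemma critical_tilt_weight:
  assumes "critical_tilt g \<mu>"
  shows "critical_weight p (tilted g) (\<lambda>a. gf (normal g a)) (\<lambda>a. marginal2 \<mu> $ a / gf (normal g a))"
proof
  show "\<exists>b. 0 < tilted g a b" for a using Q_row by (simp add: tilted_pos_iff)
  show "(a, b) \<in> {(a, b). 0 < tilted g a b}\<^sup>*" for a b
    using Q_irreducible by (simp add: tilted_pos_iff)
  show "0 < marginal2 \<mu> $ a / gf (normal g a)" for a
    using assms gf_normal_pos by (simp add: critical_tilt_def)
  show "marginal2 \<mu> $ b / gf (normal g b) = (\<Sum>a\<in>UNIV. marginal2 \<mu> $ a / gf (normal g a) *
      gf' (\<Sum>c\<in>UNIV. tilted g a c * gf (normal g c)) * tilted g a b)" for b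
  proof -
    have "marginal2 \<mu> $ b = (\<Sum>a\<in>UNIV. \<mu> $ (a, b))" by (simp add: marginal2_def)
    also have "\<dots> / gf (normal g b) = (\<Sum>a\<in>UNIV. \<mu> $ (a, b) / gf (normal g b))"
      by (rule sum_divide_distrib)
    also have "\<dots> = (\<Sum>a\<in>UNIV. marginal2 \<mu> $ a / gf (normal g a) * gf' (normal g a) * tilted g a b)"
    proof (intro sum.cong refl)
      fix a
      have "\<mu> $ (a, b) = marginal2 \<mu> $ a * (gf' (normal g a) / gf (normal g a) * Q a b * exp (g (a, b)))"
        using assms by (simp add: critical_tilt_def)
      then show "\<mu> $ (a, b) / gf (normal g b) =
          marginal2 \<mu> $ a / gf (normal g a) * gf' (normal g a) * tilted g a b"
        using gf_normal_pos[of g b] by (simp add: tilted_def edge_gain_def exp_diff)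
    qed
    finally show ?thesis by (simp add: tilted_sum)
  qed
qed (auto simp: tilted_nonneg tilted_sum gf_normal_pos less_imp_le)

text \<open>If no h improved on g at \<nu>, then \<nu> would satisfy the same first-order equation
  as \<mu>, and \<open>stationary_unique\<close> would identify them. So the Chernoff rate relative
  to g is positive away from \<mu>.\<close>

lemma critical_tilt_unique:
  assumes crit: "critical_tilt g \<mu>" and \<nu>: "\<nu> \<in> prob_vectors" "\<nu> \<noteq> \<mu>"
  shows "\<exists>h. 0 < lin_rate h \<nu> - lin_rate g \<nu>"
proof (rule ccontr)
  assume "\<not> ?thesis"
  then have "lin_rate h \<nu> \<le> lin_rate g \<nu>" for h by (simp add: not_less)
  note grad = stationary_gradient[OF this]
  have \<mu>_eq: "\<mu> $ (a, b) = marginal2 \<mu> $ a * (gf' (normal g a) / gf (normal g a) * Q a b * exp (g (a, b)))"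
    and pos: "0 < marginal2 \<mu> $ a" for a b
    using crit by (simp_all add: critical_tilt_def)
  have "\<nu> = \<mu>"
  proof (rule stationary_unique)
    show "0 < \<mu> $ (a, b)" if "0 < Q a b" for a b
      unfolding \<mu>_eq using that pos[of a] gf'_pos[OF normal_pos] gf_normal_pos by simp
    show "\<nu> $ (a, b) = marginal2 \<nu> $ a / marginal2 \<mu> $ a * \<mu> $ (a, b)" for a b
      using grad[of a b] \<mu>_eq[of a b] pos[of a] by simp
  qed (use crit \<nu> in \<open>auto simp: critical_tilt_def\<close>)
  then show False using \<nu> by simp
qed

text \<open>A size of positive mass carries a tree of positive weight whose root label is charged by
  i. Tilting keeps that weight positive, so the subexponential bound applies to this root
  label.\<close>

lemma critical_mass_lower_bound:
  assumes crit: "critical_tilt g \<mu>" and \<delta>: "0 < \<delta>" and i: "\<And>a. 0 \<le> i a"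
  shows "\<exists>C>0. \<forall>n. 0 < (\<Sum>t | tsize t = n. i (lab t) * weight p Q t) \<longrightarrow>
    C * exp (- \<delta> * real n) \<le> (\<Sum>t | tsize t = n. i (lab t) * weight p (tilted g) t)"
proof -
  interpret critical_weight p "tilted g" "\<lambda>a. gf (normal g a)" "\<lambda>a. marginal2 \<mu> $ a / gf (normal g a)"
    by (rule critical_tilt_weight[OF crit])
  obtain C where C: "\<And>a. 0 < C a"
      "\<And>a n. 0 < tmass p (tilted g) a n \<Longrightarrow> C a * exp (- \<delta> * real n) \<le> tmass p (tilted g) a n"
    using tmass_subexponential[OF \<delta>] by metis
  \<comment> \<open>The available root label depends on n, hence a minimum over all letters charged
    by i.\<close>
  define C' where "C' = Min (insert 1 ((\<lambda>a. i a * C a) ` {a. 0 < i a}))"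
  have "0 < C'" unfolding C'_def using C by (subst Min_gr_iff) auto
  moreover have "C' * exp (- \<delta> * real n) \<le> (\<Sum>t | tsize t = n. i (lab t) * weight p (tilted g) t)"
    if pos: "0 < (\<Sum>t | tsize t = n. i (lab t) * weight p Q t)" for n
  proof -
    have wQ: "0 \<le> weight p Q t" for t using tilted_weight_nonneg[of "\<lambda>_. 0"] by simp
    have "\<exists>t. tsize t = n \<and> 0 < i (lab t) * weight p Q t"
    proof (rule ccontr)
      assume "\<not> ?thesis"
      then have "(\<Sum>t | tsize t = n. i (lab t) * weight p Q t) \<le> 0"
        by (intro sum_nonpos) (auto simp: not_less)
      then show False using pos by simp
    qed
    then obtain t where t: "tsize t = n" "0 < i (lab t) * weight p Q t" by blast
    then have it: "0 < i (lab t)" "0 < weight p Q t"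
      using i[of "lab t"] wQ[of t] by (auto simp: zero_less_mult_iff)
    have "0 < weight p (tilted g) t" using it by (simp add: weight_tilted)
    also have "\<dots> \<le> tmass p (tilted g) (lab t) n"
      unfolding tmass_def using t
      by (intro member_le_sum) (auto simp: finite_trees_eq tilted_weight_nonneg)
    finally have "C (lab t) * exp (- \<delta> * real n) \<le> tmass p (tilted g) (lab t) n" by (rule C)
    then have "i (lab t) * C (lab t) * exp (- \<delta> * real n) \<le> i (lab t) * tmass p (tilted g) (lab t) n"
      using i by (simp add: mult.assoc mult_left_mono)
    moreover have "C' * exp (- \<delta> * real n) \<le> i (lab t) * C (lab t) * exp (- \<delta> * real n)"
      unfolding C'_def using it by (intro mult_right_mono Min_le) auto
    moreover have "i (lab t) * tmass p (tilted g) (lab t) n =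
        (\<Sum>s | tsize s = n \<and> lab s = lab t. i (lab s) * weight p (tilted g) s)"
      by (simp add: tmass_def sum_distrib_left)
    moreover have "\<dots> \<le> (\<Sum>s | tsize s = n. i (lab s) * weight p (tilted g) s)"
      by (intro sum_mono2 mult_nonneg_nonneg i tilted_weight_nonneg)
         (auto simp: finite_trees_eq[where P="\<lambda>_. True", simplified])
    ultimately show ?thesis by linarith
  qed
  ultimately show ?thesis by blast
qed

lemma eventually_exp_dominates:
  assumes "0 < c" "a < b"
  shows "\<forall>\<^sub>F n in sequentially. R * exp (- b * real (n - 1)) \<le> c * exp (- a * real n)"
proof -
  have "(\<lambda>n. \<bar>R\<bar> * exp b * exp (- (b - a) * real n)) \<longlonglongrightarrow> 0"
  proof -
    have "(\<lambda>n. \<bar>R\<bar> * exp b * exp (- (b - a)) ^ n) \<longlonglongrightarrow> \<bar>R\<bar> * exp b * 0"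
      using assms by (intro tendsto_mult_left LIMSEQ_realpow_zero) auto
    then show ?thesis by (simp add: mult.commute flip: exp_of_nat_mult)
  qed
  then have "\<forall>\<^sub>F n in sequentially. \<bar>R\<bar> * exp b * exp (- (b - a) * real n) < c"
    using \<open>0 < c\<close> by (rule order_tendstoD(2))
  then show ?thesis
    using eventually_ge_at_top[of 1]
  proof eventually_elim
    case (elim n)
    have "R * exp (- b * real (n - 1)) \<le> \<bar>R\<bar> * exp (- b * real (n - 1))"
      by (intro mult_right_mono) auto
    also have "\<dots> = \<bar>R\<bar> * exp b * exp (- (b - a) * real n) * exp (- a * real n)"
      using elim(2) by (simp add: of_nat_diff algebra_simps flip: exp_add)
    also have "\<dots> \<le> c * exp (- a * real n)"
      using elim(1) by (intro mult_right_mono) auto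
    finally show ?case .
  qed
qed

text \<open>Under the tilted weights, trees with pair measure outside a small neighbourhood V of
  \<mu> are exponentially negligible against the total mass, so V keeps half of its lower bound.
  Removing the tilt on V costs at most the factor exp (- x) per edge.\<close>

lemma critical_lower_bound:
  assumes crit: "critical_tilt g \<mu>" and \<delta>: "0 < \<delta>"
    and i: "\<And>a. 0 \<le> i a" "\<And>a. i a \<le> 1" and U: "open U" "\<mu> \<in> U"
  shows "\<exists>C>0. \<forall>\<^sub>F n in sequentially. 0 < (\<Sum>t | tsize t = n. i (lab t) * weight p Q t) \<longrightarrow>
    C * exp (- (lin_rate g \<mu> + \<delta>) * real n) \<le>
      (\<Sum>t | tsize t = n \<and> empirical t \<in> prob_vectors \<inter> U. i (lab t) * weight p Q t)"
proof -
  define x where "x = lin_rate g \<mu> + \<delta> / 2"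
  define V where "V = U \<inter> {\<nu>. lin_rate g \<nu> < x}"
  have V: "open V" "\<mu> \<in> V"
    unfolding V_def using U \<delta>
    by (auto simp: x_def intro!: open_Int open_Collect_less continuous_intros continuous_lin_rate)
  have "compact (prob_vectors - V)"
    using V by (intro compact_diff prob_vectors_compact)
  moreover have "\<exists>h. 0 < lin_rate h \<nu> - lin_rate g \<nu>" if "\<nu> \<in> prob_vectors - V" for \<nu>
    using critical_tilt_unique[OF crit, of \<nu>] that V by auto
  ultimately obtain \<eta> R where \<eta>: "0 < \<eta>" and R: "\<And>n. 2 \<le> n \<Longrightarrow>
      (\<Sum>t | tsize t = n \<and> empirical t \<in> prob_vectors - V. weight p (tilted g) t) \<le> R * exp (- \<eta> * real (n - 1))"
    using chernoff_compact[of "prob_vectors - V" 0 g] by meson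
  \<comment> \<open>At most \<delta> / 2, the part of \<delta> not spent in x, and below \<eta>, so
    that the trees outside V use up at most half of the guaranteed mass.\<close>
  define \<delta>' where "\<delta>' = min (\<delta> / 2) (\<eta> / 2)"
  have \<delta>': "0 < \<delta>'" "\<delta>' \<le> \<delta> / 2" "\<delta>' < \<eta>" using \<delta> \<eta> by (auto simp: \<delta>'_def)
  obtain C where C: "0 < C" "\<And>n. 0 < (\<Sum>t | tsize t = n. i (lab t) * weight p Q t) \<Longrightarrow>
      C * exp (- \<delta>' * real n) \<le> (\<Sum>t | tsize t = n. i (lab t) * weight p (tilted g) t)"
    using critical_mass_lower_bound[OF crit \<delta>'(1) i(1)] by meson
  have "\<forall>\<^sub>F n in sequentially. R * exp (- \<eta> * real (n - 1)) \<le> C / 2 * exp (- \<delta>' * real n)"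
    using C \<delta>' by (intro eventually_exp_dominates) auto
  then have "\<forall>\<^sub>F n in sequentially. 0 < (\<Sum>t | tsize t = n. i (lab t) * weight p Q t) \<longrightarrow>
    C / 2 * exp x * exp (- (lin_rate g \<mu> + \<delta>) * real n) \<le>
      (\<Sum>t | tsize t = n \<and> empirical t \<in> prob_vectors \<inter> U. i (lab t) * weight p Q t)"
    using eventually_ge_at_top[of 2]
  proof (eventually_elim, intro impI)
    fix n assume n: "2 \<le> n" and pos: "0 < (\<Sum>t | tsize t = n. i (lab t) * weight p Q t)"
      and small: "R * exp (- \<eta> * real (n - 1)) \<le> C / 2 * exp (- \<delta>' * real n)"
    let ?w = "\<lambda>t. i (lab t) * weight p (tilted g) t"
    let ?A = "{t :: 'a ltree. tsize t = n \<and> empirical t \<in> prob_vectors \<inter> V}"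
    let ?B = "{t :: 'a ltree. tsize t = n \<and> empirical t \<in> prob_vectors - V}"
    have w: "0 \<le> ?w t" for t by (intro mult_nonneg_nonneg i tilted_weight_nonneg)
    have "{t :: 'a ltree. tsize t = n} = ?A \<union> ?B"
      using empirical_in_prob_vectors n by auto
    then have "(\<Sum>t | tsize t = n. ?w t) = sum ?w ?A + sum ?w ?B"
      by (simp only:, intro sum.union_disjoint) (auto simp: finite_trees_eq)
    moreover have "sum ?w ?B \<le> (\<Sum>t\<in>?B. weight p (tilted g) t)"
      by (intro sum_mono mult_left_le_one_le tilted_weight_nonneg i)
    ultimately have "C / 2 * exp (- \<delta>' * real n) \<le> sum ?w ?A"
      using C(2)[OF pos] R[OF n] small by linarith
    moreover have "C / 2 * exp x * exp (- (lin_rate g \<mu> + \<delta>) * real n) \<le>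
        C / 2 * exp (- \<delta>' * real n) * exp (- x * real (n - 1))"
    proof -
      have "\<delta>' * real n \<le> \<delta> / 2 * real n"
        by (intro mult_right_mono \<delta>') auto
      then have "x + - (lin_rate g \<mu> + \<delta>) * real n \<le> - \<delta>' * real n + - x * real (n - 1)"
        using n by (simp add: x_def of_nat_diff field_simps)
      then have "exp (x + - (lin_rate g \<mu> + \<delta>) * real n) \<le> exp (- \<delta>' * real n + - x * real (n - 1))"
        by (simp only: exp_le_cancel_iff)
      then have "C / 2 * exp (x + - (lin_rate g \<mu> + \<delta>) * real n) \<le> C / 2 * exp (- \<delta>' * real n + - x * real (n - 1))"
        using C(1) by (intro mult_left_mono) auto
      then show ?thesis by (simp only: exp_add mult.assoc)
    qed
    ultimately have "C / 2 * exp x * exp (- (lin_rate g \<mu> + \<delta>) * real n) \<le> sum ?w ?A * exp (- x * real (n - 1))"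
      by (meson exp_ge_zero mult_right_mono order_trans)
    also have "\<dots> = (\<Sum>t\<in>?A. ?w t * exp (- x * real (n - 1)))" by (rule sum_distrib_right)
    also have "\<dots> \<le> (\<Sum>t\<in>?A. i (lab t) * weight p Q t)"
    proof (intro sum_mono)
      fix t assume t: "t \<in> ?A"
      have "lin_rate g (empirical t) * real (n - 1) \<le> x * real (n - 1)"
        using t by (intro mult_right_mono) (auto simp: V_def)
      then have "exp (- x * real (n - 1)) \<le> exp (- real (tsize t - 1) * lin_rate g (empirical t))"
        using t by (simp add: mult.commute)
      then have "?w t * exp (- x * real (n - 1)) \<le> ?w t * exp (- real (tsize t - 1) * lin_rate g (empirical t))"
        by (intro mult_left_mono w)
      also have "\<dots> = i (lab t) * weight p Q t"
        using weight_retilt[of t "\<lambda>_. 0" g] weight_tilted[of g t] lin_rate_empirical[of t g] t n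
        by (simp add: mult.assoc flip: exp_add)
      finally show "?w t * exp (- x * real (n - 1)) \<le> i (lab t) * weight p Q t" .
    qed
    also have "\<dots> \<le> (\<Sum>t | tsize t = n \<and> empirical t \<in> prob_vectors \<inter> U. i (lab t) * weight p Q t)"
      using tilted_weight_nonneg[of "\<lambda>_. 0"] i
      by (intro sum_mono2) (auto simp: finite_trees_eq V_def)
    finally show "C / 2 * exp x * exp (- (lin_rate g \<mu> + \<delta>) * real n) \<le>
        (\<Sum>t | tsize t = n \<and> empirical t \<in> prob_vectors \<inter> U. i (lab t) * weight p Q t)" .
  qed
  then show ?thesis using C(1) by (intro exI[of _ "C / 2 * exp x"]) auto
qed

end

section \<open>The rate function\<close>

text \<open>The parameter l(a) is chosen independently for each a, so suprema may be taken one
  coordinate at a time.\<close>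

lemma sum_SUP_ereal_le:
  fixes f :: "'b \<Rightarrow> 'c \<Rightarrow> real"
  assumes "finite A" "\<And>l. (\<Sum>a\<in>A. f a (l a)) \<le> c"
  shows "(\<Sum>a\<in>A. SUP l. ereal (f a l)) \<le> ereal c"
  using assms
proof (induction A arbitrary: c rule: finite_induct)
  case (insert a A)
  define R where "R = (\<Sum>a\<in>A. SUP l. ereal (f a l))"
  have R: "R \<le> ereal (c - f a x)" for x
    unfolding R_def
  proof (rule insert.IH)
    fix l
    have "(\<Sum>b\<in>insert a A. f b ((l(a := x)) b)) = f a x + (\<Sum>b\<in>A. f b ((l(a := x)) b))"
      using insert.hyps by simp
    also have "(\<Sum>b\<in>A. f b ((l(a := x)) b)) = (\<Sum>b\<in>A. f b (l b))"
      using insert.hyps by (intro sum.cong) auto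
    finally show "(\<Sum>b\<in>A. f b (l b)) \<le> c - f a x"
      using insert.prems[of "l(a := x)"] by linarith
  qed
  \<comment> \<open>A lower bound as well, so that R is a real number and may be subtracted.\<close>
  have "ereal (\<Sum>b\<in>A. f b undefined) \<le> R"
    unfolding R_def sum_ereal[symmetric] by (intro sum_mono SUP_upper) auto
  then obtain r where r: "R = ereal r"
    using R[of undefined] by (cases R) auto
  have "(SUP l. ereal (f a l)) \<le> ereal (c - r)"
    using R by (intro SUP_least) (auto simp: r algebra_simps)
  then have "(SUP l. ereal (f a l)) + R \<le> ereal (c - r) + ereal r"
    unfolding r by (rule add_right_mono)
  then show ?case
    using insert.hyps by (simp add: R_def)
qed simp

lemma marginal_nonneg:
  assumes "\<mu> \<in> prob_vectors"
  shows "0 \<le> marginal1 \<mu> $ a" "0 \<le> marginal2 \<mu> $ b"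
  using assms by (auto simp: marginal1_def marginal2_def prob_vectors_def intro!: sum_nonneg)

lemma le_marginal:
  assumes "\<mu> \<in> prob_vectors"
  shows "\<mu> $ (a, b) \<le> marginal1 \<mu> $ a" "\<mu> $ (a, b) \<le> marginal2 \<mu> $ b"
proof -
  show "\<mu> $ (a, b) \<le> marginal1 \<mu> $ a"
    using assms member_le_sum[of b UNIV "\<lambda>b. \<mu> $ (a, b)"] by (simp add: marginal1_def prob_vectors_def)
  show "\<mu> $ (a, b) \<le> marginal2 \<mu> $ b"
    using assms member_le_sum[of a UNIV "\<lambda>a. \<mu> $ (a, b)"] by (simp add: marginal2_def prob_vectors_def)
qed

lemma convex_prob_vectors: "convex prob_vectors"
proof (rule convexI)
  fix x y :: "real ^ 'i" and u v :: real
  assume "x \<in> prob_vectors" "y \<in> prob_vectors" "0 \<le> u" "0 \<le> v" "u + v = 1"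
  then show "u *\<^sub>R x + v *\<^sub>R y \<in> prob_vectors"
    by (auto simp: prob_vectors_def sum.distrib simp flip: sum_distrib_left)
qed

lemma marginal_convex:
  "marginal1 (u *\<^sub>R \<mu> + v *\<^sub>R \<nu>) $ a = u * marginal1 \<mu> $ a + v * marginal1 \<nu> $ a"
  "marginal2 (u *\<^sub>R \<mu> + v *\<^sub>R \<nu>) $ b = u * marginal2 \<mu> $ b + v * marginal2 \<nu> $ b"
  by (simp_all add: marginal1_def marginal2_def sum.distrib sum_distrib_left)

section \<open>The variational formula\<close>

context tree_chain begin

text \<open>The homogeneous form y I(x / y) of Cramer's transform. It makes sense at y = 0 too,
  where x = 0 gives the conventional value 0.\<close>

definition cramer_sup :: "real \<Rightarrow> real \<Rightarrow> ereal" where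
  "cramer_sup x y = (SUP l. ereal (x * l - y * ln (gf (exp l))))"

definition pair_entropy :: "real ^ ('a \<times> 'a) \<Rightarrow> real" where
  "pair_entropy \<mu> = (\<Sum>e\<in>UNIV. \<mu> $ e * ln (\<mu> $ e / (Q (fst e) (snd e) * marginal1 \<mu> $ fst e)))"

text \<open>Rearranged: the entropy of \<mu> relative to its first marginal times the normalised
  kernel Q exp(g) / \<open>normal g\<close> is nonnegative.\<close>

lemma gibbs:
  assumes \<mu>: "\<mu> \<in> prob_vectors" and ac: "\<And>a b. Q a b = 0 \<Longrightarrow> \<mu> $ (a, b) = 0"
  shows "(\<Sum>e\<in>UNIV. \<mu> $ e * g e) \<le> pair_entropy \<mu> + (\<Sum>a\<in>UNIV. marginal1 \<mu> $ a * ln (normal g a))"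
proof -
  have pointwise: "\<mu> $ (a, b) * g (a, b) - \<mu> $ (a, b) * ln (normal g a) -
      \<mu> $ (a, b) * ln (\<mu> $ (a, b) / (Q a b * marginal1 \<mu> $ a)) \<le>
      marginal1 \<mu> $ a * (Q a b * exp (g (a, b))) / normal g a - \<mu> $ (a, b)" for a b
  proof (cases "\<mu> $ (a, b) = 0")
    case True
    then show ?thesis using marginal_nonneg[OF \<mu>] Q_nonneg normal_pos[of g a]
      by (simp add: less_imp_le)
  next
    case False
    then have pos: "0 < \<mu> $ (a, b)" using prob_vectors_nonneg[OF \<mu>, of "(a, b)"] by simp
    then have m1: "0 < marginal1 \<mu> $ a" using le_marginal[OF \<mu>, of a b] by linarith
    have q: "0 < Q a b" using ac[of a b] False Q_nonneg[of a b] by (cases "Q a b = 0") auto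
    \<comment> \<open>The mass of that tilted product at (a, b) divided by \<mu>(a, b). Both have
      total mass 1, so the bound \<open>ln y \<le> y - 1\<close> sums to 0.\<close>
    define y where "y = marginal1 \<mu> $ a * (Q a b * exp (g (a, b))) / (normal g a * \<mu> $ (a, b))"
    have "ln y = g (a, b) - ln (normal g a) - ln (\<mu> $ (a, b) / (Q a b * marginal1 \<mu> $ a))"
      using pos m1 q normal_pos[of g a] by (simp add: y_def ln_mult ln_div)
    moreover have "ln y \<le> y - 1"
      using pos m1 q normal_pos[of g a] by (intro ln_le_minus_one) (simp add: y_def)
    ultimately have "\<mu> $ (a, b) * (g (a, b) - ln (normal g a) - ln (\<mu> $ (a, b) / (Q a b * marginal1 \<mu> $ a)))
        \<le> \<mu> $ (a, b) * (y - 1)"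
      using pos by (intro mult_left_mono) auto
    also have "\<dots> = marginal1 \<mu> $ a * (Q a b * exp (g (a, b))) / normal g a - \<mu> $ (a, b)"
      using pos normal_pos[of g a] by (simp add: y_def field_simps)
    finally show ?thesis by (simp add: algebra_simps)
  qed
  have "(\<Sum>a\<in>UNIV. \<Sum>b\<in>UNIV. \<mu> $ (a, b) * g (a, b) - \<mu> $ (a, b) * ln (normal g a) -
      \<mu> $ (a, b) * ln (\<mu> $ (a, b) / (Q a b * marginal1 \<mu> $ a))) \<le>
      (\<Sum>a\<in>UNIV. \<Sum>b\<in>UNIV. marginal1 \<mu> $ a * (Q a b * exp (g (a, b))) / normal g a - \<mu> $ (a, b))"
    by (intro sum_mono pointwise)
  also have "\<dots> = (\<Sum>a\<in>UNIV. marginal1 \<mu> $ a * normal g a / normal g a) - (\<Sum>a\<in>UNIV. \<Sum>b\<in>UNIV. \<mu> $ (a, b))"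
    by (simp add: sum_subtractf normal_def sum_distrib_left sum_divide_distrib)
  also have "\<dots> = 0"
    using \<mu> sum_marginal1[of \<mu>] normal_pos[of g]
    by (simp add: prob_vectors_def sum_UNIV_prod[of "\<lambda>e. \<mu> $ e"] less_imp_neq[symmetric])
  finally have "(\<Sum>a\<in>UNIV. \<Sum>b\<in>UNIV. \<mu> $ (a, b) * g (a, b)) -
      (\<Sum>a\<in>UNIV. \<Sum>b\<in>UNIV. \<mu> $ (a, b) * ln (normal g a)) - pair_entropy \<mu> \<le> 0"
    by (simp add: sum_subtractf pair_entropy_def sum_UNIV_prod)
  moreover have "(\<Sum>a\<in>UNIV. \<Sum>b\<in>UNIV. \<mu> $ (a, b) * ln (normal g a)) =
      (\<Sum>a\<in>UNIV. marginal1 \<mu> $ a * ln (normal g a))"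
    by (simp add: marginal1_def sum_distrib_right)
  ultimately show ?thesis by (simp add: sum_UNIV_prod)
qed

text \<open>The tilt is chosen so that \<open>normal g a = exp (l a)\<close> holds exactly although \<open>\<mu>\<close> may vanish
  where \<open>Q\<close> does not.\<close>

lemma entropy_achieved:
  assumes \<mu>: "\<mu> \<in> prob_vectors" and ac: "\<And>a b. Q a b = 0 \<Longrightarrow> \<mu> $ (a, b) = 0" and \<delta>: "0 < \<delta>"
  shows "\<exists>g. pair_entropy \<mu> + (\<Sum>a\<in>UNIV. marginal1 \<mu> $ a * l a - marginal2 \<mu> $ a * ln (gf (exp (l a)))) - \<delta>
    \<le> lin_rate g \<mu>"
proof -
  \<comment> \<open>Solves \<open>ln (1 - \<epsilon>) = - \<delta>\<close>: replacing a density r by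
    (1 - \<epsilon>) r + \<epsilon> lowers its logarithm by at most \<delta> and makes it
    positive.\<close>
  define \<epsilon> where "\<epsilon> = 1 - exp (- \<delta>)"
  have \<epsilon>: "0 < \<epsilon>" "\<epsilon> < 1" "ln (1 - \<epsilon>) = - \<delta>" using \<delta> by (auto simp: \<epsilon>_def)
  \<comment> \<open>The density, with respect to Q, of the conditional law of b given a under \<mu>.
    The default 1 at letters of zero marginal integrates to 1 as well.\<close>
  define r where "r a b = (if marginal1 \<mu> $ a = 0 then 1 else \<mu> $ (a, b) / (Q a b * marginal1 \<mu> $ a))" for a b
  define g where "g = (\<lambda>(a, b). l a + ln ((1 - \<epsilon>) * r a b + \<epsilon>))"
  have r: "0 \<le> r a b" for a b
    using marginal_nonneg[OF \<mu>] Q_nonneg prob_vectors_nonneg[OF \<mu>] by (simp add: r_def)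
  have pos: "0 < (1 - \<epsilon>) * r a b + \<epsilon>" for a b
    using \<epsilon> r[of a b] by (intro add_nonneg_pos) auto
  have Qr: "(\<Sum>b\<in>UNIV. Q a b * r a b) = 1" for a
  proof (cases "marginal1 \<mu> $ a = 0")
    case True
    then show ?thesis by (simp add: r_def Q_sum)
  next
    case False
    have "Q a b * r a b = \<mu> $ (a, b) / marginal1 \<mu> $ a" for b
      using False ac[of a b] by (cases "Q a b = 0") (simp_all add: r_def)
    then have "(\<Sum>b\<in>UNIV. Q a b * r a b) = marginal1 \<mu> $ a / marginal1 \<mu> $ a"
      by (simp add: marginal1_def flip: sum_divide_distrib)
    then show ?thesis using False by simp
  qed
  have expg: "exp (g (a, b)) = exp (l a) * ((1 - \<epsilon>) * r a b + \<epsilon>)" for a b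
    using pos[of a b] by (simp add: g_def exp_add)
  have normal: "normal g a = exp (l a)" for a
  proof -
    have "normal g a = exp (l a) * ((1 - \<epsilon>) * (\<Sum>b\<in>UNIV. Q a b * r a b) + \<epsilon> * (\<Sum>b\<in>UNIV. Q a b))"
      by (simp add: normal_def expg sum_distrib_left sum.distrib[symmetric] algebra_simps)
    then show ?thesis by (simp add: Qr Q_sum)
  qed
  have pointwise: "\<mu> $ (a, b) * l a + \<mu> $ (a, b) * ln (\<mu> $ (a, b) / (Q a b * marginal1 \<mu> $ a)) - \<mu> $ (a, b) * \<delta>
      \<le> \<mu> $ (a, b) * g (a, b)" for a b
  proof (cases "\<mu> $ (a, b) = 0")
    case False
    then have \<mu>pos: "0 < \<mu> $ (a, b)" using prob_vectors_nonneg[OF \<mu>, of "(a, b)"] by simp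
    then have m1: "0 < marginal1 \<mu> $ a" using le_marginal[OF \<mu>, of a b] by linarith
    have q: "0 < Q a b" using ac[of a b] False Q_nonneg[of a b] by (cases "Q a b = 0") auto
    have rpos: "0 < r a b" "r a b = \<mu> $ (a, b) / (Q a b * marginal1 \<mu> $ a)"
      using \<mu>pos m1 q by (simp_all add: r_def)
    have "ln (r a b) - \<delta> = ln ((1 - \<epsilon>) * r a b)" using rpos(1) \<epsilon> by (simp add: ln_mult)
    also have "\<dots> \<le> ln ((1 - \<epsilon>) * r a b + \<epsilon>)" using rpos(1) \<epsilon> pos by (subst ln_le_cancel_iff) auto
    finally have "\<mu> $ (a, b) * (l a + (ln (r a b) - \<delta>)) \<le> \<mu> $ (a, b) * g (a, b)"
      using \<mu>pos by (intro mult_left_mono) (auto simp: g_def)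
    then show ?thesis by (simp add: rpos(2) algebra_simps)
  qed simp
  have "(\<Sum>a\<in>UNIV. \<Sum>b\<in>UNIV. \<mu> $ (a, b) * l a + \<mu> $ (a, b) * ln (\<mu> $ (a, b) / (Q a b * marginal1 \<mu> $ a)) -
      \<mu> $ (a, b) * \<delta>) \<le> (\<Sum>a\<in>UNIV. \<Sum>b\<in>UNIV. \<mu> $ (a, b) * g (a, b))"
    by (intro sum_mono pointwise)
  moreover have "(\<Sum>a\<in>UNIV. \<Sum>b\<in>UNIV. \<mu> $ (a, b) * l a) = (\<Sum>a\<in>UNIV. marginal1 \<mu> $ a * l a)"
    by (simp add: marginal1_def sum_distrib_right)
  moreover have "(\<Sum>a\<in>UNIV. \<Sum>b\<in>UNIV. \<mu> $ (a, b) * \<delta>) = \<delta>"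
    using \<mu> by (simp add: prob_vectors_def sum_UNIV_prod flip: sum_distrib_right)
  ultimately have "(\<Sum>a\<in>UNIV. marginal1 \<mu> $ a * l a) + pair_entropy \<mu> - \<delta> \<le> (\<Sum>e\<in>UNIV. \<mu> $ e * g e)"
    by (simp add: sum_subtractf sum.distrib pair_entropy_def sum_UNIV_prod)
  then have "pair_entropy \<mu> + (\<Sum>a\<in>UNIV. marginal1 \<mu> $ a * l a - marginal2 \<mu> $ a * ln (gf (exp (l a)))) - \<delta>
    \<le> lin_rate g \<mu>"
    by (simp add: lin_rate_alt normal sum_subtractf)
  then show ?thesis by (rule exI[of _ g])
qed

lemma SUP_lin_rate_nonneg: "0 \<le> (SUP g. ereal (lin_rate g \<mu>))"
  using SUP_upper[of "\<lambda>_. 0" UNIV "\<lambda>g. ereal (lin_rate g \<mu>)"] by (simp add: zero_ereal_def)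

text \<open>A tilt g amounts to a kernel proportional to Q exp(g) and its normalisations
  \<open>normal g a\<close>, and these can be optimised separately: the kernel yields the entropy,
  l(a) = ln (\<open>normal g a\<close>) the Cramer terms. \<open>gibbs\<close> and
  \<open>entropy_achieved\<close> are the two inequalities.\<close>

lemma entropy_eq_SUP_lin_rate:
  assumes \<mu>: "\<mu> \<in> prob_vectors" and ac: "\<And>a b. Q a b = 0 \<Longrightarrow> \<mu> $ (a, b) = 0"
  shows "ereal (pair_entropy \<mu>) + (\<Sum>a\<in>UNIV. cramer_sup (marginal1 \<mu> $ a) (marginal2 \<mu> $ a)) =
    (SUP g. ereal (lin_rate g \<mu>))" (is "?I = ?S")
proof (rule antisym)
  show "?S \<le> ?I"
  proof (rule SUP_least)
    fix g
    have "lin_rate g \<mu> \<le> pair_entropy \<mu> +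
        (\<Sum>a\<in>UNIV. marginal1 \<mu> $ a * ln (normal g a) - marginal2 \<mu> $ a * ln (gf (exp (ln (normal g a)))))"
      using gibbs[OF \<mu> ac, of g] normal_pos by (simp add: lin_rate_alt sum_subtractf)
    then have "ereal (lin_rate g \<mu>) \<le> ereal (pair_entropy \<mu>) +
        (\<Sum>a\<in>UNIV. ereal (marginal1 \<mu> $ a * ln (normal g a) - marginal2 \<mu> $ a * ln (gf (exp (ln (normal g a))))))"
      by simp
    also have "\<dots> \<le> ?I"
      unfolding cramer_sup_def by (intro add_left_mono sum_mono SUP_upper) auto
    finally show "ereal (lin_rate g \<mu>) \<le> ?I" .
  qed
  show "?I \<le> ?S"
  proof (cases ?S)
    case (real s)
    have "pair_entropy \<mu> + (\<Sum>a\<in>UNIV. marginal1 \<mu> $ a * l a - marginal2 \<mu> $ a * ln (gf (exp (l a)))) \<le> s" for l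
    proof (rule field_le_epsilon)
      fix \<delta> :: real assume "0 < \<delta>"
      then obtain g where g: "pair_entropy \<mu> +
          (\<Sum>a\<in>UNIV. marginal1 \<mu> $ a * l a - marginal2 \<mu> $ a * ln (gf (exp (l a)))) - \<delta> \<le> lin_rate g \<mu>"
        using entropy_achieved[OF \<mu> ac] by blast
      have "ereal (lin_rate g \<mu>) \<le> ereal s" unfolding real[symmetric] by (rule SUP_upper) simp
      then show "pair_entropy \<mu> +
          (\<Sum>a\<in>UNIV. marginal1 \<mu> $ a * l a - marginal2 \<mu> $ a * ln (gf (exp (l a)))) \<le> s + \<delta>"
        using g by simp
    qed
    then have "(\<Sum>a\<in>UNIV. marginal1 \<mu> $ a * l a - marginal2 \<mu> $ a * ln (gf (exp (l a)))) \<le> s - pair_entropy \<mu>" for l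
      by (simp add: algebra_simps)
    then have "(\<Sum>a\<in>UNIV. cramer_sup (marginal1 \<mu> $ a) (marginal2 \<mu> $ a)) \<le> ereal (s - pair_entropy \<mu>)"
      unfolding cramer_sup_def
      by (intro sum_SUP_ereal_le[of UNIV "\<lambda>a l. marginal1 \<mu> $ a * l - marginal2 \<mu> $ a * ln (gf (exp l))"]) simp_all
    then have "?I \<le> ereal (pair_entropy \<mu>) + ereal (s - pair_entropy \<mu>)"
      by (rule add_left_mono)
    then show ?thesis by (simp add: real)
  next
    case MInf
    then show ?thesis using SUP_lin_rate_nonneg[of \<mu>] by simp
  qed simp
qed

text \<open>Raising g on all edges leaving a gains in proportion to
  \<open>marginal1 \<mu> $ a\<close>, while the cost at vertices labelled a has weight
  \<open>marginal2 \<mu> $ a\<close>, which is 0.\<close>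

lemma SUP_lin_rate_infinite1:
  assumes "\<mu> \<in> prob_vectors" "marginal2 \<mu> $ a = 0" "marginal1 \<mu> $ a \<noteq> 0"
  shows "(SUP g. ereal (lin_rate g \<mu>)) = \<infinity>"
proof (rule ereal_top)
  fix B
  have pos: "0 < marginal1 \<mu> $ a" using assms marginal_nonneg(1)[of \<mu> a] by simp
  define t where "t = B / marginal1 \<mu> $ a"
  define g :: "'a \<times> 'a \<Rightarrow> real" where "g = (\<lambda>e. if fst e = a then t else 0)"
  have "normal g b = (if b = a then exp t else 1)" for b
    by (simp add: normal_def g_def Q_sum flip: sum_distrib_right)
  then have "(\<Sum>b\<in>UNIV. marginal2 \<mu> $ b * ln (gf (normal g b))) = 0"
    using assms(2) by (intro sum.neutral) (simp add: gf_1)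
  moreover have "(\<Sum>e\<in>UNIV. \<mu> $ e * g e) = (\<Sum>c\<in>UNIV. if c = a then marginal1 \<mu> $ a * t else 0)"
    unfolding sum_UNIV_prod by (intro sum.cong) (simp_all add: g_def marginal1_def sum_distrib_right)
  ultimately have "lin_rate g \<mu> = B"
    using pos by (simp add: lin_rate_alt t_def)
  then show "ereal B \<le> (SUP g. ereal (lin_rate g \<mu>))"
    using SUP_upper[of g UNIV "\<lambda>g. ereal (lin_rate g \<mu>)"] by simp
qed

text \<open>Raising g on an edge that Q forbids changes no \<open>normal g c\<close> and so costs
  nothing.\<close>

lemma SUP_lin_rate_infinite2:
  assumes "\<mu> \<in> prob_vectors" "Q a b = 0" "\<mu> $ (a, b) \<noteq> 0"
  shows "(SUP g. ereal (lin_rate g \<mu>)) = \<infinity>"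
proof (rule ereal_top)
  fix B
  define t where "t = B / \<mu> $ (a, b)"
  define g :: "'a \<times> 'a \<Rightarrow> real" where "g = (\<lambda>e. if e = (a, b) then t else 0)"
  have "normal g c = (\<Sum>d\<in>UNIV. Q c d)" for c
    unfolding normal_def using assms by (intro sum.cong) (auto simp: g_def)
  then have "normal g c = 1" for c by (simp add: Q_sum)
  moreover have "(\<Sum>e\<in>UNIV. \<mu> $ e * g e) = \<mu> $ (a, b) * t"
    by (simp add: g_def if_distrib[of "\<lambda>x. _ * x"] cong: if_cong)
  ultimately have "lin_rate g \<mu> = B"
    using assms by (simp add: lin_rate_alt t_def gf_1)
  then show "ereal B \<le> (SUP g. ereal (lin_rate g \<mu>))"
    using SUP_upper[of g UNIV "\<lambda>g. ereal (lin_rate g \<mu>)"] by simp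
qed

section \<open>From finite rate to critical tilts\<close>

lemma cramer_sup_finite:
  assumes fin: "cramer_sup x y \<noteq> \<infinity>" and y: "0 \<le> y"
  shows "\<exists>K\<ge>2. 0 < p K \<and> x \<le> real K * y"
proof (rule ccontr)
  assume "\<not> ?thesis"
  then have small: "real K * y < x" if "2 \<le> K" "0 < p K" for K using that by auto
  obtain K where K: "2 \<le> K" "0 < p K" using branching by auto
  have x: "0 < x" using small[OF K] y by (simp add: order_le_less_trans[of 0 "real K * y" x])
  have small': "real k * y < x" if "0 < p k" for k
  proof (cases "2 \<le> k")
    case False
    then have "real k * y \<le> real K * y" using K y by (intro mult_right_mono) auto
    then show ?thesis using small[OF K] by simp
  qed (use small that in auto)
  \<comment> \<open>If k y < x throughout the support and y > 0, the support is bounded by some m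
    with m y < x. Then \<open>ln (gf (exp l))\<close> \<le> m l for l \<ge> 0, and the exponent
    grows linearly in l.\<close>
  have "\<exists>d>0. \<forall>l\<ge>0. d * l \<le> x * l - y * ln (gf (exp l))"
  proof (cases "y = 0")
    case True
    then show ?thesis using x by (intro exI[of _ x]) auto
  next
    case False
    then have y: "0 < y" using y by simp
    \<comment> \<open>The largest integer strictly below x / y.\<close>
    define m where "m = nat (\<lceil>x / y\<rceil> - 1)"
    have ceil: "1 \<le> \<lceil>x / y\<rceil>" using x y by simp
    have m: "real m * y < x"
    proof -
      have "real m = of_int \<lceil>x / y\<rceil> - 1" using ceil by (simp add: m_def)
      then have "real m < x / y" by linarith
      then show ?thesis using y by (simp add: pos_less_divide_eq)
    qed
    have supp: "k \<le> m" if "0 < p k" for k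
    proof -
      have "real k < x / y" using small'[OF that] y by (simp add: pos_less_divide_eq)
      then have "int k < \<lceil>x / y\<rceil>" by (simp add: less_ceiling_iff)
      then show ?thesis by (simp add: m_def)
    qed
    have "gf (exp l) \<le> exp l ^ m" if l: "0 \<le> l" for l
    proof (rule sums_le[OF _ gf_sums])
      show "(\<lambda>k. p k * exp l ^ m) sums (exp l ^ m)"
        using sums_mult2[OF p_sums, of "exp l ^ m"] by simp
      show "p k * exp l ^ k \<le> p k * exp l ^ m" for k
        using supp[of k] l p_nonneg[of k] by (cases "p k = 0") (auto intro!: mult_left_mono power_increasing)
    qed
    then have "ln (gf (exp l)) \<le> real m * l" if l: "0 \<le> l" for l
      using ln_mono[of "gf (exp l)" "exp l ^ m"] l gf_pos[of "exp l"] by (simp flip: exp_of_nat_mult)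
    then have "y * ln (gf (exp l)) \<le> y * (real m * l)" if "0 \<le> l" for l
      using y that by (intro mult_left_mono) auto
    then show ?thesis using m by (intro exI[of _ "x - real m * y"]) (auto simp: algebra_simps)
  qed
  then obtain d where d: "0 < d" "\<And>l. 0 \<le> l \<Longrightarrow> d * l \<le> x * l - y * ln (gf (exp l))" by auto
  have "cramer_sup x y = \<infinity>"
  proof (rule ereal_top)
    fix B
    define l where "l = \<bar>B\<bar> / d"
    have "0 \<le> l" using d(1) by (simp add: l_def)
    have "B \<le> d * l" using d(1) by (simp add: l_def)
    also have "\<dots> \<le> x * l - y * ln (gf (exp l))" by (rule d(2)) fact
    finally show "ereal B \<le> cramer_sup x y"
      unfolding cramer_sup_def by (intro SUP_upper2[of l]) auto
  qed
  then show False using fin by simp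
qed

text \<open>The mean of the offspring law tilted by z takes every value strictly between 0 and K:
  the function f below is 0 at 0 and negative at two points around it, so it has an interior
  maximum, where its derivative vanishes.\<close>

lemma mean_attained:
  assumes x: "0 < x" "x < real K" and K: "0 < p K"
  shows "\<exists>z>0. z * gf' z / gf z = x"
proof -
  define f where "f l = x * l - ln (gf (exp l))" for l
  have deriv: "(f has_field_derivative x - gf' (exp l) * exp l / gf (exp l)) (at l)" for l
  proof -
    have "((\<lambda>l. gf (exp l)) has_field_derivative gf' (exp l) * exp l) (at l)"
      by (rule DERIV_chain2[where f=gf, OF gf_has_derivative]) (rule DERIV_exp)
    then show ?thesis
      unfolding f_def[abs_def] using gf_pos[of "exp l"]
      by (auto intro!: derivative_eq_intros)
  qed
  \<comment> \<open>On the left the bound \<open>gf\<close> \<ge> p(0), on the right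
    \<open>gf (exp l)\<close> \<ge> p(K) exp (K l), make f at most -x and -(K - x),
    respectively.\<close>
  define A where "A = min (-1) (ln (p 0) / x - 1)"
  define B where "B = max 1 (- ln (p K) / (real K - x) + 1)"
  have fA: "f A < 0"
  proof -
    have "ln (p 0) \<le> ln (gf (exp A))" using gf_ge_term[of "exp A" 0] p_0 by (intro ln_mono) auto
    moreover have "x * A \<le> x * (ln (p 0) / x - 1)" using x by (intro mult_left_mono) (auto simp: A_def)
    moreover have "x * (ln (p 0) / x - 1) = ln (p 0) - x" using x by (simp add: right_diff_distrib)
    ultimately show ?thesis using x unfolding f_def by linarith
  qed
  have fB: "f B < 0"
  proof -
    have "ln (p K) + real K * B = ln (p K * exp B ^ K)" using K by (simp add: ln_mult flip: exp_of_nat_mult)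
    also have "\<dots> \<le> ln (gf (exp B))" using gf_ge_term[of "exp B" K] K gf_pos[of "exp B"] by (intro ln_mono) auto
    finally have 1: "ln (p K) + real K * B \<le> ln (gf (exp B))" .
    have "(real K - x) * (- ln (p K) / (real K - x) + 1) \<le> (real K - x) * B"
      using x by (intro mult_left_mono) (auto simp: B_def)
    moreover have "(real K - x) * (- ln (p K) / (real K - x) + 1) = - ln (p K) + (real K - x)"
      using x by (simp add: right_diff_distrib)
    ultimately have "- ln (p K) + (real K - x) \<le> (real K - x) * B" by simp
    then show ?thesis using 1 x by (simp add: f_def algebra_simps)
  qed
  have f0: "f 0 = 0" by (simp add: f_def gf_1)
  have AB: "A < 0" "0 < B" by (auto simp: A_def B_def)
  have "continuous_on {A..B} f"
    using deriv by (intro DERIV_continuous_on) (auto intro: has_field_derivative_at_within)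
  then obtain l where l: "l \<in> {A..B}" "\<And>l'. l' \<in> {A..B} \<Longrightarrow> f l' \<le> f l"
    using continuous_attains_sup[of "{A..B}" f] AB by auto
  have "0 \<le> f l" using l(2)[of 0] AB f0 by simp
  then have "l \<noteq> A" "l \<noteq> B" using fA fB by auto
  then have l': "A < l" "l < B" using l(1) by auto
  have "x - gf' (exp l) * exp l / gf (exp l) = 0"
  proof (rule DERIV_local_max[OF deriv])
    show "0 < min (l - A) (B - l)" using l' by simp
    show "\<forall>y. \<bar>l - y\<bar> < min (l - A) (B - l) \<longrightarrow> f y \<le> f l"
    proof (intro allI impI l(2))
      fix y assume "\<bar>l - y\<bar> < min (l - A) (B - l)"
      then have "l - y < l - A" "y - l < B - l" by linarith+
      then show "y \<in> {A..B}" by simp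
    qed
  qed
  then show ?thesis by (intro exI[of _ "exp l"]) (auto simp: mult.commute)
qed

lemma critical_tilt_exists:
  assumes \<mu>: "\<mu> \<in> prob_vectors"
    and supp: "\<And>a b. 0 < Q a b \<Longrightarrow> 0 < \<mu> $ (a, b)" and ac: "\<And>a b. Q a b = 0 \<Longrightarrow> \<mu> $ (a, b) = 0"
    and pos: "\<And>a. 0 < marginal2 \<mu> $ a"
    and K: "\<And>a. \<exists>K. 0 < p K \<and> marginal1 \<mu> $ a < real K * marginal2 \<mu> $ a"
  shows "\<exists>g. critical_tilt g \<mu>"
proof -
  have m1: "0 < marginal1 \<mu> $ a" for a
  proof -
    obtain b where "0 < Q a b" using Q_row by auto
    then show ?thesis using supp[of a b] le_marginal(1)[OF \<mu>, of a b] by linarith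
  qed
  have "\<exists>z>0. z * gf' z / gf z = marginal1 \<mu> $ a / marginal2 \<mu> $ a" for a
  proof -
    obtain K where "0 < p K" "marginal1 \<mu> $ a < real K * marginal2 \<mu> $ a" using K by auto
    then show ?thesis using m1[of a] pos[of a] by (intro mean_attained[of _ K]) (auto simp: pos_divide_less_eq)
  qed
  then obtain z where z: "\<And>a. 0 < z a" "\<And>a. z a * gf' (z a) / gf (z a) = marginal1 \<mu> $ a / marginal2 \<mu> $ a"
    by metis
  \<comment> \<open>Makes Q exp(g) equal to z(a) times the conditional law of b given a under \<mu>,
    so that \<open>normal g a = z a\<close>. Where Q vanishes, g has a default value that the factor
    Q erases.\<close>
  define g where "g = (\<lambda>(a, b). ln (z a * \<mu> $ (a, b) / (marginal1 \<mu> $ a * Q a b)))"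
  have Qg: "Q a b * exp (g (a, b)) = z a * \<mu> $ (a, b) / marginal1 \<mu> $ a" for a b
  proof (cases "Q a b = 0")
    case False
    then have "0 < Q a b" using Q_nonneg[of a b] by simp
    then show ?thesis using supp[of a b] m1[of a] z(1)[of a] by (simp add: g_def)
  qed (simp add: ac)
  have normal: "normal g a = z a" for a
  proof -
    have "normal g a = z a * (\<Sum>b\<in>UNIV. \<mu> $ (a, b)) / marginal1 \<mu> $ a"
      by (simp add: normal_def Qg sum_distrib_left sum_divide_distrib)
    also have "(\<Sum>b\<in>UNIV. \<mu> $ (a, b)) = marginal1 \<mu> $ a" by (simp add: marginal1_def)
    finally show ?thesis using m1[of a] by simp
  qed
  have "\<mu> $ (a, b) = marginal2 \<mu> $ a * (gf' (normal g a) / gf (normal g a) * Q a b * exp (g (a, b)))" for a b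
  proof -
    have "marginal2 \<mu> $ a * (gf' (z a) / gf (z a) * (Q a b * exp (g (a, b)))) =
        marginal2 \<mu> $ a * (z a * gf' (z a) / gf (z a)) * \<mu> $ (a, b) / marginal1 \<mu> $ a"
      unfolding Qg by simp
    also have "\<dots> = \<mu> $ (a, b)"
      unfolding z(2) using pos[of a] m1[of a] by simp
    finally show ?thesis by (simp add: normal mult.assoc)
  qed
  then show ?thesis unfolding critical_tilt_def using \<mu> pos by blast
qed

section \<open>The stationary pair measure and approximation by critical tilts\<close>

lemma stationary_exists:
  "\<exists>\<pi>. (\<forall>a. 0 < \<pi> a) \<and> (\<Sum>a\<in>UNIV. \<pi> a) = 1 \<and> (\<forall>b. (\<Sum>a\<in>UNIV. \<pi> a * Q a b) = \<pi> b)"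
proof -
  define F :: "real ^ 'a \<Rightarrow> real ^ 'a" where "F x = (\<chi> b. \<Sum>a\<in>UNIV. x $ a * Q a b)" for x
  have "F x \<in> prob_vectors" if x: "x \<in> prob_vectors" for x
  proof -
    have "(\<Sum>b\<in>UNIV. \<Sum>a\<in>UNIV. x $ a * Q a b) = (\<Sum>a\<in>UNIV. x $ a * (\<Sum>b\<in>UNIV. Q a b))"
      by (subst sum.swap) (simp add: sum_distrib_left)
    then show ?thesis
      using x Q_nonneg by (auto simp: prob_vectors_def F_def Q_sum intro!: sum_nonneg)
  qed
  moreover have "continuous_on prob_vectors F"
    unfolding F_def by (intro continuous_intros)
  moreover have "(prob_vectors :: (real ^ 'a) set) \<noteq> {}"
  proof -
    have "axis undefined 1 \<in> (prob_vectors :: (real ^ 'a) set)"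
      by (auto simp: prob_vectors_def axis_def)
    then show ?thesis by blast
  qed
  \<comment> \<open>Brouwer's theorem on the simplex gives an invariant vector; irreducibility then
    spreads positivity from one letter to all.\<close>
  ultimately obtain x where x: "x \<in> prob_vectors" "F x = x"
    using brouwer[of prob_vectors F] prob_vectors_compact convex_prob_vectors by blast
  have eq: "(\<Sum>a\<in>UNIV. x $ a * Q a b) = x $ b" for b
    using x(2) by (simp add: F_def vec_eq_iff)
  have nonneg: "0 \<le> x $ a" for a using x(1) by (rule prob_vectors_nonneg)
  have "\<exists>a. 0 < x $ a"
  proof (rule ccontr)
    assume "\<not> ?thesis"
    then have "x $ a = 0" for a using nonneg[of a] by (metis order_le_less)
    then show False using x(1) by (simp add: prob_vectors_def)
  qed
  then obtain a0 where a0: "0 < x $ a0" by auto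
  have "0 < x $ b" for b
    using Q_irreducible[of a0 b]
  proof (induction rule: rtrancl_induct)
    case (step b c)
    then have "0 < x $ b * Q b c" by simp
    also have "\<dots> \<le> (\<Sum>a\<in>UNIV. x $ a * Q a c)"
      by (intro member_le_sum[of b UNIV "\<lambda>a. x $ a * Q a c"]) (auto simp: nonneg Q_nonneg)
    finally show ?case by (simp add: eq)
  qed (rule a0)
  then show ?thesis using x(1) eq by (intro exI[of _ "\<lambda>a. x $ a"]) (auto simp: prob_vectors_def)
qed

definition stationary_pairs :: "real ^ ('a \<times> 'a)" where
  "stationary_pairs = (let \<pi> = SOME \<pi>. (\<forall>a. 0 < \<pi> a) \<and> (\<Sum>a\<in>UNIV. \<pi> a) = 1 \<and>
     (\<forall>b. (\<Sum>a\<in>UNIV. \<pi> a * Q a b) = \<pi> b) in \<chi> e. \<pi> (fst e) * Q (fst e) (snd e))"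

lemma stationary_pairs:
  "stationary_pairs \<in> prob_vectors"
  "marginal1 stationary_pairs = marginal2 stationary_pairs"
  "0 < marginal2 stationary_pairs $ a"
  "stationary_pairs $ (a, b) = marginal2 stationary_pairs $ a * Q a b"
proof -
  define \<pi> where "\<pi> = (SOME \<pi>. (\<forall>a. 0 < \<pi> a) \<and> (\<Sum>a\<in>UNIV. \<pi> a) = 1 \<and>
     (\<forall>b. (\<Sum>a\<in>UNIV. \<pi> a * Q a b) = \<pi> b))"
  have \<pi>: "\<And>a. 0 < \<pi> a" "(\<Sum>a\<in>UNIV. \<pi> a) = 1" "\<And>b. (\<Sum>a\<in>UNIV. \<pi> a * Q a b) = \<pi> b"
    using someI_ex[OF stationary_exists] unfolding \<pi>_def[symmetric] by auto
  have sp: "stationary_pairs $ (a, b) = \<pi> a * Q a b" for a b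
    by (simp add: stationary_pairs_def \<pi>_def Let_def)
  have m1: "marginal1 stationary_pairs $ a = \<pi> a" for a
    by (simp add: marginal1_def sp Q_sum flip: sum_distrib_left)
  have m2: "marginal2 stationary_pairs $ b = \<pi> b" for b
    by (simp add: marginal2_def sp \<pi>)
  show "stationary_pairs \<in> prob_vectors"
    using sum_marginal1[of stationary_pairs] \<pi> Q_nonneg
    by (auto simp: prob_vectors_def m1 sp less_imp_le)
  show "marginal1 stationary_pairs = marginal2 stationary_pairs"
    by (simp add: vec_eq_iff m1 m2)
  show "0 < marginal2 stationary_pairs $ a" "stationary_pairs $ (a, b) = marginal2 stationary_pairs $ a * Q a b"
    by (simp_all add: m2 \<pi> sp)
qed

text \<open>Criticality of the given offspring law. It makes the probability of size n decay
  subexponentially, so conditioning does not affect rates.\<close>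

lemma critical_tilt_stationary_pairs: "critical_tilt (\<lambda>_. 0) stationary_pairs"
  using stationary_pairs by (simp add: critical_tilt_def gf_1 gf'_1)

lemma ln_normal_ge: "(\<Sum>b\<in>UNIV. Q a b * g (a, b)) \<le> ln (normal g a)"
proof -
  have "(\<Sum>b\<in>UNIV. Q a b * (1 + (g (a, b) - ln (normal g a)))) \<le>
      (\<Sum>b\<in>UNIV. Q a b * exp (g (a, b) - ln (normal g a)))"
    by (intro sum_mono mult_left_mono Q_nonneg exp_ge_add_one_self)
  also have "\<dots> = (\<Sum>b\<in>UNIV. Q a b * exp (g (a, b))) / normal g a"
    using normal_pos[of g a] by (simp add: exp_diff sum_divide_distrib)
  also have "\<dots> = normal g a / normal g a"
    by (simp only: normal_def)
  also have "\<dots> = 1" using normal_pos[of g a] by simp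
  also have "(\<Sum>b\<in>UNIV. Q a b * (1 + (g (a, b) - ln (normal g a)))) =
      1 + ((\<Sum>b\<in>UNIV. Q a b * g (a, b)) - ln (normal g a))"
    by (simp add: distrib_left right_diff_distrib sum.distrib sum_subtractf Q_sum flip: sum_distrib_right)
  finally show ?thesis by simp
qed

text \<open>Jensen's inequality for each row of Q, combined with z \<le> \<open>gf z\<close>. Thus
  the rate vanishes at the stationary pair measure.\<close>

lemma lin_rate_stationary_le: "lin_rate g stationary_pairs \<le> 0"
proof -
  let ?m = "\<lambda>a. marginal2 stationary_pairs $ a"
  have "(\<Sum>e\<in>UNIV. stationary_pairs $ e * g e) = (\<Sum>a\<in>UNIV. ?m a * (\<Sum>b\<in>UNIV. Q a b * g (a, b)))"
    by (simp add: sum_UNIV_prod stationary_pairs(4) sum_distrib_left mult.assoc)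
  also have "\<dots> \<le> (\<Sum>a\<in>UNIV. ?m a * ln (gf (normal g a)))"
  proof (intro sum_mono mult_left_mono)
    fix a
    have "normal g a \<le> gf (normal g a)"
      using gf_tangent[of "normal g a" 1] normal_pos[of g a] by (simp add: gf_1 gf'_1)
    then have "ln (normal g a) \<le> ln (gf (normal g a))" using normal_pos[of g a] by (intro ln_mono)
    then show "(\<Sum>b\<in>UNIV. Q a b * g (a, b)) \<le> ln (gf (normal g a))" using ln_normal_ge[of a g] by linarith
    show "0 \<le> ?m a" using stationary_pairs(3)[of a] by simp
  qed
  finally show ?thesis by (simp add: lin_rate_alt)
qed

lemma lin_rate_convex:
  "lin_rate g (u *\<^sub>R \<mu> + v *\<^sub>R \<nu>) = u * lin_rate g \<mu> + v * lin_rate g \<nu>"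
  by (simp add: lin_rate_def sum.distrib sum_distrib_left algebra_simps)

lemma SUP_lin_rate_finite:
  assumes \<mu>: "\<mu> \<in> prob_vectors" and fin: "(SUP g. ereal (lin_rate g \<mu>)) \<noteq> \<infinity>"
  shows "Q a b = 0 \<Longrightarrow> \<mu> $ (a, b) = 0"
    and "\<exists>K\<ge>2. 0 < p K \<and> marginal1 \<mu> $ a \<le> real K * marginal2 \<mu> $ a"
proof -
  show ac: "\<mu> $ (a, b) = 0" if "Q a b = 0" for a b
    using SUP_lin_rate_infinite2[OF \<mu> that] fin by auto
  have "(\<Sum>a\<in>UNIV. cramer_sup (marginal1 \<mu> $ a) (marginal2 \<mu> $ a)) \<noteq> \<infinity>"
    using entropy_eq_SUP_lin_rate[OF \<mu> ac] fin by auto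
  then have "cramer_sup (marginal1 \<mu> $ a) (marginal2 \<mu> $ a) \<noteq> \<infinity>"
    by (auto simp: sum_Pinfty)
  then show "\<exists>K\<ge>2. 0 < p K \<and> marginal1 \<mu> $ a \<le> real K * marginal2 \<mu> $ a"
    using marginal_nonneg(2)[OF \<mu>] by (rule cramer_sup_finite)
qed

text \<open>The mixture charges every edge allowed by Q. Its ratios of marginals are strictly below
  the offspring numbers K found for \<mu>, since K \<ge> 2 and the stationary marginals agree. By
  linearity its rate at the critical tilt is at most (1 - \<epsilon>) s.\<close>

lemma critical_tilt_approx:
  assumes \<mu>: "\<mu> \<in> prob_vectors" and fin: "(SUP g. ereal (lin_rate g \<mu>)) = ereal s"
    and \<epsilon>: "0 < \<epsilon>" "\<epsilon> < 1"
  shows "\<exists>g. critical_tilt g ((1 - \<epsilon>) *\<^sub>R \<mu> + \<epsilon> *\<^sub>R stationary_pairs) \<and>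
    lin_rate g ((1 - \<epsilon>) *\<^sub>R \<mu> + \<epsilon> *\<^sub>R stationary_pairs) \<le> s"
proof -
  let ?\<nu> = "(1 - \<epsilon>) *\<^sub>R \<mu> + \<epsilon> *\<^sub>R stationary_pairs"
  note sp = stationary_pairs
  have fin': "(SUP g. ereal (lin_rate g \<mu>)) \<noteq> \<infinity>" using fin by simp
  have "\<exists>g. critical_tilt g ?\<nu>"
  proof (rule critical_tilt_exists)
    show "?\<nu> \<in> prob_vectors"
      using convexD[OF convex_prob_vectors \<mu> sp(1), of "1 - \<epsilon>" \<epsilon>] \<epsilon> by simp
    show "0 < ?\<nu> $ (a, b)" if "0 < Q a b" for a b
      using that \<epsilon> sp(3)[of a] prob_vectors_nonneg[OF \<mu>, of "(a, b)"]
      by (simp add: sp(4) add_nonneg_pos)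
    show "?\<nu> $ (a, b) = 0" if "Q a b = 0" for a b
      using SUP_lin_rate_finite(1)[OF \<mu> fin' that] that by (simp add: sp(4))
    show "0 < marginal2 ?\<nu> $ a" for a
      using \<epsilon> sp(3)[of a] marginal_nonneg[OF \<mu>, of a] by (simp add: marginal_convex add_nonneg_pos)
    show "\<exists>K. 0 < p K \<and> marginal1 ?\<nu> $ a < real K * marginal2 ?\<nu> $ a" for a
    proof -
      obtain K where K: "2 \<le> K" "0 < p K" "marginal1 \<mu> $ a \<le> real K * marginal2 \<mu> $ a"
        using SUP_lin_rate_finite(2)[OF \<mu> fin'] by blast
      have "(1 - \<epsilon>) * marginal1 \<mu> $ a \<le> (1 - \<epsilon>) * (real K * marginal2 \<mu> $ a)"
        using K \<epsilon> by (intro mult_left_mono) auto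
      moreover have "\<epsilon> * marginal1 stationary_pairs $ a < \<epsilon> * (real K * marginal2 stationary_pairs $ a)"
        using K \<epsilon> sp(3)[of a] by (simp add: sp(2))
      moreover have "(1 - \<epsilon>) * (real K * marginal2 \<mu> $ a) + \<epsilon> * (real K * marginal2 stationary_pairs $ a) =
          real K * marginal2 ?\<nu> $ a"
        unfolding marginal_convex by (simp add: algebra_simps)
      ultimately have "marginal1 ?\<nu> $ a < real K * marginal2 ?\<nu> $ a"
        unfolding marginal_convex(1) by linarith
      then show ?thesis using K(2) by blast
    qed
  qed
  then obtain g where g: "critical_tilt g ?\<nu>" by auto
  have "ereal (lin_rate g \<mu>) \<le> ereal s" unfolding fin[symmetric] by (rule SUP_upper) simp
  moreover have "0 \<le> ereal s" unfolding fin[symmetric] by (rule SUP_lin_rate_nonneg)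
  ultimately have "(1 - \<epsilon>) * lin_rate g \<mu> \<le> (1 - \<epsilon>) * s" "0 \<le> s"
    using \<epsilon> by (auto intro: mult_left_mono)
  moreover have "\<epsilon> * lin_rate g stationary_pairs \<le> 0"
    using lin_rate_stationary_le[of g] \<epsilon> by (simp add: mult_le_0_iff)
  moreover have "(1 - \<epsilon>) * s \<le> s" using \<open>0 \<le> s\<close> \<epsilon> by (simp add: mult_left_le_one_le)
  ultimately have "lin_rate g ?\<nu> \<le> s" unfolding lin_rate_convex by linarith
  then show ?thesis using g by blast
qed

end

section \<open>The large deviation principle\<close>

lemma ext_ln_div_le:
  assumes "0 < n" "x \<le> exp (r * real n)"
  shows "ext_ln (ennreal x) / ereal (real n) \<le> ereal r"
proof (cases "0 < x")
  case True
  then have "ln x \<le> r * real n"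
    using ln_mono[of x "exp (r * real n)"] assms by simp
  then show ?thesis
    using assms True by (simp add: ext_ln_def ennreal_eq_0_iff pos_divide_le_eq)
next
  case False
  then have "ennreal x = 0" by (simp add: ennreal_eq_0_iff)
  then show ?thesis
    using assms by (simp add: ext_ln_def)
qed

lemma ext_ln_div_ge:
  assumes "0 < n" "exp (r * real n) \<le> x"
  shows "ereal r \<le> ext_ln (ennreal x) / ereal (real n)"
proof -
  have x: "0 < x" using assms(2) exp_gt_zero[of "r * real n"] by linarith
  then have "r * real n \<le> ln x"
    using assms by (simp add: ln_ge_iff)
  then show ?thesis
    using assms x by (simp add: ext_ln_def ennreal_eq_0_iff pos_le_divide_eq)
qed

lemma superexponential_decay_summable:
  fixes p :: "nat pmf"
  assumes "(\<lambda>l. ext_ln (ennreal (pmf p l)) / ereal (real l)) \<longlonglongrightarrow> -\<infinity>"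
  shows "summable (\<lambda>k. pmf p k * z ^ k)"
proof -
  \<comment> \<open>Decay faster than exp (- c l) with this c beats the powers of z by a factor 1/2
    per step.\<close>
  define c where "c = ln (2 * \<bar>z\<bar> + 1)"
  have ec: "exp (- c) * \<bar>z\<bar> \<le> 1 / 2"
    by (simp add: c_def exp_minus field_simps)
  have "\<forall>\<^sub>F l in sequentially. ext_ln (ennreal (pmf p l)) / ereal (real l) < ereal (- c)"
    using assms by (rule order_tendstoD(2)) simp
  then have "\<forall>\<^sub>F l in sequentially. norm (pmf p l * z ^ l) \<le> (1 / 2) ^ l"
    using eventually_gt_at_top[of 0]
  proof eventually_elim
    case (elim l)
    have le: "pmf p l \<le> exp (- c) ^ l"
    proof (cases "pmf p l = 0")
      case False
      then have pos: "0 < pmf p l" by (simp add: pmf_pos)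
      then have "ln (pmf p l) / real l < - c"
        using elim by (simp add: ext_ln_def ennreal_eq_0_iff)
      then have "ln (pmf p l) \<le> - c * real l"
        using elim(2) by (simp add: pos_divide_less_eq)
      then have "exp (ln (pmf p l)) \<le> exp (- c * real l)" by (simp only: exp_le_cancel_iff)
      then show ?thesis
        using pos by (simp add: mult.commute flip: exp_of_nat_mult)
    qed simp
    have "norm (pmf p l * z ^ l) = pmf p l * \<bar>z\<bar> ^ l"
      by (simp add: abs_mult power_abs)
    also have "\<dots> \<le> exp (- c) ^ l * \<bar>z\<bar> ^ l"
      using le by (intro mult_right_mono) auto
    also have "\<dots> = (exp (- c) * \<bar>z\<bar>) ^ l"
      by (simp add: power_mult_distrib)
    also have "\<dots> \<le> (1 / 2) ^ l"
      using ec by (intro power_mono) auto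
    finally show ?case .
  qed
  then show ?thesis
    by (rule summable_comparison_test_ev) (simp add: summable_geometric)
qed

lemma pmf_nat_sums: "pmf p sums (1 :: real)" for p :: "nat pmf"
proof -
  have "(\<lambda>i. measure (measure_pmf p) {i}) sums measure (measure_pmf p) (\<Union>i. {i})"
    by (intro measure_pmf.finite_measure_UNION) (auto simp: disjoint_family_on_def)
  moreover have "measure (measure_pmf p) (\<Union>i. {i}) = 1"
    using measure_pmf.prob_space[of p] by simp
  ultimately show ?thesis
    by (simp add: measure_pmf_single)
qed

lemma offspring_law_pmf:
  fixes p :: "nat pmf"
  assumes "0 < pmf p 0" and "pmf p 0 < 1 - pmf p 1"
    and "(\<lambda>l. real l * pmf p l) sums 1"
    and "(\<lambda>l. ext_ln (ennreal (pmf p l)) / ereal (real l)) \<longlonglongrightarrow> -\<infinity>"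
  shows "offspring_law (pmf p)"
proof
  show "\<exists>K\<ge>2. 0 < pmf p K"
  proof (rule ccontr)
    assume "\<not> ?thesis"
    then have "pmf p k = 0" if "k \<notin> {..<2}" for k
      using that pmf_pos[of p k] by (metis lessThan_iff not_le)
    then have "pmf p sums (\<Sum>k<2. pmf p k)"
      by (intro sums_finite) auto
    then have "(\<Sum>k<2. pmf p k) = 1"
      using pmf_nat_sums[of p] by (rule sums_unique2)
    then show False using assms(2) by (simp add: numeral_2_eq_2)
  qed
qed (use assms pmf_nat_sums superexponential_decay_summable in auto)

lemma step_law_rtrancl:
  "0 < pmf (step_law Q n a) b \<Longrightarrow> (a, b) \<in> {(a, b). 0 < pmf (Q a) b}\<^sup>*"
proof (induction n arbitrary: b)
  case 0
  then show ?case by (simp add: pmf_eq_0_set_pmf indicator_def split: if_splits)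
next
  case (Suc n)
  then have "b \<in> set_pmf (step_law Q (Suc n) a)"
    by (simp add: set_pmf_iff del: step_law.simps)
  then obtain c where c: "c \<in> set_pmf (step_law Q n a)" "b \<in> set_pmf (Q c)"
    by auto
  then have "(a, c) \<in> {(a, b). 0 < pmf (Q a) b}\<^sup>*"
    by (intro Suc.IH) (simp add: pmf_positive)
  moreover have "(c, b) \<in> {(a, b). 0 < pmf (Q a) b}"
    using c by (simp add: pmf_positive)
  ultimately show ?case by (rule rtrancl_into_rtrancl)
qed

lemma tree_chain_pmf:
  fixes Q :: "'a::finite \<Rightarrow> 'a pmf"
  assumes "offspring_law (pmf p)" "irreducible_kernel Q"
  shows "tree_chain (pmf p) (\<lambda>a b. pmf (Q a) b)"
proof -
  interpret offspring_law "pmf p" by fact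
  show ?thesis
  proof
    show "(\<Sum>b\<in>UNIV. pmf (Q a) b) = 1" for a
      by (rule sum_pmf_eq_1) auto
    show "(a, b) \<in> {(a, b). 0 < pmf (Q a) b}\<^sup>*" for a b
      using assms(2) step_law_rtrancl[of Q _ a b] unfolding irreducible_kernel_def by blast
  qed simp
qed

lemma openin_prob_vectorsE:
  assumes "openin (top_of_set S) U"
  obtains V where "open V" "U = S \<inter> V"
  using assms by (auto simp: openin_open)

section \<open>The rate function as a supremum of linear functions\<close>

context
  fixes p :: "nat pmf" and Q :: "'a::finite \<Rightarrow> 'a pmf"
  assumes chain: "tree_chain (pmf p) (\<lambda>a b. pmf (Q a) b)"
begin

interpretation tree_chain "pmf p" "\<lambda>a b. pmf (Q a) b"
  by (rule chain)

lemma cramer_rate_eq: "cramer_rate p x = cramer_sup x 1"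
proof -
  have "ext_ln (\<Sum>n. ennreal (pmf p n * exp (l * real n))) = ereal (ln (gf (exp l)))" for l
  proof -
    have "exp (l * real n) = exp l ^ n" for n
      by (simp add: mult.commute flip: exp_of_nat_mult)
    then have "(\<Sum>n. ennreal (pmf p n * exp (l * real n))) = ennreal (gf (exp l))"
      unfolding gf_def by (simp add: suminf_ennreal2 p_summable)
    then show ?thesis
      using gf_pos[of "exp l"] by (simp add: ext_ln_def ennreal_eq_0_iff)
  qed
  then show ?thesis
    unfolding cramer_rate_def cramer_sup_def by (intro SUP_cong refl) (simp only: ereal_minus mult.commute mult_1)
qed

lemma cramer_sup_scale:
  assumes y: "0 < y"
  shows "ereal y * cramer_sup (x / y) 1 = cramer_sup x y"
proof (rule antisym)
  have eq: "ereal y * ereal (x / y * l - 1 * ln (gf (exp l))) = ereal (x * l - y * ln (gf (exp l)))" for l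
    using y by (simp add: right_diff_distrib)
  have "cramer_sup (x / y) 1 \<le> cramer_sup x y / ereal y"
    unfolding cramer_sup_def[of "x / y"]
  proof (rule SUP_least)
    fix l
    have "ereal y * ereal (x / y * l - 1 * ln (gf (exp l))) \<le> cramer_sup x y"
      unfolding eq cramer_sup_def by (rule SUP_upper) simp
    then show "ereal (x / y * l - 1 * ln (gf (exp l))) \<le> cramer_sup x y / ereal y"
      using y by (subst ereal_le_divide_pos) auto
  qed
  then show "ereal y * cramer_sup (x / y) 1 \<le> cramer_sup x y"
    using y by (subst (asm) ereal_le_divide_pos) auto
  show "cramer_sup x y \<le> ereal y * cramer_sup (x / y) 1"
    unfolding cramer_sup_def[of x y]
  proof (rule SUP_least)
    fix l
    have "ereal (x / y * l - 1 * ln (gf (exp l))) \<le> cramer_sup (x / y) 1"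
      unfolding cramer_sup_def by (rule SUP_upper) simp
    then show "ereal (x * l - y * ln (gf (exp l))) \<le> ereal y * cramer_sup (x / y) 1"
      unfolding eq[symmetric] using y by (intro ereal_mult_left_mono) auto
  qed
qed

text \<open>When both absolute continuities hold this is \<open>entropy_eq_SUP_lin_rate\<close>;
  each failure matches one of the infinite suprema. If \<mu> charges (a, b) but the product does
  not, the first marginal at a is positive, so Q vanishes at (a, b).\<close>

lemma pair_rate_function_eq:
  assumes \<mu>: "\<mu> \<in> prob_vectors"
  shows "pair_rate_function p Q \<mu> = (SUP g. ereal (lin_rate g \<mu>))"
proof -
  have kp: "0 \<le> kernel_product (marginal1 \<mu>) Q $ e" for e
    using marginal_nonneg(1)[OF \<mu>] by (simp add: kernel_product_def)
  have ac: "absolutely_continuous (vec_measure (marginal2 \<mu>)) (vec_measure (marginal1 \<mu>)) \<longleftrightarrow>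
      (\<forall>a. marginal2 \<mu> $ a = 0 \<longrightarrow> marginal1 \<mu> $ a = 0)"
    by (intro absolutely_continuous_vec_measure marginal_nonneg[OF \<mu>])
  have re: "relative_entropy (vec_measure \<mu>) (vec_measure (kernel_product (marginal1 \<mu>) Q)) =
      (if \<forall>e. kernel_product (marginal1 \<mu>) Q $ e = 0 \<longrightarrow> \<mu> $ e = 0
       then ereal (pair_entropy \<mu>) else \<infinity>)"
    by (subst relative_entropy_vec_measure[OF prob_vectors_nonneg[OF \<mu>] kp])
       (simp add: pair_entropy_def kernel_product_def)
  have cs: "(if marginal2 \<mu> $ a = 0 then 0
      else ereal (marginal2 \<mu> $ a) * cramer_rate p (marginal1 \<mu> $ a / marginal2 \<mu> $ a)) =
      cramer_sup (marginal1 \<mu> $ a) (marginal2 \<mu> $ a)"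
    if "marginal2 \<mu> $ a = 0 \<longrightarrow> marginal1 \<mu> $ a = 0" for a
  proof (cases "marginal2 \<mu> $ a = 0")
    case True
    then show ?thesis using that by (simp add: cramer_sup_def zero_ereal_def)
  next
    case False
    then have "0 < marginal2 \<mu> $ a" using marginal_nonneg(2)[OF \<mu>, of a] by simp
    then show ?thesis using False by (simp add: cramer_rate_eq cramer_sup_scale)
  qed
  show ?thesis
  proof (cases "\<forall>a. marginal2 \<mu> $ a = 0 \<longrightarrow> marginal1 \<mu> $ a = 0")
    case False
    then show ?thesis
      using SUP_lin_rate_infinite1[OF \<mu>] by (auto simp: pair_rate_function_def ac)
  next
    case True
    note m = True
    have I: "pair_rate_function p Q \<mu> =
        relative_entropy (vec_measure \<mu>) (vec_measure (kernel_product (marginal1 \<mu>) Q)) +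
        (\<Sum>a\<in>UNIV. cramer_sup (marginal1 \<mu> $ a) (marginal2 \<mu> $ a))"
      using m cs by (simp add: pair_rate_function_def ac)
    show ?thesis
    proof (cases "\<forall>e. kernel_product (marginal1 \<mu>) Q $ e = 0 \<longrightarrow> \<mu> $ e = 0")
      case True
      then have "\<mu> $ (a, b) = 0" if "pmf (Q a) b = 0" for a b
        using that by (auto simp: kernel_product_def)
      then show ?thesis
        using True entropy_eq_SUP_lin_rate[OF \<mu>] by (simp add: I re)
    next
      case False
      then obtain a b where ab: "pmf (Q a) b * marginal1 \<mu> $ a = 0" "\<mu> $ (a, b) \<noteq> 0"
        by (auto simp: kernel_product_def)
      then have "marginal1 \<mu> $ a \<noteq> 0"
        using le_marginal(1)[OF \<mu>, of a b] prob_vectors_nonneg[OF \<mu>, of "(a, b)"] by auto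
      then have "(SUP g. ereal (lin_rate g \<mu>)) = \<infinity>"
        using ab SUP_lin_rate_infinite2[OF \<mu>, of a b] by simp
      then show ?thesis unfolding I re if_not_P[OF False] by simp
    qed
  qed
qed

lemma good_pair_rate_function: "good_rate_function prob_vectors (pair_rate_function p Q)"
  unfolding good_rate_function_def
proof (intro conjI ballI allI)
  fix \<mu> :: "real ^ ('a \<times> 'a)" assume "\<mu> \<in> prob_vectors"
  then show "0 \<le> pair_rate_function p Q \<mu>"
    by (simp add: pair_rate_function_eq SUP_lin_rate_nonneg)
next
  fix \<alpha> :: real
  have "{\<mu> \<in> prob_vectors. pair_rate_function p Q \<mu> \<le> ereal \<alpha>} =
      prob_vectors \<inter> (\<Inter>g. {\<mu>. lin_rate g \<mu> \<le> \<alpha>})"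
    by (auto simp: pair_rate_function_eq SUP_le_iff)
  moreover have "compact (prob_vectors \<inter> (\<Inter>g. {\<mu>. lin_rate g \<mu> \<le> \<alpha>}))"
    by (intro compact_Int_closed prob_vectors_compact closed_INT ballI closed_Collect_le
        continuous_lin_rate continuous_intros)
  ultimately show "compact {\<mu> \<in> prob_vectors. pair_rate_function p Q \<mu> \<le> ereal \<alpha>}"
    by simp
qed

lemma convex_pair_rate_function: "ereal_convex_on prob_vectors (pair_rate_function p Q)"
  unfolding ereal_convex_on_def
proof (intro conjI ballI convex_prob_vectors)
  fix \<mu> \<nu> :: "real ^ ('a \<times> 'a)" and t :: real
  assume \<mu>: "\<mu> \<in> prob_vectors" and \<nu>: "\<nu> \<in> prob_vectors" and t: "t \<in> {0..1}"
  have "(1 - t) *\<^sub>R \<mu> + t *\<^sub>R \<nu> \<in> prob_vectors"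
    using convexD[OF convex_prob_vectors \<mu> \<nu>, of "1 - t" t] t by simp
  moreover have "ereal (lin_rate g ((1 - t) *\<^sub>R \<mu> + t *\<^sub>R \<nu>)) \<le>
      ereal (1 - t) * pair_rate_function p Q \<mu> + ereal t * pair_rate_function p Q \<nu>" for g
  proof -
    have "ereal (lin_rate g \<mu>) \<le> pair_rate_function p Q \<mu>" "ereal (lin_rate g \<nu>) \<le> pair_rate_function p Q \<nu>"
      by (auto simp: pair_rate_function_eq \<mu> \<nu> intro: SUP_upper)
    then have "ereal (1 - t) * ereal (lin_rate g \<mu>) + ereal t * ereal (lin_rate g \<nu>) \<le>
        ereal (1 - t) * pair_rate_function p Q \<mu> + ereal t * pair_rate_function p Q \<nu>"
      using t by (intro add_mono ereal_mult_left_mono) auto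
    then show ?thesis by (simp add: lin_rate_convex)
  qed
  ultimately show "pair_rate_function p Q ((1 - t) *\<^sub>R \<mu> + t *\<^sub>R \<nu>) \<le>
      ereal (1 - t) * pair_rate_function p Q \<mu> + ereal t * pair_rate_function p Q \<nu>"
    by (simp add: pair_rate_function_eq SUP_le_iff)
qed

section \<open>Bounds for the conditional probabilities\<close>

context
  fixes init :: "'a pmf"
begin

definition tree_prob :: "(real ^ ('a \<times> 'a)) set \<Rightarrow> nat \<Rightarrow> real" where
  "tree_prob S n = (\<Sum>t | tsize t = n \<and> empirical t \<in> S.
     pmf init (lab t) * weight (pmf p) (\<lambda>a b. pmf (Q a) b) t)"

lemma weight_Q_nonneg: "0 \<le> weight (pmf p) (\<lambda>a b. pmf (Q a) b) t"
  by (rule weight_nonneg) auto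

lemma tree_prob_nonneg: "0 \<le> tree_prob S n"
  unfolding tree_prob_def by (intro sum_nonneg mult_nonneg_nonneg weight_Q_nonneg) simp

text \<open>Of the gain \<eta> - \<beta> in \<open>chernoff_compact\<close>, half pays for dividing
  by the probability of size n; the rest dominates the constants.\<close>

lemma tree_prob_upper:
  assumes C: "compact C" and ex: "\<And>\<mu>. \<mu> \<in> C \<Longrightarrow> \<exists>g. \<beta> < lin_rate g \<mu>"
  shows "\<forall>\<^sub>F n in sequentially. 0 < tree_prob UNIV n \<longrightarrow>
    tree_prob C n / tree_prob UNIV n \<le> exp (- \<beta> * real n)"
proof -
  obtain \<eta> R where \<eta>: "\<beta> < \<eta>" and R: "\<And>n. 2 \<le> n \<Longrightarrow>
      (\<Sum>t | tsize t = n \<and> empirical t \<in> C. weight (pmf p) (tilted (\<lambda>_. 0)) t) \<le> R * exp (- \<eta> * real (n - 1))"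
    using chernoff_compact[OF C, of \<beta> "\<lambda>_. 0"] ex by auto
  define \<delta> where "\<delta> = (\<eta> - \<beta>) / 2"
  have \<delta>: "0 < \<delta>" "\<beta> + \<delta> < \<eta>" using \<eta> by (auto simp: \<delta>_def field_simps)
  obtain c where c: "0 < c" "\<And>n. 0 < tree_prob UNIV n \<Longrightarrow> c * exp (- \<delta> * real n) \<le> tree_prob UNIV n"
    using critical_mass_lower_bound[OF critical_tilt_stationary_pairs \<delta>(1), of "pmf init"]
    by (auto simp: tree_prob_def)
  have "\<forall>\<^sub>F n in sequentially. R * exp (- \<eta> * real (n - 1)) \<le> c * exp (- (\<beta> + \<delta>) * real n)"
    using c \<delta> by (intro eventually_exp_dominates)
  then show ?thesis
    using eventually_ge_at_top[of 2]
  proof (eventually_elim, intro impI)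
    fix n :: nat assume n: "2 \<le> n" and pos: "0 < tree_prob UNIV n"
      and le: "R * exp (- \<eta> * real (n - 1)) \<le> c * exp (- (\<beta> + \<delta>) * real n)"
    have "tree_prob C n \<le> (\<Sum>t | tsize t = n \<and> empirical t \<in> C. weight (pmf p) (\<lambda>a b. pmf (Q a) b) t)"
      unfolding tree_prob_def by (intro sum_mono mult_left_le_one_le weight_Q_nonneg) (auto simp: pmf_le_1)
    also have "\<dots> \<le> c * exp (- (\<beta> + \<delta>) * real n)"
      using R[OF n] le by simp
    also have "\<dots> = exp (- \<beta> * real n) * (c * exp (- \<delta> * real n))"
      by (simp add: algebra_simps flip: exp_add)
    also have "\<dots> \<le> exp (- \<beta> * real n) * tree_prob UNIV n"
      using c(2)[OF pos] by (intro mult_left_mono) auto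
    finally show "tree_prob C n / tree_prob UNIV n \<le> exp (- \<beta> * real n)"
      using pos by (simp add: pos_divide_le_eq)
  qed
qed

text \<open>A mixture of \<mu> with the stationary pair measure, close enough to \<mu> to lie in U,
  has a critical tilt whose rate there is at most s, so \<open>critical_lower_bound\<close> applies
  at the mixture.\<close>

lemma tree_prob_lower:
  assumes U: "openin (top_of_set prob_vectors) U" and \<mu>: "\<mu> \<in> U" "pair_rate_function p Q \<mu> \<le> ereal s"
    and \<delta>: "0 < \<delta>" and le1: "\<And>n. tree_prob UNIV n \<le> 1"
  shows "\<forall>\<^sub>F n in sequentially. 0 < tree_prob UNIV n \<longrightarrow>
    exp (- (s + \<delta>) * real n) \<le> tree_prob U n / tree_prob UNIV n"
proof -
  obtain V where V: "open V" "U = prob_vectors \<inter> V"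
    using U by (rule openin_prob_vectorsE)
  have \<mu>': "\<mu> \<in> prob_vectors" "\<mu> \<in> V" using \<mu> V by auto
  have S: "(SUP g. ereal (lin_rate g \<mu>)) \<le> ereal s"
    using \<mu> \<mu>' by (simp add: pair_rate_function_eq)
  then obtain s' where s': "(SUP g. ereal (lin_rate g \<mu>)) = ereal s'" "s' \<le> s"
    using SUP_lin_rate_nonneg[of \<mu>] by (cases "SUP g. ereal (lin_rate g \<mu>)") auto
  have "((\<lambda>\<epsilon>. (1 - \<epsilon>) *\<^sub>R \<mu> + \<epsilon> *\<^sub>R stationary_pairs) \<longlongrightarrow> (1 - 0) *\<^sub>R \<mu> + 0 *\<^sub>R stationary_pairs) (at_right 0)"
    by (intro tendsto_intros)
  then have "\<forall>\<^sub>F \<epsilon> in at_right 0. (1 - \<epsilon>) *\<^sub>R \<mu> + \<epsilon> *\<^sub>R stationary_pairs \<in> V"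
    using V(1) \<mu>'(2) by (intro topological_tendstoD) auto
  moreover have "\<forall>\<^sub>F \<epsilon> in at_right 0. 0 < \<epsilon> \<and> \<epsilon> < (1 :: real)"
    by (rule eventually_at_rightI[of 0 1]) auto
  ultimately have "\<forall>\<^sub>F \<epsilon> in at_right 0. 0 < \<epsilon> \<and> \<epsilon> < 1 \<and> (1 - \<epsilon>) *\<^sub>R \<mu> + \<epsilon> *\<^sub>R stationary_pairs \<in> V"
    by eventually_elim auto
  then obtain \<epsilon> where \<epsilon>: "0 < \<epsilon>" "\<epsilon> < 1" "(1 - \<epsilon>) *\<^sub>R \<mu> + \<epsilon> *\<^sub>R stationary_pairs \<in> V"
    using eventually_happens'[OF trivial_limit_at_right_real] by blast
  obtain g where g: "critical_tilt g ((1 - \<epsilon>) *\<^sub>R \<mu> + \<epsilon> *\<^sub>R stationary_pairs)"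
      "lin_rate g ((1 - \<epsilon>) *\<^sub>R \<mu> + \<epsilon> *\<^sub>R stationary_pairs) \<le> s'"
    using critical_tilt_approx[OF \<mu>'(1) s'(1) \<epsilon>(1,2)] by blast
  define x where "x = lin_rate g ((1 - \<epsilon>) *\<^sub>R \<mu> + \<epsilon> *\<^sub>R stationary_pairs)"
  obtain c where c: "0 < c" "\<forall>\<^sub>F n in sequentially. 0 < tree_prob UNIV n \<longrightarrow>
      c * exp (- (x + \<delta> / 2) * real n) \<le> tree_prob U n"
    using critical_lower_bound[OF g(1), of "\<delta> / 2" "pmf init" V] \<delta> V \<epsilon>(3)
    by (auto simp: tree_prob_def x_def pmf_le_1)
  have "\<forall>\<^sub>F n in sequentially. exp (- (s + \<delta>)) * exp (- (s + \<delta>) * real (n - 1)) \<le> c * exp (- (x + \<delta> / 2) * real n)"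
    using c(1) g(2) s'(2) \<delta> by (intro eventually_exp_dominates) (auto simp: x_def)
  then show ?thesis
    using c(2) eventually_ge_at_top[of 1]
  proof (eventually_elim, intro impI)
    fix n :: nat assume n: "1 \<le> n" and pos: "0 < tree_prob UNIV n"
      and 1: "exp (- (s + \<delta>)) * exp (- (s + \<delta>) * real (n - 1)) \<le> c * exp (- (x + \<delta> / 2) * real n)"
      and 2: "0 < tree_prob UNIV n \<longrightarrow> c * exp (- (x + \<delta> / 2) * real n) \<le> tree_prob U n"
    have "exp (- (s + \<delta>) * real n) = exp (- (s + \<delta>)) * exp (- (s + \<delta>) * real (n - 1))"
      using n by (simp add: of_nat_diff algebra_simps flip: exp_add)
    also have "\<dots> \<le> tree_prob U n" using 1 2 pos by simp
    \<comment> \<open>Conditioning only increases the lower bound, the denominator being at most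
      1.\<close>
    also have "\<dots> \<le> tree_prob U n / tree_prob UNIV n"
      using pos le1[of n] tree_prob_nonneg[of U n] by (simp add: pos_le_divide_eq mult_left_le)
    finally show "exp (- (s + \<delta>) * real n) \<le> tree_prob U n / tree_prob UNIV n" .
  qed
qed

text \<open>\<open>le1\<close> is an assumption because this context knows only weights; it holds
  once \<open>tree_prob UNIV n\<close> is recognised as the probability of size n.\<close>

lemma ldp_tree_prob:
  assumes le1: "\<And>n. tree_prob UNIV n \<le> 1"
  shows "large_deviation_principle prob_vectors
    (inf sequentially (principal {n. 0 < tree_prob UNIV n})) real
    (\<lambda>n S. tree_prob S n / tree_prob UNIV n) (pair_rate_function p Q)"
  unfolding large_deviation_principle_def
proof (intro conjI allI impI)
  fix C :: "(real ^ ('a \<times> 'a)) set"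
  assume "closedin (top_of_set prob_vectors) C"
  then have C: "compact C" "C \<subseteq> prob_vectors"
    by (rule closedin_compact[OF prob_vectors_compact], rule closedin_imp_subset)
  show "Limsup (inf sequentially (principal {n. 0 < tree_prob UNIV n}))
      (\<lambda>n. ext_ln (ennreal (tree_prob C n / tree_prob UNIV n)) / ereal (real n))
      \<le> - (INF x\<in>C. pair_rate_function p Q x)"
    unfolding Limsup_le_iff
  proof (intro allI impI)
    fix z assume "- (INF x\<in>C. pair_rate_function p Q x) < z"
    then have "- z < (INF x\<in>C. pair_rate_function p Q x)"
      by (simp add: ereal_uminus_less_reorder)
    then obtain \<beta> where \<beta>: "- z < ereal \<beta>" "ereal \<beta> < (INF x\<in>C. pair_rate_function p Q x)"
      using ereal_dense2 by blast
    have "\<exists>g. \<beta> < lin_rate g \<mu>" if "\<mu> \<in> C" for \<mu>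
    proof -
      have "ereal \<beta> < pair_rate_function p Q \<mu>"
        using \<beta>(2) that by (meson INF_lower less_le_trans)
      then show ?thesis
        using that C(2) by (auto simp: pair_rate_function_eq less_SUP_iff)
    qed
    then have "\<forall>\<^sub>F n in sequentially. 0 < tree_prob UNIV n \<longrightarrow>
        tree_prob C n / tree_prob UNIV n \<le> exp (- \<beta> * real n)"
      by (rule tree_prob_upper[OF C(1)])
    then show "\<forall>\<^sub>F n in inf sequentially (principal {n. 0 < tree_prob UNIV n}).
        ext_ln (ennreal (tree_prob C n / tree_prob UNIV n)) / ereal (real n) < z"
      unfolding eventually_inf_principal using eventually_gt_at_top[of 0]
    proof (eventually_elim, intro impI)
      fix n :: nat assume "0 < n" "n \<in> {n. 0 < tree_prob UNIV n}"
        "0 < tree_prob UNIV n \<longrightarrow> tree_prob C n / tree_prob UNIV n \<le> exp (- \<beta> * real n)"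
      then have "ext_ln (ennreal (tree_prob C n / tree_prob UNIV n)) / ereal (real n) \<le> ereal (- \<beta>)"
        by (intro ext_ln_div_le) auto
      also have "ereal (- \<beta>) < z" using \<beta>(1) by (cases z) auto
      finally show "ext_ln (ennreal (tree_prob C n / tree_prob UNIV n)) / ereal (real n) < z" .
    qed
  qed
next
  fix U :: "(real ^ ('a \<times> 'a)) set"
  assume U: "openin (top_of_set prob_vectors) U"
  show "- (INF x\<in>U. pair_rate_function p Q x) \<le>
      Liminf (inf sequentially (principal {n. 0 < tree_prob UNIV n}))
      (\<lambda>n. ext_ln (ennreal (tree_prob U n / tree_prob UNIV n)) / ereal (real n))"
    unfolding le_Liminf_iff
  proof (intro allI impI)
    fix z assume "z < - (INF x\<in>U. pair_rate_function p Q x)"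
    then have "(INF x\<in>U. pair_rate_function p Q x) < - z"
      by (simp add: ereal_less_uminus_reorder)
    then obtain \<mu> where \<mu>: "\<mu> \<in> U" "pair_rate_function p Q \<mu> < - z"
      by (auto simp: INF_less_iff)
    then obtain s where s: "pair_rate_function p Q \<mu> < ereal s" "ereal s < - z"
      using ereal_dense2 by blast
    \<comment> \<open>A second intermediate value: s' - s is the \<delta> of
      \<open>tree_prob_lower\<close>, and s' < -z keeps the final inequality strict.\<close>
    then obtain s' where s': "ereal s < ereal s'" "ereal s' < - z"
      using ereal_dense2 by blast
    have "\<forall>\<^sub>F n in sequentially. 0 < tree_prob UNIV n \<longrightarrow>
        exp (- (s + (s' - s)) * real n) \<le> tree_prob U n / tree_prob UNIV n"
      using s(1) s'(1) by (intro tree_prob_lower[OF U \<mu>(1)] le1) auto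
    then show "\<forall>\<^sub>F n in inf sequentially (principal {n. 0 < tree_prob UNIV n}).
        z < ext_ln (ennreal (tree_prob U n / tree_prob UNIV n)) / ereal (real n)"
      unfolding eventually_inf_principal using eventually_gt_at_top[of 0]
    proof (eventually_elim, intro impI)
      fix n :: nat assume n: "0 < n" "n \<in> {n. 0 < tree_prob UNIV n}"
        "0 < tree_prob UNIV n \<longrightarrow> exp (- (s + (s' - s)) * real n) \<le> tree_prob U n / tree_prob UNIV n"
      have "z < ereal (- s')" using s'(2) by (simp add: ereal_less_uminus_reorder)
      also have "ereal (- s') \<le> ext_ln (ennreal (tree_prob U n / tree_prob UNIV n)) / ereal (real n)"
        using n by (intro ext_ln_div_ge) auto
      finally show "z < ext_ln (ennreal (tree_prob U n / tree_prob UNIV n)) / ereal (real n)" .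
    qed
  qed
qed

end
end

theorem theorem2p1:
  fixes M :: "'w measure"
    and T :: "'w \<Rightarrow> nat list set"
    and X :: "'w \<Rightarrow> nat list \<Rightarrow> 'a::finite"
    and p :: "nat pmf"
    and init :: "'a pmf"
    and Q :: "'a \<Rightarrow> 'a pmf"
  assumes "galton_watson_tree M p T"
    and "0 < pmf p 0" and "pmf p 0 < 1 - pmf p 1"
    and "(\<lambda>l. real l * pmf p l) sums 1"
    and "(\<lambda>l. ext_ln (ennreal (pmf p l)) / ereal (real l)) \<longlonglongrightarrow> -\<infinity>"
    and "irreducible_kernel Q"
    and "tree_indexed_markov_chain M init Q T X"
  shows "large_deviation_principle prob_vectors
           (inf sequentially (principal {n. \<P>(\<omega> in M. finite (T \<omega>) \<and> card (T \<omega>) = n) > 0}))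
           real
           (\<lambda>n A. \<P>(\<omega> in M. empirical_pair_measure (T \<omega>) (X \<omega>) \<in> A
                      \<bar> finite (T \<omega>) \<and> card (T \<omega>) = n))
           (pair_rate_function p Q)
       \<and> good_rate_function prob_vectors (pair_rate_function p Q)
       \<and> ereal_convex_on prob_vectors (pair_rate_function p Q)"
proof -
  have chain: "tree_chain (pmf p) (\<lambda>a b. pmf (Q a) b)"
    using assms by (intro tree_chain_pmf offspring_law_pmf)
  interpret prob_space M by (rule prob_space_M[OF assms(1,7)])
  have joint: "\<P>(\<omega> in M. empirical_pair_measure (T \<omega>) (X \<omega>) \<in> A \<and> finite (T \<omega>) \<and> card (T \<omega>) = n) =
      tree_prob p Q init A n" for A n
    unfolding tree_prob_def[OF chain] by (rule prob_empirical[OF assms(1,7)])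
  have size: "\<P>(\<omega> in M. finite (T \<omega>) \<and> card (T \<omega>) = n) = tree_prob p Q init UNIV n" for n
    using joint[of UNIV n] by simp
  have cond: "\<P>(\<omega> in M. empirical_pair_measure (T \<omega>) (X \<omega>) \<in> A \<bar> finite (T \<omega>) \<and> card (T \<omega>) = n) =
      tree_prob p Q init A n / tree_prob p Q init UNIV n" for A n
    unfolding cond_prob_def joint size ..
  show ?thesis
    unfolding cond size
    by (intro conjI ldp_tree_prob[OF chain] good_pair_rate_function[OF chain] convex_pair_rate_function[OF chain])
       (simp add: size[symmetric])
qed

end
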